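(* Let $\mathcal{S}'$ be a two-dimensional model (a projected two-dimensional model with at most six steps, as defined in the context) whose associated group $G(\mathcal{S}')=\langle \phi,\psi\rangle$ has order at least $200$. (Up to exchanging $x$ and $y$ there are $409$ such models.) Then $G(\mathcal{S}')$ is infinite.
   Context: A model is a finite set of steps $\mathcal{S}\subset\{-1,0,1\}^3\setminus\{(0,0,0)\}$. An octant walk is a finite walk starting at $(0,0,0)$, with steps in $\mathcal{S}$, all of whose points lie in $\mathbb{N}^3$, where $\mathbb{N}=\{0,1,2,\dots\}$. Dimension: for a step $s=(s_x,s_y,s_z)$, consider the three inequalities $$\sum_{s\in\mathcal{S}}a_ss_x\ge 0,\qquad \sum_{s\in\mathcal{S}}a_ss_y\ge 0,\qquad \sum_{s\in\mathcal{S}}a_ss_z\ge 0$$ in non-negative integers $(a_s)_{s\in\mathcal{S}}$. The model $\mathcal{S}$ has dimension at most $d$ ($d\in\{0,1,2,3\}$) if one can choose $d$ of these inequalities such that every tuple of non-negative integers satisfying these $d$ inequalities satisfies all three; it has dimension $d$ if $d$ is the least such number. Non-trivial models: $\mathcal{S}$ is non-trivial if its dimension is $2$ or $3$ and every step of $\mathcal{S}$ occurs in at least one octant walk with steps in $\mathcal{S}$. Models are counted up to permutations of the coordinates. Projected two-dimensional models: let $\mathcal{S}$ be a non-trivial model of dimension $2$ with $|\mathcal{S}|\le 6$. After permuting coordinates assume that the $z$-inequality is redundant, i.e. implied by the $x$- and $y$-inequalities. The model is then identified with the multiset $\mathcal{S}'=\{(i,j):(i,j,k)\in\mathcal{S}\}$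 of steps of $\{-1,0,1\}^2\setminus\{(0,0)\}$ (null projected steps $(0,0)$ being discarded), with multiplicities. Such multisets are called two-dimensional models and are counted up to exchanging $x$ and $y$. Group: the characteristic polynomial of $\mathcal{S}'$ is the Laurent polynomial $S(x,y)=\sum_{(i,j)\in\mathcal{S}'}x^iy^j$ (sum with multiplicity). Write $$S(x,y)=x^{-1}A_-(y)+A_0(y)+xA_+(y)=y^{-1}B_-(x)+B_0(x)+yB_+(x).$$ For these models $A_\pm$ and $B_\pm$ are non-zero. The associated group $G(\mathcal{S}')$ is the group of birational transformations of $[x,y]$ generated by the involutions $$\phi([x,y])=\left[\frac1x\frac{A_-(y)}{A_+(y)},\,y\right],\qquad \psi([x,y])=\left[x,\,\frac1y\frac{B_-(x)}{B_+(x)}\right].$$ An infinite group is regarded as having order at least $200$. *)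

theory Defs
  imports
    "HOL-Computational_Algebra.Computational_Algebra"
    "HOL-Computational_Algebra.Field_as_Ring"
    "HOL-Algebra.Generated_Groups"
begin

section \<open>Octant models, dimension, non-triviality\<close>

type_synonym step3 = "int \<times> int \<times> int"

definition coord :: "nat \<Rightarrow> step3 \<Rightarrow> int" where
  "coord c = (\<lambda>(x, y, z). [x, y, z] ! c)"

definition model3 :: "step3 set \<Rightarrow> bool" where
  "model3 S \<longleftrightarrow> S \<subseteq> ({-1, 0, 1} \<times> {-1, 0, 1} \<times> {-1, 0, 1}) - {(0, 0, 0)}"

definition octant_walk :: "step3 set \<Rightarrow> step3 list \<Rightarrow> bool" where
  "octant_walk S w \<longleftrightarrow> set w \<subseteq> S \<and>
     (\<forall>n\<le>length w. \<forall>c<3. 0 \<le> (\<Sum>s\<leftarrow>take n w. coord c s))"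

definition coord_ineq :: "step3 set \<Rightarrow> (step3 \<Rightarrow> nat) \<Rightarrow> nat \<Rightarrow> bool" where
  "coord_ineq S a c \<longleftrightarrow> 0 \<le> (\<Sum>s\<in>S. int (a s) * coord c s)"

definition ineqs_suffice :: "step3 set \<Rightarrow> nat set \<Rightarrow> bool" where
  "ineqs_suffice S I \<longleftrightarrow>
     (\<forall>a. (\<forall>c\<in>I. coord_ineq S a c) \<longrightarrow> (\<forall>c<3. coord_ineq S a c))"

definition dim_at_most :: "step3 set \<Rightarrow> nat \<Rightarrow> bool" where
  "dim_at_most S d \<longleftrightarrow> (\<exists>I\<subseteq>{..<3}. card I = d \<and> ineqs_suffice S I)"

definition dimension :: "step3 set \<Rightarrow> nat" where
  "dimension S = (LEAST d. dim_at_most S d)"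

definition nontrivial_model :: "step3 set \<Rightarrow> bool" where
  "nontrivial_model S \<longleftrightarrow> dimension S \<in> {2, 3} \<and>
     (\<forall>s\<in>S. \<exists>w. octant_walk S w \<and> s \<in> set w)"

section \<open>Projected two-dimensional models\<close>

definition projection :: "step3 set \<Rightarrow> (int \<times> int) multiset" where
  "projection S = {# p \<in># image_mset (\<lambda>(i, j, k). (i, j)) (mset_set S). p \<noteq> (0, 0) #}"

text \<open>
  The class of non-trivial models of dimension 2 is closed under permutations of the
  coordinates, so it suffices to quantify over those models whose z-inequality is
  implied by the x- and y-inequalities.
\<close>

definition two_dim_model :: "(int \<times> int) multiset \<Rightarrow> bool" where
  "two_dim_model M \<longleftrightarrow>
     (\<exists>S. model3 S \<and> card S \<le> 6 \<and> nontrivial_model S \<and> dimension S = 2 \<and>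
          ineqs_suffice S {0, 1} \<and> M = projection S)"

definition exchange_xy :: "(int \<times> int) multiset \<Rightarrow> (int \<times> int) multiset" where
  "exchange_xy M = image_mset prod.swap M"

section \<open>Birational transformations of the plane\<close>

text \<open>
  The field of rational functions in x and y is the fraction field of the polynomial ring
  in y over the polynomial ring in x. A rational map of the plane is the pair of its
  components.
\<close>

type_synonym bipoly = "rat poly poly"
type_synonym ratfun = "rat poly poly fract"
type_synonym ratmap = "ratfun \<times> ratfun"

definition var_x :: ratfun where
  "var_x = to_fract [:[:0, 1:]:]"

definition var_y :: ratfun where
  "var_y = to_fract [:0, 1:]"

definition const_fun :: "rat \<Rightarrow> ratfun" where
  "const_fun c = to_fract [:[:c:]:]"

definition eval_poly1 :: "rat poly \<Rightarrow> ratfun \<Rightarrow> ratfun" where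
  "eval_poly1 p F = poly (map_poly const_fun p) F"

definition eval_poly2 :: "ratmap \<Rightarrow> bipoly \<Rightarrow> ratfun" where
  "eval_poly2 P p = poly (map_poly (\<lambda>q. eval_poly1 q (fst P)) p) (snd P)"

definition dominant :: "ratmap \<Rightarrow> bool" where
  "dominant P \<longleftrightarrow> (\<forall>p. eval_poly2 P p = 0 \<longrightarrow> p = 0)"

text \<open>
  \<^term>\<open>rat_subst P f\<close> is f after P. It is only meaningful for dominant P, where the
  denominator below cannot vanish.
\<close>

definition rat_subst :: "ratmap \<Rightarrow> ratfun \<Rightarrow> ratfun" where
  "rat_subst P f = (case quot_of_fract f of (a, b) \<Rightarrow> eval_poly2 P a / eval_poly2 P b)"

definition map_comp2 :: "ratmap \<Rightarrow> ratmap \<Rightarrow> ratmap" where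
  "map_comp2 P Q = (rat_subst Q (fst P), rat_subst Q (snd P))"

definition dominant_maps :: "ratmap monoid" where
  "dominant_maps = \<lparr>carrier = {P. dominant P}, mult = map_comp2, one = (var_x, var_y)\<rparr>"

definition birational_group :: "ratmap monoid" where
  "birational_group = units_of dominant_maps"

section \<open>The group of a two-dimensional model\<close>

definition model_char_poly :: "(int \<times> int) multiset \<Rightarrow> ratfun" where
  "model_char_poly M = (\<Sum>(i, j)\<in>#M. var_x powi i * var_y powi j)"

text \<open>
  \<open>x_part M (-1)\<close>, \<open>x_part M 0\<close>, \<open>x_part M 1\<close> are the Laurent polynomials
  \<open>A\<^sub>-\<close>, \<open>A\<^sub>0\<close>, \<open>A\<^sub>+\<close>, and likewise \<open>y_part\<close> for \<open>B\<close>.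
\<close>

definition x_part :: "(int \<times> int) multiset \<Rightarrow> int \<Rightarrow> ratfun" where
  "x_part M e = (\<Sum>(i, j)\<in>#{# p \<in># M. fst p = e #}. var_y powi j)"

definition y_part :: "(int \<times> int) multiset \<Rightarrow> int \<Rightarrow> ratfun" where
  "y_part M e = (\<Sum>(i, j)\<in>#{# p \<in># M. snd p = e #}. var_x powi i)"

lemma model_char_poly_x_parts:
  assumes "set_mset M \<subseteq> {-1, 0, 1} \<times> {-1, 0, 1}"
  shows "model_char_poly M =
    inverse var_x * x_part M (-1) + x_part M 0 + var_x * x_part M 1"
  using assms
  by (induction M) (auto simp: model_char_poly_def x_part_def power_int_minus algebra_simps)

lemma model_char_poly_y_parts:
  assumes "set_mset M \<subseteq> {-1, 0, 1} \<times> {-1, 0, 1}"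
  shows "model_char_poly M =
    inverse var_y * y_part M (-1) + y_part M 0 + var_y * y_part M 1"
  using assms
  by (induction M) (auto simp: model_char_poly_def y_part_def power_int_minus algebra_simps)

definition phi :: "(int \<times> int) multiset \<Rightarrow> ratmap" where
  "phi M = (1 / var_x * (x_part M (-1) / x_part M 1), var_y)"

definition psi :: "(int \<times> int) multiset \<Rightarrow> ratmap" where
  "psi M = (var_x, 1 / var_y * (y_part M (-1) / y_part M 1))"

definition model_group :: "(int \<times> int) multiset \<Rightarrow> ratmap monoid" where
  "model_group M = birational_group
     \<lparr>carrier := generate birational_group {phi M, psi M}\<rparr>"

text \<open>The cardinality of an infinite set is 0 in HOL, whence the disjunction.\<close>

definition group_order_ge :: "nat \<Rightarrow> ratmap monoid \<Rightarrow> bool" where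
  "group_order_ge n G \<longleftrightarrow> infinite (carrier G) \<or> n \<le> card (carrier G)"

section \<open>Birational transformations form a group\<close>

lemma const_fun_simps [simp]:
  "const_fun 0 = 0" "const_fun 1 = 1"
  "const_fun (a + b) = const_fun a + const_fun b"
  "const_fun (a * b) = const_fun a * const_fun b"
proof -
  show "const_fun 1 = 1"
    by (simp add: const_fun_def flip: one_pCons)
  have "[:[:a + b:]:] = [:[:a:]:] + [:[:b:]:]" "[:[:a * b:]:] = [:[:a:]:] * [:[:b:]:]"
    by simp_all
  then show "const_fun (a + b) = const_fun a + const_fun b"
    "const_fun (a * b) = const_fun a * const_fun b"
    unfolding const_fun_def by (metis to_fract_add, metis to_fract_mult)
qed (simp add: const_fun_def)

lemma poly_map_poly_hom:
  fixes h :: "'a::comm_ring_1 \<Rightarrow> 'b::comm_ring_1"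
  assumes h: "h 0 = 0" "\<And>a b. h (a + b) = h a + h b" "\<And>a b. h (a * b) = h a * h b"
  shows "poly (map_poly h (p + q)) x = poly (map_poly h p) x + poly (map_poly h q) x"
    and "poly (map_poly h (p * q)) x = poly (map_poly h p) x * poly (map_poly h q) x"
proof -
  have add: "map_poly h (p + q) = map_poly h p + map_poly h q" for p q
    by (intro poly_eqI) (simp add: coeff_map_poly h)
  have smult: "map_poly h (smult c p) = smult (h c) (map_poly h p)" for c p
    by (intro poly_eqI) (simp add: coeff_map_poly h)
  have pC: "map_poly h (pCons c p) = pCons (h c) (map_poly h p)" for c p
    by (intro poly_eqI) (simp add: coeff_map_poly coeff_pCons h split: nat.splits)
  show "poly (map_poly h (p + q)) x = poly (map_poly h p) x + poly (map_poly h q) x"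
    by (simp add: add)
  show "poly (map_poly h (p * q)) x = poly (map_poly h p) x * poly (map_poly h q) x"
    by (induction p) (simp_all add: add smult pC h algebra_simps)
qed

lemma eval_poly1_simps [simp]:
  "eval_poly1 0 F = 0" "eval_poly1 1 F = 1"
  "eval_poly1 (pCons c p) F = const_fun c + F * eval_poly1 p F"
  "eval_poly1 (p + q) F = eval_poly1 p F + eval_poly1 q F"
  "eval_poly1 (p * q) F = eval_poly1 p F * eval_poly1 q F"
  by (simp_all add: eval_poly1_def poly_map_poly_hom map_poly_pCons)

lemma eval_poly2_simps [simp]:
  "eval_poly2 P 0 = 0" "eval_poly2 P 1 = 1"
  "eval_poly2 P (pCons q p) = eval_poly1 q (fst P) + snd P * eval_poly2 P p"
  "eval_poly2 P (p + r) = eval_poly2 P p + eval_poly2 P r"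
  "eval_poly2 P (p * r) = eval_poly2 P p * eval_poly2 P r"
  by (simp_all add: eval_poly2_def poly_map_poly_hom map_poly_pCons)

lemma eval_poly2_vars: "eval_poly2 (var_x, var_y) p = to_fract p"
proof -
  have one: "eval_poly1 q var_x = to_fract [:q:]" for q
  proof (induction q)
    case (pCons c q)
    have "[:pCons c q:] = [:[:c:]:] + [:[:0, 1:]:] * [:q:]"
      by simp
    then show ?case
      by (simp only: to_fract_add to_fract_mult eval_poly1_simps pCons.IH
          flip: const_fun_def var_x_def)
  qed simp
  show ?thesis
  proof (induction p)
    case (pCons q p)
    have "pCons q p = [:q:] + [:0, 1:] * p"
      by simp
    then have "to_fract (pCons q p) = to_fract [:q:] + var_y * to_fract p"
      by (simp only: to_fract_add to_fract_mult var_y_def)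
    then show ?case
      by (simp add: pCons.IH one)
  qed simp
qed

lemma fract_cases:
  fixes f :: ratfun
  obtains a b where "b \<noteq> 0" "f = to_fract a / to_fract b"
  by (metis Fract_cases Fract_conv_to_fract)

lemma rat_subst_fract:
  assumes "dominant P" "b \<noteq> 0"
  shows "rat_subst P (to_fract a / to_fract b) = eval_poly2 P a / eval_poly2 P b"
proof -
  obtain c d where cd: "quot_of_fract (to_fract a / to_fract b) = (c, d)"
    by fastforce
  have d: "d \<noteq> 0"
    using cd by (metis snd_conv snd_quot_of_fract_nonzero)
  have "to_fract a / to_fract b = to_fract c / to_fract d"
    using cd
    by (metis Fract_conv_to_fract case_prod_conv quot_to_fract_def
        quot_to_fract_quot_of_fract)
  with d assms(2) have "to_fract (a * d) = to_fract (c * b)"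
    by (simp add: field_simps)
  then have "eval_poly2 P (a * d) = eval_poly2 P (c * b)"
    by (simp only: to_fract_eq_iff)
  moreover have "eval_poly2 P b \<noteq> 0" "eval_poly2 P d \<noteq> 0"
    using assms d by (auto simp: dominant_def)
  ultimately show ?thesis
    by (simp add: rat_subst_def cd field_simps)
qed

lemma rat_subst_to_fract: "dominant P \<Longrightarrow> rat_subst P (to_fract a) = eval_poly2 P a"
  using rat_subst_fract[of P 1 a] by simp

lemma
  assumes P: "dominant P"
  shows rat_subst_add: "rat_subst P (f + g) = rat_subst P f + rat_subst P g"
    and rat_subst_mult: "rat_subst P (f * g) = rat_subst P f * rat_subst P g"
    and rat_subst_divide: "rat_subst P (f / g) = rat_subst P f / rat_subst P g"
    and rat_subst_eq_0_iff: "rat_subst P f = 0 \<longleftrightarrow> f = 0"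
proof -
  obtain a b where ab: "b \<noteq> 0" "f = to_fract a / to_fract b" by (rule fract_cases)
  obtain c d where cd: "d \<noteq> 0" "g = to_fract c / to_fract d" by (rule fract_cases)
  have nz: "eval_poly2 P q \<noteq> 0" if "q \<noteq> 0" for q
    using P that by (auto simp: dominant_def)
  have sum: "f + g = to_fract (a * d + c * b) / to_fract (b * d)"
    and prod: "f * g = to_fract (a * c) / to_fract (b * d)"
    using ab cd by (simp_all add: field_simps)
  show "rat_subst P (f + g) = rat_subst P f + rat_subst P g"
    unfolding sum rat_subst_fract[OF P no_zero_divisors[OF ab(1) cd(1)]]
    using ab cd P nz by (simp add: rat_subst_fract add_frac_eq)
  show "rat_subst P (f * g) = rat_subst P f * rat_subst P g"
    unfolding prod rat_subst_fract[OF P no_zero_divisors[OF ab(1) cd(1)]]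
    using ab cd P nz by (simp add: rat_subst_fract)
  show "rat_subst P f = 0 \<longleftrightarrow> f = 0"
    using ab P nz by (auto simp: rat_subst_fract)
  show "rat_subst P (f / g) = rat_subst P f / rat_subst P g"
  proof (cases "c = 0")
    case True
    then show ?thesis
      using cd rat_subst_to_fract[OF P, of 0] by simp
  next
    case False
    then have "f / g = to_fract (a * d) / to_fract (b * c)"
      using ab cd by simp
    moreover have "rat_subst P (to_fract (a * d) / to_fract (b * c)) =
        eval_poly2 P (a * d) / eval_poly2 P (b * c)"
      using False ab P by (intro rat_subst_fract) auto
    ultimately show ?thesis
      using False ab cd P nz by (simp add: rat_subst_fract)
  qed
qed

lemma rat_subst_const:
  assumes "dominant P"
  shows "rat_subst P (const_fun c) = const_fun c"
  using rat_subst_to_fract[OF assms, of "[:[:c:]:]"] by (simp flip: const_fun_def)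

lemma rat_subst_vars:
  assumes "dominant P"
  shows "rat_subst P var_x = fst P" "rat_subst P var_y = snd P"
  using rat_subst_to_fract[OF assms, of "[:[:0, 1:]:]"]
    rat_subst_to_fract[OF assms, of "[:0, 1:]"]
  by (simp_all flip: var_x_def var_y_def)

lemma rat_subst_eval_poly2:
  assumes Q: "dominant Q"
  shows "rat_subst Q (eval_poly2 P p) = eval_poly2 (map_comp2 P Q) p"
proof -
  have zero: "rat_subst Q 0 = 0"
    using Q by (simp add: rat_subst_eq_0_iff)
  have one: "rat_subst Q (eval_poly1 q (fst P)) = eval_poly1 q (rat_subst Q (fst P))" for q
    by (induction q) (simp_all add: zero rat_subst_add rat_subst_mult rat_subst_const Q)
  show ?thesis
    by (induction p)
      (simp_all add: zero one rat_subst_add rat_subst_mult Q map_comp2_def)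
qed

lemma dominant_map_comp2:
  "dominant P \<Longrightarrow> dominant Q \<Longrightarrow> dominant (map_comp2 P Q)"
  by (metis dominant_def rat_subst_eq_0_iff rat_subst_eval_poly2)

lemma rat_subst_map_comp2:
  assumes "dominant P" "dominant Q"
  shows "rat_subst Q (rat_subst P f) = rat_subst (map_comp2 P Q) f"
proof -
  obtain a b where "b \<noteq> 0" "f = to_fract a / to_fract b"
    by (rule fract_cases)
  then show ?thesis
    using assms
    by (simp add: rat_subst_fract dominant_map_comp2 rat_subst_eval_poly2
        rat_subst_divide[of Q])
qed

lemma dominant_vars: "dominant (var_x, var_y)"
  by (simp add: dominant_def eval_poly2_vars)

lemma rat_subst_id: "rat_subst (var_x, var_y) f = f"
proof -
  obtain a b where "b \<noteq> 0" "f = to_fract a / to_fract b"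
    by (rule fract_cases)
  then show ?thesis
    by (simp add: rat_subst_fract dominant_vars eval_poly2_vars)
qed

lemma monoid_dominant_maps: "monoid dominant_maps"
proof (rule monoidI, unfold dominant_maps_def, simp_all add: dominant_map_comp2 dominant_vars)
  fix P Q R assume "dominant P" "dominant Q" "dominant R"
  then show "map_comp2 (map_comp2 P Q) R = map_comp2 P (map_comp2 Q R)"
    by (simp add: map_comp2_def[of P] map_comp2_def[of _ R] rat_subst_map_comp2)
qed (simp_all add: map_comp2_def rat_subst_vars rat_subst_id)

lemma group_birational_group: "group birational_group"
  unfolding birational_group_def by (rule monoid.units_group[OF monoid_dominant_maps])

end

theory Submission
  imports Defs
begin

text \<open>
  Order the monomials \<open>x\<^sup>i y\<^sup>j\<close> lexicographically by \<open>(j, i)\<close> and call the lowest term of a rational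
  function its leading term. A composition of the two involutions acts on leading monomials by a
  piecewise linear map of the exponents. For the models whose steps lie in no closed half-plane
  that map is periodic: some power \<open>\<theta>\<^sup>n\<close> of \<open>\<theta> = \<psi>\<phi>\<close> sends \<open>x\<close> and \<open>y\<close> to functions with leading terms
  \<open>c x\<close> and \<open>d y\<close>, where \<open>c, d > 0\<close>. The key fact (\<open>finite_order_leads\<close>) is that such a
  substitution has finite order only if it is the identity. Indeed \<open>c\<close> and \<open>d\<close> must be 1, because their
  powers are. Then the substitution \<open>T\<close> preserves all leading terms, and if \<open>g = T f - f\<close> were non-zero,
  the sum \<open>g + T g + \<dots> + T\<^sup>N\<^sup>-\<^sup>1 g = T\<^sup>N f - f\<close> would have \<open>N\<close> times the leading term of \<open>g\<close>, which is
  not zero in characteristic 0.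

  So the group of such a model is infinite as soon as \<open>\<theta>\<^sup>n \<noteq> 1\<close>. This is visible either from
  \<open>(c, d) \<noteq> (1, 1)\<close> or from the image of one rational point under \<open>\<theta>\<^sup>n\<close>, computed modulo 53. The remaining infinite models
  have their steps in the half-plane \<open>i + j \<ge> 0\<close>; there the exponents of the leading monomials grow
  without bound (\<open>infinite_half_plane\<close>).

  The finite groups come from three mechanisms (\<open>finite_rows_card\<close>): \<open>A\<^sub>- = k A\<^sub>+\<close> or \<open>B\<^sub>- = k B\<^sub>+\<close> makes
  the involutions commute; if \<open>A\<^sub>-/A\<^sub>+\<close> and \<open>B\<^sub>-/B\<^sub>+\<close> are monomials \<open>k y\<^sup>m\<close>, \<open>l x\<^sup>n\<close> with \<open>m n\<close> equal to 1 or
  2, then \<open>\<theta>\<close> is a monomial map of order 3 or 4; and four models, up to exchanging \<open>x\<close> and \<open>y\<close>,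
  are a Lyness recurrence of period 6 in disguise. In all three cases the order is at most 8.

  A multiset of at most six steps arises as a projected model exactly if every step occurs in a
  quadrant walk, neither the \<open>x\<close>- nor the \<open>y\<close>-inequality implies the other, and the multiplicities
  leave room for distinct third coordinates \<open>k \<ge> \<alpha> i + \<beta> j\<close>, where \<open>\<alpha>, \<beta> \<in> {0, 1}\<close> turn out to suffice
  (\<open>two_dim_model_iff\<close>). Hence a model is a list of eight multiplicities satisfying explicit
  inequalities, and the kernel computes that each of them falls under one of the two criteria and
  that 409 of them, up to exchanging \<open>x\<close> and \<open>y\<close>, are not of the finite kind.
\<close>

section \<open>Leading monomials of rational functions\<close>

abbreviation monomial :: "int \<Rightarrow> int \<Rightarrow> ratfun" where
  "monomial i j \<equiv> var_x powi i * var_y powi j"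

text \<open>
  The residue map of the lexicographic valuation of \<open>\<rat>(x, y)\<close>: first the value at \<open>y = 0\<close>, a
  function of \<open>x\<close>, then its value at \<open>x = 0\<close>. The common factor \<open>x\<^sup>k\<close> appears because
  setting \<open>y = 0\<close> in numerator and denominator may leave a common zero at \<open>x = 0\<close>. The relation
  is partial: functions of negative valuation have no residue.
\<close>
definition residue :: "ratfun \<Rightarrow> rat \<Rightarrow> bool" where
  "residue f c \<longleftrightarrow> (\<exists>a b a1 b1 k. f = to_fract a / to_fract b \<and>
     coeff a 0 = [:0, 1:] ^ k * a1 \<and> coeff b 0 = [:0, 1:] ^ k * b1 \<and>
     poly b1 0 = 1 \<and> poly a1 0 = c)"

lemma residueI:
  assumes "coeff a 0 = [:0, 1:] ^ k * a1" "coeff b 0 = [:0, 1:] ^ k * b1" "poly b1 0 = 1"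
  shows "residue (to_fract a / to_fract b) (poly a1 0)"
  using assms unfolding residue_def by blast

lemma residueE:
  assumes "residue f c"
  obtains a b a1 b1 k where "f = to_fract a / to_fract b" "b \<noteq> 0"
    "coeff a 0 = [:0, 1:] ^ k * a1" "coeff b 0 = [:0, 1:] ^ k * b1"
    "poly b1 0 = 1" "poly a1 0 = c"
proof -
  obtain a b a1 b1 k where *: "f = to_fract a / to_fract b"
    "coeff a 0 = [:0, 1:] ^ k * a1" "coeff b 0 = [:0, 1:] ^ k * b1"
    "poly b1 0 = 1" "poly a1 0 = c"
    using assms unfolding residue_def by blast
  moreover have "b \<noteq> 0"
    using *(3,4) by auto
  ultimately show ?thesis
    using that by blast
qed

lemma residue_unique:
  assumes "residue f c" "residue f d"
  shows "c = d"
proof -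
  from assms(1) obtain a b a1 b1 k where f: "f = to_fract a / to_fract b" "b \<noteq> 0"
    "coeff a 0 = [:0, 1:] ^ k * a1" "coeff b 0 = [:0, 1:] ^ k * b1"
    "poly b1 0 = 1" "poly a1 0 = c"
    by (rule residueE)
  from assms(2) obtain a' b' a2 b2 l where g: "f = to_fract a' / to_fract b'" "b' \<noteq> 0"
    "coeff a' 0 = [:0, 1:] ^ l * a2" "coeff b' 0 = [:0, 1:] ^ l * b2"
    "poly b2 0 = 1" "poly a2 0 = d"
    by (rule residueE)
  have "to_fract (a * b') = to_fract (a' * b)"
    using f(1,2) g(1,2) by (simp add: field_simps)
  then have "a * b' = a' * b"
    by (simp only: to_fract_eq_iff)
  then have "coeff a 0 * coeff b' 0 = coeff a' 0 * coeff b 0"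
    by (metis coeff_mult_0)
  then have "[:0, 1:] ^ (k + l) * (a1 * b2) = [:0, 1:] ^ (k + l) * (a2 * b1)"
    by (simp only: f g power_add mult_ac)
  then have "a1 * b2 = a2 * b1"
    by simp
  then have "poly (a1 * b2) 0 = poly (a2 * b1) 0"
    by simp
  then show ?thesis
    using f g by simp
qed

lemma residue_add: "residue f c \<Longrightarrow> residue g d \<Longrightarrow> residue (f + g) (c + d)"
proof (elim residueE)
  fix a b a1 b1 k a' b' a2 b2 l
  assume f: "f = to_fract a / to_fract b" "b \<noteq> 0"
    "coeff a 0 = [:0, 1:] ^ k * a1" "coeff b 0 = [:0, 1:] ^ k * b1"
    "poly b1 0 = 1" "poly a1 0 = c"
  assume g: "g = to_fract a' / to_fract b'" "b' \<noteq> 0"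
    "coeff a' 0 = [:0, 1:] ^ l * a2" "coeff b' 0 = [:0, 1:] ^ l * b2"
    "poly b2 0 = 1" "poly a2 0 = d"
  have "f + g = to_fract (a * b' + a' * b) / to_fract (b * b')"
    using f(1,2) g(1,2) by (simp add: field_simps)
  moreover have "residue \<dots> (poly (a1 * b2 + a2 * b1) 0)"
    by (rule residueI[of _ "k + l" _ _ "b1 * b2"])
      (use f g in \<open>simp_all add: coeff_mult_0 power_add algebra_simps\<close>)
  ultimately show ?thesis
    using f g by simp
qed

lemma residue_mult: "residue f c \<Longrightarrow> residue g d \<Longrightarrow> residue (f * g) (c * d)"
proof (elim residueE)
  fix a b a1 b1 k a' b' a2 b2 l
  assume f: "f = to_fract a / to_fract b" "b \<noteq> 0"
    "coeff a 0 = [:0, 1:] ^ k * a1" "coeff b 0 = [:0, 1:] ^ k * b1"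
    "poly b1 0 = 1" "poly a1 0 = c"
  assume g: "g = to_fract a' / to_fract b'" "b' \<noteq> 0"
    "coeff a' 0 = [:0, 1:] ^ l * a2" "coeff b' 0 = [:0, 1:] ^ l * b2"
    "poly b2 0 = 1" "poly a2 0 = d"
  have "f * g = to_fract (a * a') / to_fract (b * b')"
    unfolding f(1) g(1) by simp
  moreover have "residue \<dots> (poly (a1 * a2) 0)"
    by (rule residueI[of _ "k + l" _ _ "b1 * b2"])
      (use f g in \<open>simp_all add: coeff_mult_0 power_add algebra_simps\<close>)
  ultimately show ?thesis
    using f g by simp
qed

lemma residue_inverse:
  assumes "residue f c" "c \<noteq> 0"
  shows "residue (inverse f) (inverse c)"
proof -
  from assms(1) obtain a b a1 b1 k where f: "f = to_fract a / to_fract b" "b \<noteq> 0"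
    "coeff a 0 = [:0, 1:] ^ k * a1" "coeff b 0 = [:0, 1:] ^ k * b1"
    "poly b1 0 = 1" "poly a1 0 = c"
    by (rule residueE)
  define s where "s = [:[:inverse c:]:]"
  have s: "to_fract s \<noteq> 0"
    using assms(2) by (simp add: s_def)
  have "inverse f = to_fract (s * b) / to_fract (s * a)"
    unfolding f(1) to_fract_mult using s by simp
  moreover have "residue \<dots> (poly (smult (inverse c) b1) 0)"
    by (rule residueI[of _ k _ _ "smult (inverse c) a1"])
      (use f assms(2) in \<open>simp_all add: coeff_mult_0 s_def\<close>)
  ultimately show ?thesis
    using f by simp
qed

lemma residue_divide:
  "residue f c \<Longrightarrow> residue g d \<Longrightarrow> d \<noteq> 0 \<Longrightarrow> residue (f / g) (c / d)"
  by (simp add: divide_inverse residue_mult residue_inverse)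

lemma residue_const: "residue (const_fun c) c"
  using residueI[of "[:[:c:]:]" 0 "[:c:]" 1 1] by (simp add: const_fun_def)

lemma residue_0: "residue 0 0" and residue_1: "residue 1 1"
  using residue_const[of 0] residue_const[of 1] by simp_all

lemma residue_power: "residue f c \<Longrightarrow> residue (f ^ n) (c ^ n)"
  by (induction n) (simp_all add: residue_1 residue_mult)

lemma residue_power_int:
  "residue f c \<Longrightarrow> c \<noteq> 0 \<Longrightarrow> residue (f powi i) (c powi i)"
  by (cases i) (auto simp: power_int_def residue_power residue_inverse simp flip: power_inverse)

lemma residue_sum:
  "(\<And>a. a \<in> A \<Longrightarrow> residue (f a) (c a)) \<Longrightarrow> residue (sum f A) (sum c A)"
  by (induction A rule: infinite_finite_induct) (simp_all add: residue_0 residue_add)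

lemma var_nonzero [simp]: "var_x \<noteq> 0" "var_y \<noteq> 0"
  by (simp_all add: var_x_def var_y_def)

lemma const_fun_eq_0_iff [simp]: "const_fun c = 0 \<longleftrightarrow> c = 0"
  by (simp add: const_fun_def)

lemma residue_var_x: "residue var_x 0"
  using residueI[of "[:[:0, 1:]:]" 0 "[:0, 1:]" 1 1] by (simp add: var_x_def)

text \<open>
  \<open>y\<close> is infinitely small compared with every power of \<open>x\<close>: this makes the valuation lexicographic.
\<close>
lemma residue_y_over_x: "residue (var_y / var_x ^ n) 0"
proof -
  have "to_fract ([:[:0, 1:]:] ^ n) = var_x ^ n"
    by (induction n) (simp_all only: power_Suc to_fract_mult to_fract_1 power_0 var_x_def)
  moreover have "coeff ([:[:0, 1:]:] ^ n) 0 = [:0, 1:] ^ n"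
    by (induction n) (simp_all add: coeff_mult_0)
  ultimately show ?thesis
    using residueI[of "[:0, 1:]" n 0 "[:[:0, 1:]:] ^ n" 1] by (simp add: var_y_def)
qed

lemma residue_monomial:
  assumes "j > 0 \<or> (j = 0 \<and> i > 0)"
  shows "residue (monomial i j) 0"
proof (cases "j > 0")
  case False
  then obtain n where "i = int (Suc n)" "j = 0"
    using assms by (metis gr0_implies_Suc zero_less_imp_eq_int less_irrefl)
  then show ?thesis
    using residue_power[OF residue_var_x, of "Suc n"]
    by (simp only: power_int_of_nat power_int_0_right mult_1_right power_0_Suc)
next
  case True
  then obtain m where m: "j = int (Suc m)"
    by (metis gr0_implies_Suc zero_less_imp_eq_int)
  define n where "n = nat (- i)"
  define k where "k = nat (i + int n)"
  have i: "i = int k - int n"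
    by (simp add: k_def n_def)
  have "var_x powi i = var_x ^ k / var_x ^ n"
    by (simp add: i power_int_diff)
  moreover have "var_y powi j = var_y * var_y ^ m"
    by (simp only: m power_int_of_nat power_Suc)
  ultimately have "monomial i j = (var_x ^ k * (var_y / var_x ^ 0) ^ m) * (var_y / var_x ^ n)"
    by simp
  moreover have "residue \<dots> ((0 ^ k * 0 ^ m) * 0)"
    by (intro residue_mult residue_power residue_var_x residue_y_over_x)
  ultimately show ?thesis
    by simp
qed

text \<open>
  Since the value group is \<open>\<int>\<^sup>2\<close> and the residue field is \<open>\<rat>\<close>, every non-zero function is a
  constant times a monomial times a function of residue 1.
\<close>
definition leads :: "ratfun \<Rightarrow> rat \<Rightarrow> int \<Rightarrow> int \<Rightarrow> bool" where
  "leads f c i j \<longleftrightarrow> c \<noteq> 0 \<and> residue (f / monomial i j) c"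

lemma leads_nonzero: "leads f c i j \<Longrightarrow> f \<noteq> 0"
  using residue_unique[OF residue_0] by (auto simp: leads_def)

lemma leads_mult: "leads f c i j \<Longrightarrow> leads g d k l \<Longrightarrow> leads (f * g) (c * d) (i + k) (j + l)"
  using residue_mult[of "f / monomial i j" c "g / monomial k l" d]
  by (simp add: leads_def power_int_add mult_ac)

lemma leads_inverse: "leads f c i j \<Longrightarrow> leads (inverse f) (inverse c) (- i) (- j)"
  using residue_inverse[of "f / monomial i j" c]
  by (simp add: leads_def power_int_minus field_simps)

lemma leads_divide: "leads f c i j \<Longrightarrow> leads g d k l \<Longrightarrow> leads (f / g) (c / d) (i - k) (j - l)"
  using leads_mult[OF _ leads_inverse] by (simp add: divide_inverse)

lemma leads_const: "c \<noteq> 0 \<Longrightarrow> leads (const_fun c) c 0 0"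
  by (simp add: leads_def residue_const)

lemma leads_monomial: "leads (monomial i j) 1 i j"
  by (simp add: leads_def residue_1)

lemma leads_var: "leads var_x 1 1 0" "leads var_y 1 0 1"
  using leads_monomial[of 1 0] leads_monomial[of 0 1] by simp_all

lemma leads_power_int: "leads f c i j \<Longrightarrow> leads (f powi n) (c powi n) (n * i) (n * j)"
  using residue_power_int[of "f / monomial i j" c n]
  by (simp add: leads_def power_int_divide_distrib power_int_mult_distrib power_int_mult
      mult.commute)

lemma leads_add:
  assumes f: "leads f c i j" and g: "leads g d k l" and less: "j < l \<or> (j = l \<and> i < k)"
  shows "leads (f + g) c i j"
proof -
  have "(f + g) / monomial i j =
      f / monomial i j + g / monomial k l * monomial (k - i) (l - j)"
    by (simp add: power_int_diff field_simps)
  moreover have "residue (monomial (k - i) (l - j)) 0"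
    using less by (intro residue_monomial) auto
  then have "residue (f / monomial i j + g / monomial k l * monomial (k - i) (l - j)) (c + d * 0)"
    using f g unfolding leads_def by (intro residue_add residue_mult) auto
  ultimately show ?thesis
    using f by (simp add: leads_def)
qed

text \<open>
  Summands with distinct leading monomials cannot cancel.
\<close>
lemma leads_sum:
  assumes "finite A" "A \<noteq> {}" "\<And>a. a \<in> A \<Longrightarrow> leads (f a) (c a) (i a) (j a)"
    and "inj_on (\<lambda>a. (i a, j a)) A"
  shows "\<exists>a\<in>A. leads (sum f A) (c a) (i a) (j a)"
  using assms
proof (induction rule: finite_ne_induct)
  case (insert a A)
  then obtain b where b: "b \<in> A" "leads (sum f A) (c b) (i b) (j b)"
    by auto
  have ne: "(i a, j a) \<noteq> (i b, j b)"
    using insert.prems(2) insert.hyps b by (auto simp: inj_on_def)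
  have a: "leads (f a) (c a) (i a) (j a)"
    using insert.prems by auto
  show ?case
  proof (cases "j a < j b \<or> (j a = j b \<and> i a < i b)")
    case True
    then show ?thesis
      using leads_add[OF a b(2)] insert.hyps by auto
  next
    case False
    then have "j b < j a \<or> (j b = j a \<and> i b < i a)"
      using ne by auto
    then show ?thesis
      using leads_add[OF b(2) a] insert.hyps b(1) by (auto simp: add.commute)
  qed
qed auto

lemma eval_poly1_sum:
  "degree q < n \<Longrightarrow> eval_poly1 q F = (\<Sum>i<n. const_fun (coeff q i) * F ^ i)"
proof (induction n arbitrary: q)
  case (Suc n)
  obtain c r where q: "q = pCons c r"
    by (rule pCons_cases)
  show ?case
  proof (cases "r = 0")
    case True
    then show ?thesis
      by (simp add: q sum.lessThan_Suc_shift del: sum.lessThan_Suc)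
  next
    case False
    then have "degree r < n"
      using Suc.prems by (simp add: q)
    from Suc.IH[OF this] show ?thesis
      by (simp add: q sum.lessThan_Suc_shift sum_distrib_left mult_ac del: sum.lessThan_Suc)
  qed
qed simp

lemma eval_poly2_sum:
  "degree p < n \<Longrightarrow> eval_poly2 P p = (\<Sum>j<n. eval_poly1 (coeff p j) (fst P) * snd P ^ j)"
proof (induction n arbitrary: p)
  case (Suc n)
  obtain c r where p: "p = pCons c r"
    by (rule pCons_cases)
  show ?case
  proof (cases "r = 0")
    case True
    then show ?thesis
      by (simp add: p sum.lessThan_Suc_shift del: sum.lessThan_Suc)
  next
    case False
    then have "degree r < n"
      using Suc.prems by (simp add: p)
    from Suc.IH[OF this] show ?thesis
      by (simp add: p sum.lessThan_Suc_shift sum_distrib_left mult_ac del: sum.lessThan_Suc)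
  qed
qed simp

text \<open>
  If the exponent vectors of \<open>X\<close> and \<open>Y\<close> are independent, then the terms of \<open>p(X, Y)\<close> have distinct
  leading monomials. This yields dominance of rational maps, and, for \<open>X = x\<close> and \<open>Y = y\<close>,
  the existence of leading terms.
\<close>
lemma eval_poly2_leads:
  assumes X: "leads X c a b" and Y: "leads Y d k l" and det: "a * l \<noteq> b * k"
    and p: "p \<noteq> 0"
  shows "\<exists>r i j. leads (eval_poly2 (X, Y) p) r i j"
proof -
  define A where
    "A = (SIGMA j:{..degree p}. {i. i \<le> degree (coeff p j) \<and> coeff (coeff p j) i \<noteq> 0})"
  define F where "F = (\<lambda>(j, i). const_fun (coeff (coeff p j) i) * (X powi int i * Y powi int j))"
  have eval1: "eval_poly1 q X * Y ^ j = (\<Sum>i | i \<le> degree q \<and> coeff q i \<noteq> 0.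
      const_fun (coeff q i) * (X powi int i * Y powi int j))" for q j
  proof -
    have "eval_poly1 q X = (\<Sum>i\<le>degree q. const_fun (coeff q i) * X ^ i)"
      using eval_poly1_sum[of q "Suc (degree q)" X] by (simp add: lessThan_Suc_atMost del: sum.lessThan_Suc)
    also have "\<dots> = (\<Sum>i | i \<le> degree q \<and> coeff q i \<noteq> 0. const_fun (coeff q i) * X ^ i)"
      by (rule sum.mono_neutral_right) auto
    finally have eval: "eval_poly1 q X =
        (\<Sum>i | i \<le> degree q \<and> coeff q i \<noteq> 0. const_fun (coeff q i) * X ^ i)" .
    show ?thesis
      unfolding eval sum_distrib_right by (simp add: mult.assoc)
  qed
  have "eval_poly2 (X, Y) p = (\<Sum>j\<le>degree p. eval_poly1 (coeff p j) X * Y ^ j)"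
    using eval_poly2_sum[of p "Suc (degree p)" "(X, Y)"]
    by (simp add: lessThan_Suc_atMost del: sum.lessThan_Suc)
  also have "\<dots> = sum F A"
    unfolding eval1 A_def F_def by (rule sum.Sigma) auto
  finally have eval2: "eval_poly2 (X, Y) p = sum F A" .
  have "\<exists>e\<in>A. leads (sum F A) (case e of (j, i) \<Rightarrow> coeff (coeff p j) i * (c powi int i * d powi int j))
     (case e of (j, i) \<Rightarrow> 0 + (int i * a + int j * k)) (case e of (j, i) \<Rightarrow> 0 + (int i * b + int j * l))"
  proof (rule leads_sum)
    show "finite A"
      by (auto simp: A_def)
    have "(degree p, degree (lead_coeff p)) \<in> A"
      using p by (auto simp: A_def)
    then show "A \<noteq> {}"
      by auto
    show "inj_on (\<lambda>e. (case e of (j, i) \<Rightarrow> 0 + (int i * a + int j * k), case e of (j, i) \<Rightarrow> 0 + (int i * b + int j * l))) A"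
    proof (rule inj_onI, clarsimp)
      fix j i j' i'
      assume 1: "int i * a + int j * k = int i' * a + int j' * k"
        and 2: "int i * b + int j * l = int i' * b + int j' * l"
      have "(int i - int i') * (a * l - b * k) = 0"
        using arg_cong2[OF 1 2, of "\<lambda>u v. u * l - v * k"] by (simp add: algebra_simps)
      moreover have "(int j - int j') * (a * l - b * k) = 0"
        using arg_cong2[OF 1 2, of "\<lambda>u v. u * b - v * a"] by (simp add: algebra_simps)
      ultimately show "j = j' \<and> i = i'"
        using det by simp
    qed
  next
    fix e assume "e \<in> A"
    then obtain j i where e: "e = (j, i)" and nz: "coeff (coeff p j) i \<noteq> 0"
      by (auto simp: A_def)
    show "leads (F e) (case e of (j, i) \<Rightarrow> coeff (coeff p j) i * (c powi int i * d powi int j))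
     (case e of (j, i) \<Rightarrow> 0 + (int i * a + int j * k)) (case e of (j, i) \<Rightarrow> 0 + (int i * b + int j * l))"
      using leads_mult[OF leads_const[OF nz]
          leads_mult[OF leads_power_int[OF X, of "int i"] leads_power_int[OF Y, of "int j"]]]
      by (simp add: F_def e)
  qed
  then show ?thesis
    unfolding eval2 by blast
qed

lemma dominant_leads:
  assumes "leads X c a b" "leads Y d k l" "a * l \<noteq> b * k"
  shows "dominant (X, Y)"
  unfolding dominant_def using eval_poly2_leads[OF assms] leads_nonzero by blast

lemma ex_leads: "f \<noteq> 0 \<Longrightarrow> \<exists>c i j. leads f c i j"
proof -
  assume f: "f \<noteq> 0"
  obtain a b where ab: "b \<noteq> 0" "f = to_fract a / to_fract b"
    by (rule fract_cases)
  have "\<exists>c i j. leads (to_fract p) c i j" if "p \<noteq> 0" for p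
    using eval_poly2_leads[OF leads_var _ that] by (simp add: eval_poly2_vars)
  then show ?thesis
    using ab f leads_divide by (metis to_fract_0 div_0)
qed

lemma residue_eval_poly1:
  assumes X: "residue X 0"
  shows "residue (eval_poly1 q X) (poly q 0)"
proof (induction q)
  case (pCons c q)
  then show ?case
    using residue_add[OF residue_const residue_mult[OF X pCons.IH], of c] by simp
qed (simp add: residue_0)

lemma residue_eval_poly2:
  assumes X: "residue X 0" and Y: "residue Y 0"
  shows "residue (eval_poly2 (X, Y) p) (poly (poly p 0) 0)"
proof (induction p)
  case (pCons q p)
  then show ?case
    using residue_add[OF residue_eval_poly1[OF X] residue_mult[OF Y pCons.IH], of q] by simp
qed (simp add: residue_0)

text \<open>
  If \<open>X\<close> and \<open>Y\<close> lead with \<open>c x\<close> and \<open>d y\<close>, the substitution preserves the valuation and the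
  residues, so it acts on leading terms through \<open>x \<mapsto> c x\<close>, \<open>y \<mapsto> d y\<close> alone.
\<close>
lemma leads_subst:
  assumes X: "leads X c 1 0" and Y: "leads Y d 0 1" and f: "leads f r i j"
  shows "leads (rat_subst (X, Y) f) (r * (c powi i * d powi j)) i j"
proof -
  have dom: "dominant (X, Y)"
    using dominant_leads[OF X Y] by simp
  have nz: "X \<noteq> 0" "Y \<noteq> 0" "c \<noteq> 0" "d \<noteq> 0"
    using leads_nonzero[OF X] leads_nonzero[OF Y] X Y by (simp_all add: leads_def)
  have Xx: "residue (X / var_x) c" and Yy: "residue (Y / var_y) d"
    using X Y by (simp_all add: leads_def)
  have rX: "residue X 0"
    using residue_mult[OF Xx residue_var_x] by simp
  have YX: "residue (Y / X ^ k) 0" for k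
  proof -
    have eq: "Y / X ^ k = (Y / var_y) * (var_y / var_x ^ k) / (X / var_x) ^ k"
      by (simp add: power_divide nz)
    have "residue (Y / X ^ k) (d * 0 / c ^ k)"
      unfolding eq
      using nz by (intro residue_divide residue_mult residue_power residue_y_over_x Xx Yy) auto
    then show ?thesis
      by simp
  qed
  from YX[of 0] have rY: "residue Y 0" by simp
  \<comment> \<open>Modulo the maximal ideal only the coefficient of \<open>y\<^sup>0\<close> matters, even after division by
    \<open>X\<^sup>k\<close>, because \<open>Y\<close> remains infinitely small compared with all powers of \<open>X\<close>.\<close>
  have poly: "residue (eval_poly2 (X, Y) p / X ^ k) (poly p1 0)"
    if p: "coeff p 0 = [:0, 1:] ^ k * p1" for p p1 k
  proof -
    obtain p2 where p2: "p = pCons ([:0, 1:] ^ k * p1) p2"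
      by (metis p coeff_pCons_0 pCons_cases)
    have "eval_poly1 ([:0, 1:] ^ k) X = X ^ k"
      by (induction k) simp_all
    then have "eval_poly2 (X, Y) p / X ^ k = eval_poly1 p1 X + (Y / X ^ k) * eval_poly2 (X, Y) p2"
      using nz by (simp add: p2 add_divide_distrib)
    moreover have "residue (eval_poly1 p1 X + (Y / X ^ k) * eval_poly2 (X, Y) p2)
        (poly p1 0 + 0 * poly (poly p2 0) 0)"
      by (intro residue_add residue_mult residue_eval_poly1 residue_eval_poly2 YX rX rY)
    ultimately show ?thesis by simp
  qed
  have res: "residue (rat_subst (X, Y) g) s" if "residue g s" for g s
  proof -
    from that obtain a b a1 b1 k where g: "g = to_fract a / to_fract b" "b \<noteq> 0"
      "coeff a 0 = [:0, 1:] ^ k * a1" "coeff b 0 = [:0, 1:] ^ k * b1"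
      "poly b1 0 = 1" "poly a1 0 = s"
      by (rule residueE)
    have "rat_subst (X, Y) g = (eval_poly2 (X, Y) a / X ^ k) / (eval_poly2 (X, Y) b / X ^ k)"
      using nz by (simp add: g(1,2) rat_subst_fract dom)
    moreover have "residue \<dots> (poly a1 0 / poly b1 0)"
      using g by (intro residue_divide poly) auto
    ultimately show ?thesis
      using g by simp
  qed
  have pow: "rat_subst (X, Y) (g powi n) = rat_subst (X, Y) g powi n" for g n
  proof -
    have 1: "rat_subst (X, Y) 1 = 1"
      using rat_subst_const[OF dom, of 1] by simp
    have power: "rat_subst (X, Y) (h ^ m) = rat_subst (X, Y) h ^ m" for h m
      by (induction m) (simp_all add: 1 rat_subst_mult dom)
    have "rat_subst (X, Y) (inverse g) = inverse (rat_subst (X, Y) g)"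
      by (simp add: inverse_eq_divide rat_subst_divide dom 1)
    then show ?thesis
      by (simp add: power_int_def power)
  qed
  have "residue (rat_subst (X, Y) (f / monomial i j)) r"
    using f by (intro res) (simp add: leads_def)
  then have "residue (rat_subst (X, Y) f / (X powi i * Y powi j)) r"
    by (simp add: rat_subst_divide rat_subst_mult pow rat_subst_vars dom)
  then have "residue (rat_subst (X, Y) f / (X powi i * Y powi j) *
      ((X / var_x) powi i * (Y / var_y) powi j)) (r * (c powi i * d powi j))"
    using nz by (intro residue_mult residue_power_int Xx Yy) auto
  then show ?thesis
    using nz f by (simp add: leads_def power_int_divide_distrib)
qed

section \<open>Substitutions of finite order\<close>

lemma leads_unique:
  assumes f: "leads f c i j" and g: "leads f d k l"
  shows "c = d \<and> i = k \<and> j = l"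
proof -
  have no: False if "leads f c i j" "leads f d k l" "j < l \<or> (j = l \<and> i < k)" for c d i j k l
  proof -
    have "f / monomial i j = f / monomial k l * monomial (k - i) (l - j)"
      by (simp add: power_int_diff)
    moreover have "residue (f / monomial k l * monomial (k - i) (l - j)) (d * 0)"
      using that by (intro residue_mult residue_monomial) (auto simp: leads_def)
    ultimately show False
      using that(1) residue_unique by (metis leads_def mult_zero_right)
  qed
  have "\<not> (j < l \<or> (j = l \<and> i < k))" "\<not> (l < j \<or> (l = j \<and> k < i))"
    using no[OF f g] no[OF g f] by blast+
  then have "i = k" "j = l"
    by auto
  then show ?thesis
    using f g residue_unique by (auto simp: leads_def)
qed

lemma rat_subst_diff:
  assumes "dominant P"
  shows "rat_subst P (f - g) = rat_subst P f - rat_subst P g"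
  using rat_subst_add[OF assms, of "f - g" g] by simp

text \<open>
  The heart of the argument. Powers of the substitution \<open>T\<close> multiply the leading coefficients of \<open>x\<close>
  and \<open>y\<close> by powers of \<open>c\<close> and \<open>d\<close>, so finite order forces \<open>c = d = 1\<close>. Then \<open>T\<close> preserves leading terms
  altogether, and the telescoping sum of the \<open>T\<^sup>k (T f - f)\<close> cannot vanish unless \<open>T f = f\<close>.
\<close>
lemma finite_order_leads:
  assumes X: "leads X c 1 0" and Y: "leads Y d 0 1"
    and pos: "c > 0" "d > 0" and n: "n > 0"
    and id: "\<And>f. (rat_subst (X, Y) ^^ n) f = f"
  shows "X = var_x" "Y = var_y"
proof -
  define T where "T = rat_subst (X, Y)"
  have dom: "dominant (X, Y)"
    using dominant_leads[OF X Y] by simp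
  have iter: "leads ((T ^^ k) f) (r * (c powi i * d powi j) ^ k) i j" if "leads f r i j" for f r i j k
    using that
  proof (induction k)
    case (Suc k)
    then show ?case
      using leads_subst[OF X Y Suc.IH] by (simp add: T_def mult_ac)
  qed simp
  have "(c powi 1 * d powi 0) ^ n = 1" "(c powi 0 * d powi 1) ^ n = 1"
    using leads_unique[OF iter[OF leads_var(1), of n]] leads_unique[OF iter[OF leads_var(2), of n]]
      leads_var id by (force simp: T_def)+
  then have 1: "c = 1" "d = 1"
    using pos n power_eq_iff_eq_base[of n c 1] power_eq_iff_eq_base[of n d 1] by simp_all
  have "T f = f" for f
  proof (rule ccontr)
    assume "T f \<noteq> f"
    then obtain r i j where g: "leads (T f - f) r i j"
      using ex_leads[of "T f - f"] by auto
    \<comment> \<open>The summands \<open>T\<^sup>k (T f - f)\<close> share one leading term, and their sum telescopes to 0.\<close>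
    have "residue ((T ^^ k) (T f - f) / monomial i j) r" for k
      using iter[OF g, of k] by (simp add: leads_def 1)
    then have "residue (\<Sum>k<n. (T ^^ k) (T f - f) / monomial i j) (\<Sum>k<n. r)"
      by (rule residue_sum)
    moreover have "(\<Sum>k<m. (T ^^ k) (T f - f)) = (T ^^ m) f - f" for m
    proof (induction m)
      case (Suc m)
      have "(T ^^ k) (f - g) = (T ^^ k) f - (T ^^ k) g" for f g k
        by (induction k) (simp_all add: T_def rat_subst_diff dom)
      then show ?case
        using Suc.IH by (simp add: funpow_swap1)
    qed simp
    ultimately have "residue 0 (of_nat n * r)"
      using id by (simp add: T_def flip: sum_divide_distrib)
    then show False
      using residue_unique[OF residue_0, of "of_nat n * r"] n g by (simp add: leads_def)
  qed
  then show "X = var_x" "Y = var_y"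
    using rat_subst_vars[OF dom] by (simp_all add: T_def)
qed

section \<open>Coefficient rows\<close>

type_synonym row = "nat \<times> nat \<times> nat"

text \<open>
  The Laurent polynomials \<open>A\<^sub>\<plusminus>\<close> and \<open>B\<^sub>\<plusminus>\<close> have three coefficients each. They will be evaluated at
  rational functions as well as at rational numbers.
\<close>
definition row :: "row \<Rightarrow> 'a::field \<Rightarrow> 'a" where
  "row = (\<lambda>(a, b, c) F. of_nat a / F + of_nat b + of_nat c * F)"

definition x_row :: "(int \<times> int) multiset \<Rightarrow> int \<Rightarrow> row" where
  "x_row M e = (count M (e, -1), count M (e, 0), count M (e, 1))"

definition y_row :: "(int \<times> int) multiset \<Rightarrow> int \<Rightarrow> row" where
  "y_row M e = (count M (-1, e), count M (0, e), count M (1, e))"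

definition small_steps :: "(int \<times> int) multiset \<Rightarrow> bool" where
  "small_steps M \<longleftrightarrow> set_mset M \<subseteq> {-1, 0, 1} \<times> {-1, 0, 1}"

lemma x_part_row: "small_steps M \<Longrightarrow> x_part M e = row (x_row M e) var_y"
  unfolding small_steps_def
  by (induction M) (auto simp: x_part_def x_row_def row_def power_int_minus field_simps)

lemma y_part_row: "small_steps M \<Longrightarrow> y_part M e = row (y_row M e) var_x"
  unfolding small_steps_def
  by (induction M) (auto simp: y_part_def y_row_def row_def power_int_minus field_simps)

lemma const_fun_of_nat: "const_fun (of_nat n) = of_nat n"
  by (induction n) simp_all

lemma rat_subst_of_nat: "dominant P \<Longrightarrow> rat_subst P (of_nat n) = of_nat n"
  using rat_subst_const[of P "of_nat n"] by (simp add: const_fun_of_nat)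

lemma rat_subst_row: "dominant P \<Longrightarrow> rat_subst P (row p F) = row p (rat_subst P F)"
  by (cases p) (simp add: row_def rat_subst_add rat_subst_mult rat_subst_divide rat_subst_of_nat)

definition low :: "row \<Rightarrow> nat \<times> int" where
  "low = (\<lambda>(a, b, c). if a \<noteq> 0 then (a, -1) else if b \<noteq> 0 then (b, 0) else (c, 1))"

definition high :: "row \<Rightarrow> nat \<times> int" where
  "high = (\<lambda>(a, b, c). if c \<noteq> 0 then (c, 1) else if b \<noteq> 0 then (b, 0) else (a, -1))"

definition lex_pos :: "int \<Rightarrow> int \<Rightarrow> bool" where
  "lex_pos i j \<longleftrightarrow> j > 0 \<or> (j = 0 \<and> i > 0)"

lemma leads_of_nat: "n \<noteq> 0 \<Longrightarrow> leads (of_nat n) (of_nat n) 0 0"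
  using leads_const[of "of_nat n"] by (simp add: const_fun_of_nat)

text \<open>
  The three terms of a row have leading monomials \<open>F\<^sup>-\<^sup>1\<close>, 1 and \<open>F\<close>, strictly ordered in one
  direction or the other, so the first non-zero coefficient from the appropriate end decides.
\<close>
lemma leads_row:
  assumes F: "leads F d i j" and p: "p \<noteq> (0, 0, 0)" and ij: "(i, j) \<noteq> (0, 0)"
    and ne: "(n, e) = (if lex_pos i j then low p else high p)"
  shows "leads (row p F) (of_nat n * d powi e) (e * i) (e * j)"
proof -
  obtain a b c where abc: "p = (a, b, c)"
    by (cases p)
  have A: "leads (of_nat a / F) (of_nat a / d) (- i) (- j)" if "a \<noteq> 0"
    using leads_divide[OF leads_of_nat[OF that] F] by simp
  have B: "leads (of_nat b) (of_nat b) 0 0" if "b \<noteq> 0"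
    using leads_of_nat[OF that] by simp
  have C: "leads (of_nat c * F) (of_nat c * d) i j" if "c \<noteq> 0"
    using leads_mult[OF leads_of_nat[OF that] F] by simp
  note ABC = A B C
  show ?thesis
  proof (cases "lex_pos i j")
    case True
    have BC: "leads (of_nat b + of_nat c * F) (of_nat b) 0 0" if "b \<noteq> 0"
      using leads_add[OF B[OF that] C] B[OF that] True by (cases "c = 0") (auto simp: lex_pos_def)
    have AC: "leads (of_nat a / F + of_nat c * F) (of_nat a / d) (- i) (- j)" if "a \<noteq> 0"
      using leads_add[OF A[OF that] C] A[OF that] True by (cases "c = 0") (auto simp: lex_pos_def)
    have "leads (of_nat a / F + (of_nat b + of_nat c * F)) (of_nat a / d) (- i) (- j)"
      if "a \<noteq> 0" "b \<noteq> 0"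
      by (rule leads_add[OF A[OF that(1)] BC[OF that(2)]]) (use True in \<open>auto simp: lex_pos_def\<close>)
    then show ?thesis
      using True ne p ABC BC AC
      by (cases "b = 0") (auto simp: abc row_def low_def power_int_minus add.assoc divide_inverse split: if_splits)
  next
    case False
    then have neg: "j < 0 \<or> (j = 0 \<and> i < 0)"
      using ij by (auto simp: lex_pos_def)
    have BA: "leads (of_nat b + of_nat a / F) (of_nat b) 0 0" if "b \<noteq> 0"
      using leads_add[OF B[OF that] A] B[OF that] neg by (cases "a = 0") auto
    have CA: "leads (of_nat c * F + of_nat a / F) (of_nat c * d) i j" if "c \<noteq> 0"
      using leads_add[OF C[OF that] A] C[OF that] neg by (cases "a = 0") auto
    have "leads (of_nat c * F + (of_nat b + of_nat a / F)) (of_nat c * d) i j"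
      if "c \<noteq> 0" "b \<noteq> 0"
      by (rule leads_add[OF C[OF that(1)] BA[OF that(2)]]) (use neg in auto)
    moreover have "row p F = of_nat c * F + (of_nat b + of_nat a / F)"
      by (simp add: abc row_def)
    ultimately show ?thesis
      using False ne p ABC BA CA
      by (cases "b = 0") (auto simp: abc high_def power_int_minus divide_inverse split: if_splits)
  qed
qed

section \<open>The group generated by the two involutions\<close>

lemma birational_group_simps [simp]:
  "\<one>\<^bsub>birational_group\<^esub> = (var_x, var_y)"
  "mult birational_group = map_comp2"
  by (simp_all add: birational_group_def units_of_def dominant_maps_def)

lemma involution_in_birational_group:
  assumes "dominant P" "map_comp2 P P = (var_x, var_y)"
  shows "P \<in> carrier birational_group"
  using assms unfolding birational_group_def units_of_def Units_def dominant_maps_def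
  by (simp del: split_paired_Ex) blast

lemma birational_group_dominant: "P \<in> carrier birational_group \<Longrightarrow> dominant P"
  by (auto simp: birational_group_def units_of_def Units_def dominant_maps_def)

locale walk_model =
  fixes M :: "(int \<times> int) multiset"
  assumes small: "small_steps M"
    and rows: "x_row M (-1) \<noteq> (0, 0, 0)" "x_row M 1 \<noteq> (0, 0, 0)"
      "y_row M (-1) \<noteq> (0, 0, 0)" "y_row M 1 \<noteq> (0, 0, 0)"
begin

lemma leads_row_var:
  assumes "p \<noteq> (0, 0, 0)"
  shows "\<exists>c k. leads (row p var_x) c k 0" "\<exists>c k. leads (row p var_y) c 0 k"
  using leads_row[OF leads_var(1) assms] leads_row[OF leads_var(2) assms]
  by (metis prod.exhaust mult_zero_right zero_neq_one prod.inject)+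

lemma row_var_nonzero:
  "p \<noteq> (0, 0, 0) \<Longrightarrow> row p var_x \<noteq> 0" "p \<noteq> (0, 0, 0) \<Longrightarrow> row p var_y \<noteq> 0"
  using leads_row_var leads_nonzero by blast+

lemma phi_row: "phi M = (1 / var_x * (row (x_row M (-1)) var_y / row (x_row M 1) var_y), var_y)"
  and psi_row: "psi M = (var_x, 1 / var_y * (row (y_row M (-1)) var_x / row (y_row M 1) var_x))"
  by (simp_all add: phi_def psi_def x_part_row y_part_row small)

lemma phi_dominant: "dominant (phi M)"
proof -
  obtain c k d l where "leads (row (x_row M (-1)) var_y) c 0 k" "leads (row (x_row M 1) var_y) d 0 l"
    using leads_row_var(2) rows by meson
  then have "leads (inverse var_x * (row (x_row M (-1)) var_y / row (x_row M 1) var_y))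
      (inverse 1 * (c / d)) (- 1 + (0 - 0)) (- 0 + (k - l))"
    by (intro leads_mult leads_inverse leads_divide leads_var)
  from dominant_leads[OF this leads_var(2)] show ?thesis
    by (simp add: phi_row divide_inverse)
qed

lemma psi_dominant: "dominant (psi M)"
proof -
  obtain c k d l where "leads (row (y_row M (-1)) var_x) c k 0" "leads (row (y_row M 1) var_x) d l 0"
    using leads_row_var(1) rows by meson
  then have "leads (inverse var_y * (row (y_row M (-1)) var_x / row (y_row M 1) var_x))
      (inverse 1 * (c / d)) (- 0 + (k - l)) (- 1 + (0 - 0))"
    by (intro leads_mult leads_inverse leads_divide leads_var)
  from dominant_leads[OF leads_var(1) this] show ?thesis
    by (simp add: psi_row divide_inverse)
qed

lemma phi_comp:
  assumes "dominant (X, Y)"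
  shows "map_comp2 (phi M) (X, Y) = (1 / X * (row (x_row M (-1)) Y / row (x_row M 1) Y), Y)"
  using assms rat_subst_const[OF assms, of 1]
  by (simp add: map_comp2_def phi_row rat_subst_mult rat_subst_divide rat_subst_row rat_subst_vars)

lemma psi_comp:
  assumes "dominant (X, Y)"
  shows "map_comp2 (psi M) (X, Y) = (X, 1 / Y * (row (y_row M (-1)) X / row (y_row M 1) X))"
  using assms rat_subst_const[OF assms, of 1]
  by (simp add: map_comp2_def psi_row rat_subst_mult rat_subst_divide rat_subst_row rat_subst_vars)

lemma phi_phi: "map_comp2 (phi M) (phi M) = (var_x, var_y)"
  using phi_comp[of "fst (phi M)" "snd (phi M)"] phi_dominant row_var_nonzero rows
  by (simp add: phi_row)

lemma psi_psi: "map_comp2 (psi M) (psi M) = (var_x, var_y)"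
  using psi_comp[of "fst (psi M)" "snd (psi M)"] psi_dominant row_var_nonzero rows
  by (simp add: psi_row)

lemma phi_psi_carrier: "{phi M, psi M} \<subseteq> carrier birational_group"
  using involution_in_birational_group phi_dominant psi_dominant phi_phi psi_psi by simp

lemma group_model_group: "group (model_group M)"
  unfolding model_group_def
  by (rule group.subgroup_imp_group[OF group_birational_group
        group.generate_is_subgroup[OF group_birational_group phi_psi_carrier]])

lemma model_group_dominant: "P \<in> carrier (model_group M) \<Longrightarrow> dominant P"
proof -
  have "carrier (model_group M) \<subseteq> carrier birational_group"
    by (simp add: model_group_def group.generate_incl[OF group_birational_group phi_psi_carrier])
  then show "P \<in> carrier (model_group M) \<Longrightarrow> dominant P"
    using birational_group_dominant by blast
qed

lemma model_group_simps [simp]: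
  "\<one>\<^bsub>model_group M\<^esub> = (var_x, var_y)" "mult (model_group M) = map_comp2"
  by (simp_all add: model_group_def)

lemma generators_in: "phi M \<in> carrier (model_group M)" "psi M \<in> carrier (model_group M)"
  by (auto simp: model_group_def intro: generate.incl)

text \<open>
  The alternating words in the two involutions, with \<open>\<phi>\<close> as the innermost letter; the words of even
  length are the powers of \<open>\<psi>\<phi>\<close>.
\<close>
primrec orbit :: "nat \<Rightarrow> ratmap" where
  "orbit 0 = (var_x, var_y)"
| "orbit (Suc k) = map_comp2 (if even k then phi M else psi M) (orbit k)"

lemma orbit_in: "orbit k \<in> carrier (model_group M)"
proof (induction k)
  case 0
  show ?case
    using monoid.one_closed[OF group.is_monoid[OF group_model_group]] by simp
next
  case (Suc k)
  then show ?case
    using monoid.m_closed[OF group.is_monoid[OF group_model_group] _ Suc.IH] generators_in by simp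
qed

lemma orbit_dominant: "dominant (orbit k)"
  using orbit_in model_group_dominant by blast

lemma rat_subst_pow:
  assumes "P \<in> carrier (model_group M)"
  shows "rat_subst (P [^]\<^bsub>model_group M\<^esub> n) f = (rat_subst P ^^ n) f"
proof (induction n arbitrary: f)
  case (Suc n)
  have "P [^]\<^bsub>model_group M\<^esub> n \<in> carrier (model_group M)"
    using assms by (rule monoid.nat_pow_closed[OF group.is_monoid[OF group_model_group]])
  then have "rat_subst (P [^]\<^bsub>model_group M\<^esub> Suc n) f =
      rat_subst P (rat_subst (P [^]\<^bsub>model_group M\<^esub> n) f)"
    using assms by (simp add: rat_subst_map_comp2 model_group_dominant)
  then show ?case
    by (simp add: Suc.IH)
qed (simp add: rat_subst_id)

lemma finite_period:
  assumes "finite (carrier (model_group M))" "P \<in> carrier (model_group M)"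
  obtains n where "n > 0" "P [^]\<^bsub>model_group M\<^esub> n = (var_x, var_y)"
    "\<And>f. (rat_subst P ^^ n) f = f"
proof -
  interpret group "model_group M"
    by (rule group_model_group)
  have "range (\<lambda>k::nat. P [^]\<^bsub>model_group M\<^esub> k) \<subseteq> carrier (model_group M)"
    using nat_pow_closed[OF assms(2)] by blast
  then have "\<not> inj (\<lambda>k::nat. P [^]\<^bsub>model_group M\<^esub> k)"
    using assms(1) finite_imageD infinite_UNIV_nat finite_subset by blast
  then obtain i j :: nat where ij: "i < j" "P [^]\<^bsub>model_group M\<^esub> i = P [^]\<^bsub>model_group M\<^esub> j"
    unfolding inj_def by (metis linorder_neqE_nat)
  define n where "n = j - i"
  have "P [^]\<^bsub>model_group M\<^esub> i \<otimes>\<^bsub>model_group M\<^esub> P [^]\<^bsub>model_group M\<^esub> n =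
      P [^]\<^bsub>model_group M\<^esub> i"
    using ij nat_pow_mult[OF assms(2), of i n] by (simp add: n_def)
  then have pow: "P [^]\<^bsub>model_group M\<^esub> n = \<one>\<^bsub>model_group M\<^esub>"
    using l_cancel_one[OF nat_pow_closed[OF assms(2)] nat_pow_closed[OF assms(2)]] by blast
  show ?thesis
  proof (rule that)
    show "n > 0"
      using ij(1) by (simp add: n_def)
    show "P [^]\<^bsub>model_group M\<^esub> n = (var_x, var_y)"
      using pow by simp
    then show "(rat_subst P ^^ n) f = f" for f
      using rat_subst_pow[OF assms(2), of n f] by (simp add: rat_subst_id)
  qed
qed

text \<open>
  If some alternating word scales the leading monomials of \<open>x\<close> and \<open>y\<close>, then it has finite order only
  as the identity; in a finite group every element has finite order.
\<close>
theorem infinite_periodic_direction: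
  assumes "leads (fst (orbit k)) c 1 0" "leads (snd (orbit k)) d 0 1" "c > 0" "d > 0"
    and "orbit k \<noteq> (var_x, var_y)"
  shows "infinite (carrier (model_group M))"
proof
  assume "finite (carrier (model_group M))"
  then obtain n where "n > 0" "\<And>f. (rat_subst (orbit k) ^^ n) f = f"
    using finite_period orbit_in by metis
  then show False
    using finite_order_leads[OF assms(1,2)] assms(3-5) by (metis prod.collapse)
qed

lemma orbit_even: "orbit (2 * k) = orbit 2 [^]\<^bsub>model_group M\<^esub> k"
proof (induction k)
  case (Suc k)
  interpret group "model_group M"
    by (rule group_model_group)
  have 2: "orbit 2 = map_comp2 (psi M) (phi M)"
    using phi_dominant generators_in r_one[of "phi M"] by (simp add: numeral_2_eq_2)
  have "orbit (2 * Suc k) = map_comp2 (psi M) (map_comp2 (phi M) (orbit (2 * k)))"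
    by simp
  also have "\<dots> = map_comp2 (orbit 2) (orbit 2 [^]\<^bsub>model_group M\<^esub> k)"
    using m_assoc[OF generators_in(2,1) orbit_in[of "2 * k"]] by (simp add: 2 Suc.IH)
  also have "\<dots> = orbit 2 [^]\<^bsub>model_group M\<^esub> Suc k"
    using nat_pow_Suc2[OF orbit_in[of 2], of k] by simp
  finally show ?case .
qed simp

theorem infinite_aperiodic:
  assumes "\<And>k. k > 0 \<Longrightarrow> orbit (2 * k) \<noteq> (var_x, var_y)"
  shows "infinite (carrier (model_group M))"
  using finite_period[OF _ orbit_in[of 2]] assms orbit_even by metis

text \<open>
  Once an alternating word of length \<open>2 n\<close> is trivial, left multiplication by \<open>\<phi>\<close> or \<open>\<psi>\<close> only
  moves to a neighbour in the cycle of the first \<open>2 n\<close> words, so these words form the whole group.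
\<close>
theorem card_le_periodic:
  assumes n: "n > 0" and per: "orbit (2 * n) = (var_x, var_y)"
  shows "finite (carrier (model_group M)) \<and> card (carrier (model_group M)) \<le> 2 * n"
proof -
  interpret group "model_group M"
    by (rule group_model_group)
  let ?H = "orbit ` {..<2 * n}"
  have phi: "map_comp2 (phi M) (orbit k) \<in> ?H" if k: "k < 2 * n" for k
  proof (cases "even k")
    case True
    then have "Suc k < 2 * n"
      using k by presburger
    then show ?thesis
      using True by (intro image_eqI[of _ _ "Suc k"]) auto
  next
    case False
    then obtain l where l: "k = Suc l" "even l"
      by (metis even_Suc odd_Suc_minus_one)
    have "map_comp2 (phi M) (orbit k) = orbit l"
      using m_assoc[OF generators_in(1,1) orbit_in[of l]] l_one[OF orbit_in[of l]]
      by (simp add: l phi_phi)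
    then show ?thesis
      using k l by auto
  qed
  have psi_back: "map_comp2 (psi M) (orbit (Suc l)) = orbit l" if "odd l" for l
    using m_assoc[OF generators_in(2,2) orbit_in[of l]] l_one[OF orbit_in[of l]] that
    by (simp add: psi_psi)
  have psi: "map_comp2 (psi M) (orbit k) \<in> ?H" if k: "k < 2 * n" for k
  proof -
    consider "odd k" | l where "k = Suc l" "odd l" | "k = 0"
      by (metis even_Suc not0_implies_Suc)
    then show ?thesis
    proof cases
      case 1
      show ?thesis
      proof (cases "Suc k = 2 * n")
        case True
        then show ?thesis
          using 1 per n by (intro image_eqI[of _ _ 0]) (auto simp flip: True)
      next
        case False
        then show ?thesis
          using 1 k by (intro image_eqI[of _ _ "Suc k"]) auto
      qed
    next
      case 2
      then show ?thesis
        using k psi_back by auto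
    next
      case 3
      obtain l where l: "2 * n = Suc l" "odd l"
        using n by (metis Suc_pred' even_Suc dvd_triv_left nat_0_less_mult_iff zero_less_numeral)
      have "map_comp2 (psi M) (orbit k) = orbit l"
        using psi_back[OF l(2)] per by (simp only: 3 orbit.simps(1) flip: l(1))
      then show ?thesis
        using l by auto
    qed
  qed
  have inv: "inv\<^bsub>birational_group\<^esub> phi M = phi M" "inv\<^bsub>birational_group\<^esub> psi M = psi M"
    using group.inv_equality[OF group_birational_group] phi_phi psi_psi phi_psi_carrier by auto
  have closed: "\<forall>h\<in>?H. map_comp2 g h \<in> ?H"
    if "g \<in> generate birational_group {phi M, psi M}" for g
    using that
  proof induction
    case one
    have "map_comp2 (var_x, var_y) (orbit k) = orbit k" for k
      using l_one[OF orbit_in[of k]] by simp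
    then show ?case
      by auto
  next
    case (eng g h)
    have assoc: "map_comp2 (map_comp2 g h) (orbit k) = map_comp2 g (map_comp2 h (orbit k))" for k
      using m_assoc[of g h "orbit k"] eng.hyps orbit_in by (simp add: model_group_def)
    show ?case
    proof
      fix u assume u: "u \<in> ?H"
      then obtain k where "u = orbit k"
        by blast
      then have "map_comp2 (map_comp2 g h) u = map_comp2 g (map_comp2 h u)"
        using assoc by simp
      moreover have "map_comp2 g (map_comp2 h u) \<in> ?H"
        by (rule bspec[OF eng.IH(1) bspec[OF eng.IH(2) u]])
      ultimately show "map_comp2 (g \<otimes>\<^bsub>birational_group\<^esub> h) u \<in> ?H"
        by (simp only: birational_group_simps)
    qed
  qed (use phi psi inv in auto)
  have "carrier (model_group M) \<subseteq> ?H"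
  proof
    fix g assume g: "g \<in> carrier (model_group M)"
    then have "g \<in> generate birational_group {phi M, psi M}"
      by (simp add: model_group_def)
    moreover have "orbit 0 \<in> ?H"
      using n by (intro imageI) simp
    ultimately have "map_comp2 g (orbit 0) \<in> ?H"
      by (rule bspec[OF closed])
    then show "g \<in> ?H"
      using r_one[OF g] by simp
  qed
  then show ?thesis
    using card_image_le[of "{..<2 * n}" orbit] card_mono[of ?H "carrier (model_group M)"] finite_subset
    by fastforce
qed

end

section \<open>Models with a finite group\<close>

type_synonym rows = "row \<times> row \<times> row \<times> row"

definition rows_of :: "(int \<times> int) multiset \<Rightarrow> rows" where
  "rows_of M = (x_row M (-1), x_row M 1, y_row M (-1), y_row M 1)"

lemma row_proportional:
  fixes F :: ratfun
  assumes "a * g = b * f" "a * h = c * f" "b * h = c * g" "(a, b, c) \<noteq> (0, 0, 0)" "(f, g, h) \<noteq> (0, 0, 0)"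
  obtains k where "k > 0" "of_nat a = k * of_nat f" "of_nat b = k * of_nat g" "of_nat c = (k::rat) * of_nat h"
proof -
  have nat: "of_nat x * of_nat w = (of_nat y * of_nat z :: rat)" if "x * w = y * z" for x y z w :: nat
    using arg_cong[OF that, of of_nat] by simp
  consider "a \<noteq> 0" "f \<noteq> 0" | "b \<noteq> 0" "g \<noteq> 0" | "c \<noteq> 0" "h \<noteq> 0"
    using assms by (cases "a = 0"; cases "b = 0"; cases "c = 0") auto
  then show ?thesis
  proof cases
    case 1
    then show ?thesis
      using that[of "of_nat a / of_nat f"] nat[OF assms(1)] nat[OF assms(2)]
      by (simp add: field_simps)
  next
    case 2
    then show ?thesis
      using that[of "of_nat b / of_nat g"] nat[OF assms(1)] nat[OF assms(3)]
      by (simp add: field_simps)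
  next
    case 3
    then show ?thesis
      using that[of "of_nat c / of_nat h"] nat[OF assms(2)] nat[OF assms(3)]
      by (simp add: field_simps)
  qed
qed

text \<open>
  For non-zero rows \<open>p\<close>, \<open>q\<close>: the quotient \<open>p(F) / q(F)\<close> is a constant times \<open>F\<^sup>m\<close>. As rows have
  three entries, \<open>m\<close> lies between -2 and 2.
\<close>
definition monomial_ratio :: "int \<Rightarrow> row \<Rightarrow> row \<Rightarrow> bool" where
  "monomial_ratio m = (\<lambda>(a, b, c) (f, g, h).
     if m = 0 then a * g = b * f \<and> a * h = c * f \<and> b * h = c * g
     else if m = 1 then a = 0 \<and> h = 0 \<and> b * g = c * f
     else if m = -1 then c = 0 \<and> f = 0 \<and> a * h = b * g
     else if m = 2 then a = 0 \<and> b = 0 \<and> g = 0 \<and> h = 0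
     else if m = -2 then b = 0 \<and> c = 0 \<and> f = 0 \<and> g = 0
     else False)"

lemma monomial_ratio:
  assumes "monomial_ratio m p q" "p \<noteq> (0, 0, 0)" "q \<noteq> (0, 0, 0)"
  obtains k :: rat where "k \<noteq> 0"
    "\<And>F. F \<noteq> 0 \<Longrightarrow> row p F = const_fun k * F powi m * row q F"
proof -
  obtain a b c f g h where p: "p = (a, b, c)" and q: "q = (f, g, h)"
    by (metis prod.exhaust)
  have cf: "(of_nat x :: ratfun) = const_fun k * of_nat y" if "(of_nat x :: rat) = k * of_nat y" for x y k
    using arg_cong[OF that, of const_fun] by (simp add: const_fun_of_nat)
  consider "m = 0" | "m = 1" | "m = -1" | "m = 2" | "m = -2"
    using assms(1) by (auto simp: monomial_ratio_def p q split: if_splits)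
  then show ?thesis
  proof cases
    case 1
    then have "a * g = b * f" "a * h = c * f" "b * h = c * g"
      using assms(1) by (auto simp: monomial_ratio_def p q)
    then obtain k :: rat where k: "k > 0" "of_nat a = k * of_nat f" "of_nat b = k * of_nat g"
        "of_nat c = k * of_nat h"
      using assms(2,3) unfolding p q by (rule row_proportional)
    show ?thesis
      by (rule that[of k]) (use k 1 in \<open>simp_all add: p q row_def cf[OF k(2)] cf[OF k(3)] cf[OF k(4)] algebra_simps\<close>)
  next
    case 2
    then have 0: "a = 0" "h = 0" "b * g = c * f"
      using assms(1) by (auto simp: monomial_ratio_def p q)
    then obtain k :: rat where k: "k > 0" "of_nat b = k * of_nat f" "of_nat c = k * of_nat g"
      using assms(2,3) row_proportional[of b g c f 0 0] unfolding p q by auto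
    show ?thesis
      by (rule that[of k]) (use k 2 0 in \<open>simp_all add: p q row_def cf[OF k(2)] cf[OF k(3)] field_simps\<close>)
  next
    case 3
    then have 0: "c = 0" "f = 0" "a * h = b * g"
      using assms(1) by (auto simp: monomial_ratio_def p q)
    then obtain k :: rat where k: "k > 0" "of_nat a = k * of_nat g" "of_nat b = k * of_nat h"
      using assms(2,3) row_proportional[of a h b g 0 0] unfolding p q by auto
    show ?thesis
      by (rule that[of k]) (use k 3 0 in \<open>simp_all add: p q row_def cf[OF k(2)] cf[OF k(3)] field_simps power_int_minus\<close>)
  next
    case 4
    then have 0: "a = 0" "b = 0" "g = 0" "h = 0"
      using assms(1) by (auto simp: monomial_ratio_def p q)
    define k :: rat where "k = of_nat c / of_nat f"
    have k: "k \<noteq> 0" "of_nat c = k * of_nat f"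
      using assms(2,3) by (auto simp: k_def p q 0)
    show ?thesis
      by (rule that[of k]) (use k 4 0 in \<open>simp_all add: p q row_def cf[OF k(2)] field_simps power2_eq_square\<close>)
  next
    case 5
    then have 0: "c = 0" "b = 0" "g = 0" "f = 0"
      using assms(1) by (auto simp: monomial_ratio_def p q)
    define k :: rat where "k = of_nat a / of_nat h"
    have k: "k \<noteq> 0" "of_nat a = k * of_nat h"
      using assms(2,3) by (auto simp: k_def p q 0)
    show ?thesis
      by (rule that[of k]) (use k 5 0 in \<open>simp_all add: p q row_def cf[OF k(2)] field_simps power2_eq_square power_int_minus\<close>)
  qed
qed

text \<open>
  Here \<open>A\<^sub>-/A\<^sub>+\<close> is \<open>(1 + y\<^sup>\<delta>)\<^sup>\<epsilon>\<close> and \<open>B\<^sub>-/B\<^sub>+\<close> is \<open>(1 + x\<^sup>2\<^sup>\<epsilon>)\<^sup>\<delta>\<close> with signs \<open>\<delta>\<close>, \<open>\<epsilon>\<close>. In the coordinates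
  \<open>u = x\<^sup>\<epsilon>\<close>, \<open>v = y\<^sup>\<delta>\<close> the involutions become \<open>u \<mapsto> (1 + v)/u\<close> and \<open>v \<mapsto> (1 + u\<^sup>2)/v\<close>.
\<close>
definition lyness_rows :: "rows list" where
  "lyness_rows = [
     ((0, 1, 1), (1, 2, 1), (0, 0, 1), (1, 0, 1)),
     ((1, 2, 1), (0, 1, 1), (1, 0, 0), (1, 0, 1)),
     ((1, 1, 0), (1, 2, 1), (1, 0, 1), (0, 0, 1)),
     ((1, 2, 1), (1, 1, 0), (1, 0, 1), (1, 0, 0))]"

text \<open>
  The possible pairs of exponents are those with \<open>m n = 1\<close> or \<open>m n = 2\<close>: the monomial map
  \<open>(x, y) \<mapsto> (y\<^sup>m/x, \<dots>)\<close> followed by \<open>(x, y) \<mapsto> (\<dots>, x\<^sup>n/y)\<close> has trace \<open>m n - 2\<close> and determinant 1 on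
  exponents, hence order 3 or 4.
\<close>
definition finite_rows :: "rows \<Rightarrow> bool" where
  "finite_rows = (\<lambda>(W, E, S, N).
     monomial_ratio 0 W E \<or> monomial_ratio 0 S N \<or>
     (\<exists>(m, n)\<in>{(1, 1), (-1, -1), (1, 2), (2, 1), (-1, -2), (-2, -1)}.
        monomial_ratio m W E \<and> monomial_ratio n S N) \<or>
     (W, E, S, N) \<in> set lyness_rows \<or> (S, N, W, E) \<in> set lyness_rows)"

text \<open>
  The recurrence \<open>w\<^sub>k\<^sub>+\<^sub>1 w\<^sub>k\<^sub>-\<^sub>1 = 1 + w\<^sub>k\<^sup>e\<close>, in which \<open>e\<close> alternates between 1 and 2, has period 6 (the
  cluster recurrence of type \<open>B\<^sub>2\<close>). The values in between are written out as functions of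
  two consecutive ones.
\<close>
lemma lyness_period:
  fixes U V :: "nat \<Rightarrow> 'a::field"
  assumes U: "\<And>k. U (Suc k) = (1 + V k) / U k"
    and V: "\<And>k. V (Suc k) = (1 + (U (Suc k))\<^sup>2) / V k"
    and nz: "\<And>k. U k \<noteq> 0" "\<And>k. V k \<noteq> 0"
  shows "U (k + 3) = U k \<and> V (k + 3) = V k"
proof -
  define u v u1 v1 u2 v2 where uv: "u = U k" "v = V k" "u1 = U (Suc k)" "v1 = V (Suc k)"
    "u2 = U (Suc (Suc k))" "v2 = V (Suc (Suc k))"
  note nz' = nz[of k] nz[of "Suc k"] nz[of "Suc (Suc k)"]
  note cancel = mult_right_cancel[THEN iffD1, rotated]
  have u1: "u1 = (1 + v) / u"
    by (simp add: uv U)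
  have v1: "v1 = (u\<^sup>2 + (1 + v)\<^sup>2) / (u\<^sup>2 * v)"
    using nz' by (simp add: uv V U power_divide field_simps)
  have "u2 * u1 = 1 + v1"
    using nz' by (simp add: uv U[of "Suc k"])
  also have "\<dots> = (u\<^sup>2 + 1 + v) / (u * v) * u1"
    using nz' by (simp add: v1 u1 field_simps power2_eq_square flip: uv)
  finally have u2: "u2 = (u\<^sup>2 + 1 + v) / (u * v)"
    by (rule cancel) (use nz' in \<open>simp add: uv\<close>)
  have "v2 * v1 = 1 + u2\<^sup>2"
    using nz' by (simp add: uv V[of "Suc k"])
  also have "\<dots> = (1 + u\<^sup>2) / v * v1"
    using nz' unfolding uv[symmetric] v1 u2
    by (simp add: power_divide field_simps) (simp add: power2_eq_square power4_eq_xxxx algebra_simps)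
  finally have v2: "v2 = (1 + u\<^sup>2) / v"
    by (rule cancel) (use nz' in \<open>simp add: uv\<close>)
  have "U (k + 3) * u2 = 1 + v2"
    using nz' by (simp add: uv U[of "Suc (Suc k)"] numeral_3_eq_3)
  also have "\<dots> = u * u2"
    using nz' unfolding uv[symmetric] v2 u2 by (simp add: field_simps power2_eq_square)
  finally have u3: "U (k + 3) = u"
    by (rule cancel) (use nz' in \<open>simp add: uv\<close>)
  have "V (k + 3) * v2 = 1 + u\<^sup>2"
    using nz' u3 by (simp add: uv V[of "Suc (Suc k)"] numeral_3_eq_3)
  also have "\<dots> = v * v2"
    using nz' by (simp add: v2 flip: uv)
  finally have "V (k + 3) = v"
    by (rule cancel) (use nz' in \<open>simp add: uv\<close>)
  then show ?thesis
    using u3 by (simp add: uv)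
qed

text \<open>
  The same recurrence entered one step later.
\<close>
lemma lyness_period_mirror:
  fixes U V :: "nat \<Rightarrow> 'a::field"
  assumes U: "\<And>k. U (Suc k) = (1 + (V k)\<^sup>2) / U k"
    and V: "\<And>k. V (Suc k) = (1 + U (Suc k)) / V k"
    and nz: "\<And>k. U k \<noteq> 0" "\<And>k. V k \<noteq> 0"
  shows "U 3 = U 0 \<and> V 3 = V 0"
proof -
  have *: "V (0 + 3) = V 0 \<and> U (Suc (0 + 3)) = U (Suc 0)"
    by (rule lyness_period[of V "\<lambda>k. U (Suc k)"]) (rule V U nz)+
  have "U 3 * U 4 = 1 + (V 3)\<^sup>2" "U 0 * U 1 = 1 + (V 0)\<^sup>2"
    using nz(1)[of 3] nz(1)[of 0] U[of 3] U[of 0] by (simp_all add: field_simps)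
  moreover have "U 4 = U 1" "V 3 = V 0"
    using * by (simp_all add: eval_nat_numeral)
  ultimately have "U 3 * U 1 = U 0 * U 1"
    by simp
  then show ?thesis
    using nz(1)[of 1] \<open>V 3 = V 0\<close> by simp
qed

lemma lyness_ratios:
  fixes F :: "'a::field"
  assumes "F \<noteq> 0"
  shows "1 + F \<noteq> 0 \<Longrightarrow> row (0, 1, 1) F / row (1, 2, 1) F = inverse (1 + inverse F)"
    "1 + F \<noteq> 0 \<Longrightarrow> row (1, 2, 1) F / row (0, 1, 1) F = 1 + inverse F"
    "1 + F \<noteq> 0 \<Longrightarrow> row (1, 1, 0) F / row (1, 2, 1) F = inverse (1 + F)"
    "1 + F \<noteq> 0 \<Longrightarrow> row (1, 2, 1) F / row (1, 1, 0) F = 1 + F"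
    "row (0, 0, 1) F / row (1, 0, 1) F = inverse (1 + (inverse F)\<^sup>2)"
    "row (1, 0, 0) F / row (1, 0, 1) F = inverse (1 + F\<^sup>2)"
    "row (1, 0, 1) F / row (0, 0, 1) F = 1 + (inverse F)\<^sup>2"
    "row (1, 0, 1) F / row (1, 0, 0) F = 1 + F\<^sup>2"
proof -
  assume 1: "1 + F \<noteq> 0"
  have rows: "row (1, 2, 1) F = (1 + F) * (1 + F) / F" "row (0, 1, 1) F = 1 + F"
    "row (1, 1, 0) F = (1 + F) / F" "1 + inverse F = (1 + F) / F"
    using assms by (simp_all add: row_def field_simps)
  show "row (0, 1, 1) F / row (1, 2, 1) F = inverse (1 + inverse F)"
    "row (1, 2, 1) F / row (0, 1, 1) F = 1 + inverse F"
    "row (1, 1, 0) F / row (1, 2, 1) F = inverse (1 + F)"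
    "row (1, 2, 1) F / row (1, 1, 0) F = 1 + F"
    unfolding rows using 1 assms by (simp_all add: inverse_eq_divide)
next
  have rows: "row (1, 0, 1) F = (1 + F\<^sup>2) / F" "row (0, 0, 1) F = F" "row (1, 0, 0) F = 1 / F"
    "1 + (inverse F)\<^sup>2 = (1 + F\<^sup>2) / F\<^sup>2"
    using assms by (simp_all add: row_def field_simps power2_eq_square)
  show "row (0, 0, 1) F / row (1, 0, 1) F = inverse (1 + (inverse F)\<^sup>2)"
    "row (1, 0, 0) F / row (1, 0, 1) F = inverse (1 + F\<^sup>2)"
    "row (1, 0, 1) F / row (0, 0, 1) F = 1 + (inverse F)\<^sup>2"
    "row (1, 0, 1) F / row (1, 0, 0) F = 1 + F\<^sup>2"
    unfolding rows using assms by (simp_all add: power2_eq_square inverse_eq_divide)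
qed

lemma row_reflect:
  fixes F :: ratfun
  assumes "F \<noteq> 0" "of_nat a = k * of_nat c" "k \<noteq> (0::rat)"
  shows "row (a, b, c) (const_fun k / F) = row (a, b, c) F"
proof -
  have "(of_nat a :: ratfun) = const_fun k * of_nat c"
    using arg_cong[OF assms(2), of const_fun] by (simp add: const_fun_of_nat)
  then show ?thesis
    using assms(1,3) by (simp add: row_def)
qed

context walk_model
begin

lemma orbit_nonzero: "fst (orbit k) \<noteq> 0" "snd (orbit k) \<noteq> 0"
proof -
  have "rat_subst (orbit k) var_x \<noteq> 0" "rat_subst (orbit k) var_y \<noteq> 0"
    using orbit_dominant rat_subst_eq_0_iff by simp_all
  then show "fst (orbit k) \<noteq> 0" "snd (orbit k) \<noteq> 0"
    by (simp_all add: rat_subst_vars orbit_dominant)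
qed

lemma row_orbit_nonzero:
  assumes "p \<noteq> (0, 0, 0)"
  shows "row p (fst (orbit k)) \<noteq> 0" "row p (snd (orbit k)) \<noteq> 0"
proof -
  have "rat_subst (orbit k) (row p var_x) \<noteq> 0" "rat_subst (orbit k) (row p var_y) \<noteq> 0"
    using orbit_dominant rat_subst_eq_0_iff row_var_nonzero assms by simp_all
  then show "row p (fst (orbit k)) \<noteq> 0" "row p (snd (orbit k)) \<noteq> 0"
    by (simp_all add: rat_subst_row rat_subst_vars orbit_dominant)
qed

definition X :: "nat \<Rightarrow> ratfun" where "X k = fst (orbit (2 * k))"
definition Y :: "nat \<Rightarrow> ratfun" where "Y k = snd (orbit (2 * k))"

lemma orbit_XY: "orbit (2 * k) = (X k, Y k)" "orbit (Suc (2 * k)) = (X (Suc k), Y k)"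
proof -
  show 1: "orbit (2 * k) = (X k, Y k)" for k
    by (simp add: X_def Y_def)
  have "snd (orbit (Suc (2 * k))) = Y k"
    using phi_comp[of "X k" "Y k"] orbit_dominant[of "2 * k"] by (simp add: 1)
  moreover have "fst (orbit (Suc (Suc (2 * k)))) = fst (orbit (Suc (2 * k)))"
    using psi_comp[of "fst (orbit (Suc (2 * k)))" "snd (orbit (Suc (2 * k)))"] orbit_dominant[of "Suc (2 * k)"]
    by (simp del: orbit.simps(2) add: orbit.simps(2)[of "Suc (2 * k)"])
  ultimately show "orbit (Suc (2 * k)) = (X (Suc k), Y k)"
    using 1[of "Suc k"] by (simp del: orbit.simps add: prod_eq_iff)
qed

lemma XY_0: "X 0 = var_x" "Y 0 = var_y"
  by (simp_all add: X_def Y_def)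

lemma XY_Suc:
  "X (Suc k) = 1 / X k * (row (x_row M (-1)) (Y k) / row (x_row M 1) (Y k))"
  "Y (Suc k) = 1 / Y k * (row (y_row M (-1)) (X (Suc k)) / row (y_row M 1) (X (Suc k)))"
proof -
  show "X (Suc k) = 1 / X k * (row (x_row M (-1)) (Y k) / row (x_row M 1) (Y k))"
    using phi_comp[of "X k" "Y k"] orbit_dominant[of "2 * k"] orbit_XY(2)[of k] by (simp add: orbit_XY(1))
  have "orbit (2 * Suc k) = map_comp2 (psi M) (orbit (Suc (2 * k)))"
    by simp
  then show "Y (Suc k) = 1 / Y k * (row (y_row M (-1)) (X (Suc k)) / row (y_row M 1) (X (Suc k)))"
    using psi_comp[of "X (Suc k)" "Y k"] orbit_dominant[of "Suc (2 * k)"]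
    by (simp only: orbit_XY) simp
qed

lemma XY_nonzero [simp]: "X k \<noteq> 0" "Y k \<noteq> 0"
  using orbit_nonzero[of "2 * k"] by (simp_all add: orbit_XY)

lemma row_XY_nonzero: "p \<noteq> (0, 0, 0) \<Longrightarrow> row p (X k) \<noteq> 0" "p \<noteq> (0, 0, 0) \<Longrightarrow> row p (Y k) \<noteq> 0"
  using row_orbit_nonzero[of p "2 * k"] by (simp_all add: orbit_XY)

lemma card_le_8:
  assumes "n > 0" "n \<le> 4" "X n = var_x" "Y n = var_y"
  shows "finite (carrier (model_group M)) \<and> card (carrier (model_group M)) \<le> 8"
  using card_le_periodic[of n] assms by (simp add: orbit_XY)

lemma X_monomial:
  assumes "monomial_ratio m (x_row M (-1)) (x_row M 1)"
  obtains r where "r \<noteq> 0" "\<And>k. X (Suc k) = r * Y k powi m / X k"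
    "\<And>F. F \<noteq> 0 \<Longrightarrow> row (x_row M (-1)) F = r * F powi m * row (x_row M 1) F"
proof -
  obtain k where "k \<noteq> 0" "\<And>F. F \<noteq> 0 \<Longrightarrow> row (x_row M (-1)) F = const_fun k * F powi m * row (x_row M 1) F"
    using monomial_ratio[OF assms] rows by metis
  then show ?thesis
    using that[of "const_fun k"] XY_Suc(1) row_XY_nonzero(2)[OF rows(2)] by simp
qed

lemma Y_monomial:
  assumes "monomial_ratio m (y_row M (-1)) (y_row M 1)"
  obtains r where "r \<noteq> 0" "\<And>k. Y (Suc k) = r * X (Suc k) powi m / Y k"
    "\<And>F. F \<noteq> 0 \<Longrightarrow> row (y_row M (-1)) F = r * F powi m * row (y_row M 1) F"
proof -
  obtain k where "k \<noteq> 0" "\<And>F. F \<noteq> 0 \<Longrightarrow> row (y_row M (-1)) F = const_fun k * F powi m * row (y_row M 1) F"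
    using monomial_ratio[OF assms] rows by metis
  then show ?thesis
    using that[of "const_fun k"] XY_Suc(2) row_XY_nonzero(1)[OF rows(4)] by simp
qed

lemma finite_monomial:
  assumes "monomial_ratio m (x_row M (-1)) (x_row M 1)" "monomial_ratio n (y_row M (-1)) (y_row M 1)"
    and mn: "(m, n) \<in> {(1, 1), (-1, -1), (1, 2), (2, 1), (-1, -2), (-2, -1)}"
  shows "finite (carrier (model_group M)) \<and> card (carrier (model_group M)) \<le> 8"
proof -
  obtain r where r: "r \<noteq> 0" "\<And>k. X (Suc k) = r * Y k powi m / X k"
    using X_monomial[OF assms(1)] by metis
  obtain s where s: "s \<noteq> 0" "\<And>k. Y (Suc k) = s * X (Suc k) powi n / Y k"
    using Y_monomial[OF assms(2)] by metis
  have "X 3 = var_x \<and> Y 3 = var_y \<or> X 4 = var_x \<and> Y 4 = var_y"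
    using mn r(1) s(1)
    by (auto simp: numeral_3_eq_3 eval_nat_numeral r(2) s(2) XY_0 power_int_minus power2_eq_square field_simps)
  then show ?thesis
    using card_le_8[of 3] card_le_8[of 4] by auto
qed

text \<open>
  The maps \<open>s\<close> and \<open>t\<close> are the changes of coordinates \<open>x \<mapsto> x\<^sup>\<epsilon>\<close> and \<open>y \<mapsto> y\<^sup>\<delta>\<close>.
\<close>
lemma finite_lyness:
  assumes s: "s \<in> {\<lambda>F. F, inverse}" and t: "t \<in> {\<lambda>F. F, inverse}"
    and "(\<forall>k. row (x_row M (-1)) (Y k) / row (x_row M 1) (Y k) = s (1 + t (Y k)) \<and>
            row (y_row M (-1)) (X k) / row (y_row M 1) (X k) = t (1 + (s (X k))\<^sup>2)) \<or>
         (\<forall>k. row (x_row M (-1)) (Y k) / row (x_row M 1) (Y k) = s (1 + (t (Y k))\<^sup>2) \<and>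
            row (y_row M (-1)) (X k) / row (y_row M 1) (X k) = t (1 + s (X k)))"
  shows "finite (carrier (model_group M)) \<and> card (carrier (model_group M)) \<le> 8"
proof -
  have nz: "s (X k) \<noteq> 0" "t (Y k) \<noteq> 0" for k
    using s t by auto
  have "s (X 3) = s (X 0) \<and> t (Y 3) = t (Y 0)"
    using assms(3)
  proof
    assume *: "\<forall>k. row (x_row M (-1)) (Y k) / row (x_row M 1) (Y k) = s (1 + t (Y k)) \<and>
            row (y_row M (-1)) (X k) / row (y_row M 1) (X k) = t (1 + (s (X k))\<^sup>2)"
    have "X (Suc k) = 1 / X k * s (1 + t (Y k))"
        "Y (Suc k) = 1 / Y k * t (1 + (s (X (Suc k)))\<^sup>2)" for k
      by (subst XY_Suc, simp only: *)+
    then have "s (X (Suc k)) = (1 + t (Y k)) / s (X k)"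
        "t (Y (Suc k)) = (1 + (s (X (Suc k)))\<^sup>2) / t (Y k)" for k
      using s t by (auto simp: divide_inverse)
    then show ?thesis
      using lyness_period[of "\<lambda>k. s (X k)" "\<lambda>k. t (Y k)" 0] nz by simp
  next
    assume *: "\<forall>k. row (x_row M (-1)) (Y k) / row (x_row M 1) (Y k) = s (1 + (t (Y k))\<^sup>2) \<and>
            row (y_row M (-1)) (X k) / row (y_row M 1) (X k) = t (1 + s (X k))"
    have "X (Suc k) = 1 / X k * s (1 + (t (Y k))\<^sup>2)"
        "Y (Suc k) = 1 / Y k * t (1 + s (X (Suc k)))" for k
      by (subst XY_Suc, simp only: *)+
    then have "s (X (Suc k)) = (1 + (t (Y k))\<^sup>2) / s (X k)"
        "t (Y (Suc k)) = (1 + s (X (Suc k))) / t (Y k)" for k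
      using s t by (auto simp: divide_inverse)
    then show ?thesis
      using lyness_period_mirror[of "\<lambda>k. s (X k)" "\<lambda>k. t (Y k)"] nz by simp
  qed
  then have "X 3 = X 0" "Y 3 = Y 0"
    using s t by auto
  then show ?thesis
    using card_le_8[of 3] by (simp add: XY_0)
qed

text \<open>
  If \<open>A\<^sub>- = k A\<^sub>+\<close>, then \<open>\<phi>\<close> is \<open>x \<mapsto> k/x\<close>. The proportionality, read by columns, says that \<open>B\<^sub>-\<close> and \<open>B\<^sub>+\<close>
  are invariant under \<open>x \<mapsto> k/x\<close>, so \<open>\<phi>\<close> and \<open>\<psi>\<close> commute.
\<close>
lemma finite_proportional:
  assumes "monomial_ratio 0 (x_row M (-1)) (x_row M 1) \<or> monomial_ratio 0 (y_row M (-1)) (y_row M 1)"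
  shows "finite (carrier (model_group M)) \<and> card (carrier (model_group M)) \<le> 8"
  using assms
proof
  assume W: "monomial_ratio 0 (x_row M (-1)) (x_row M 1)"
  then have minors: "count M (-1, -1) * count M (1, 0) = count M (-1, 0) * count M (1, -1)"
      "count M (-1, -1) * count M (1, 1) = count M (-1, 1) * count M (1, -1)"
      "count M (-1, 0) * count M (1, 1) = count M (-1, 1) * count M (1, 0)"
    by (simp_all add: monomial_ratio_def x_row_def)
  obtain k :: rat where k: "k > 0" "of_nat (count M (-1, -1)) = k * of_nat (count M (1, -1))"
      "of_nat (count M (-1, 0)) = k * of_nat (count M (1, 0))"
      "of_nat (count M (-1, 1)) = k * of_nat (count M (1, 1))"
    by (rule row_proportional[OF minors rows(1,2)[unfolded x_row_def]])
  have "row (x_row M (-1)) F = const_fun k * row (x_row M 1) F" for F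
    using k(2-4)[THEN arg_cong[where f = const_fun]]
    by (simp add: x_row_def row_def const_fun_of_nat algebra_simps)
  then have X: "X (Suc j) = const_fun k / X j" for j
    using row_XY_nonzero(2)[OF rows(2)] by (simp add: XY_Suc(1))
  have "row (y_row M (-1)) (X 1) = row (y_row M (-1)) (X 0)" "row (y_row M 1) (X 1) = row (y_row M 1) (X 0)"
    using k X[of 0] by (simp_all add: y_row_def row_reflect)
  moreover have "X 2 = X 0"
    using k(1) by (simp add: X numeral_2_eq_2)
  ultimately have "Y 2 = Y 0"
    using row_XY_nonzero(1)[OF rows(3), of 0] row_XY_nonzero(1)[OF rows(4), of 0]
      XY_Suc(2)[of 0] XY_Suc(2)[of 1] by (simp add: numeral_2_eq_2)
  with \<open>X 2 = X 0\<close> show ?thesis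
    using card_le_8[of 2] by (simp add: XY_0)
next
  assume S: "monomial_ratio 0 (y_row M (-1)) (y_row M 1)"
  then have minors: "count M (-1, -1) * count M (0, 1) = count M (0, -1) * count M (-1, 1)"
      "count M (-1, -1) * count M (1, 1) = count M (1, -1) * count M (-1, 1)"
      "count M (0, -1) * count M (1, 1) = count M (1, -1) * count M (0, 1)"
    by (simp_all add: monomial_ratio_def y_row_def)
  obtain k :: rat where k: "k > 0" "of_nat (count M (-1, -1)) = k * of_nat (count M (-1, 1))"
      "of_nat (count M (0, -1)) = k * of_nat (count M (0, 1))"
      "of_nat (count M (1, -1)) = k * of_nat (count M (1, 1))"
    by (rule row_proportional[OF minors rows(3,4)[unfolded y_row_def]])
  have "row (y_row M (-1)) F = const_fun k * row (y_row M 1) F" for F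
    using k(2-4)[THEN arg_cong[where f = const_fun]]
    by (simp add: y_row_def row_def const_fun_of_nat algebra_simps)
  then have Y: "Y (Suc j) = const_fun k / Y j" for j
    using row_XY_nonzero(1)[OF rows(4)] by (simp add: XY_Suc(2))
  have "row (x_row M (-1)) (Y 1) = row (x_row M (-1)) (Y 0)" "row (x_row M 1) (Y 1) = row (x_row M 1) (Y 0)"
    using k Y[of 0] by (simp_all add: x_row_def row_reflect)
  moreover have "Y 2 = Y 0"
    using k(1) by (simp add: Y numeral_2_eq_2)
  ultimately have "X 2 = X 0"
    using row_XY_nonzero(2)[OF rows(1), of 0] row_XY_nonzero(2)[OF rows(2), of 0]
      XY_Suc(1)[of 0] XY_Suc(1)[of 1] by (simp add: numeral_2_eq_2)
  with \<open>Y 2 = Y 0\<close> show ?thesis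
    using card_le_8[of 2] by (simp add: XY_0)
qed

theorem finite_rows_card:
  assumes "finite_rows (rows_of M)"
  shows "finite (carrier (model_group M)) \<and> card (carrier (model_group M)) \<le> 8"
proof -
  have nz: "1 + X k \<noteq> 0" "1 + Y k \<noteq> 0" for k
    using row_XY_nonzero[of "(0, 1, 1)" k] by (simp_all add: row_def)
  note ratios = lyness_ratios(1-4)[OF XY_nonzero(1) nz(1)] lyness_ratios(1-4)[OF XY_nonzero(2) nz(2)]
    lyness_ratios(5-8)[OF XY_nonzero(1)] lyness_ratios(5-8)[OF XY_nonzero(2)]
  consider "monomial_ratio 0 (x_row M (-1)) (x_row M 1) \<or> monomial_ratio 0 (y_row M (-1)) (y_row M 1)"
    | m n where "monomial_ratio m (x_row M (-1)) (x_row M 1)" "monomial_ratio n (y_row M (-1)) (y_row M 1)"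
        "(m, n) \<in> {(1, 1), (-1, -1), (1, 2), (2, 1), (-1, -2), (-2, -1)}"
    | "rows_of M \<in> set lyness_rows"
    | "(y_row M (-1), y_row M 1, x_row M (-1), x_row M 1) \<in> set lyness_rows"
    using assms unfolding finite_rows_def rows_of_def by fast
  then show ?thesis
  proof cases
    case 1
    then show ?thesis
      by (rule finite_proportional)
  next
    case 2
    then show ?thesis
      by (rule finite_monomial)
  next
    case 3
    then show ?thesis
      using finite_lyness[of inverse inverse] finite_lyness[of "\<lambda>F. F" inverse]
        finite_lyness[of inverse "\<lambda>F. F"] finite_lyness[of "\<lambda>F. F" "\<lambda>F. F"]
      by (auto simp: lyness_rows_def rows_of_def ratios[unfolded One_nat_def])
  next
    case 4
    then show ?thesis
      using finite_lyness[of inverse inverse] finite_lyness[of "\<lambda>F. F" inverse]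
        finite_lyness[of inverse "\<lambda>F. F"] finite_lyness[of "\<lambda>F. F" "\<lambda>F. F"]
      by (auto simp: lyness_rows_def rows_of_def ratios[unfolded One_nat_def])
  qed
qed

end

section \<open>Leading monomials along an orbit\<close>

type_synonym exps = "int \<times> int \<times> int \<times> int"

text \<open>
  The non-zero multiplicities of a model are 1, 2 or 3, so every leading coefficient met along an orbit is of
  the form \<open>2\<^sup>u 3\<^sup>v\<close>. Recording \<open>(i, j, u, v)\<close> instead of the term \<open>2\<^sup>u 3\<^sup>v x\<^sup>i y\<^sup>j\<close> turns the
  involutions into piecewise affine maps of integer vectors.
\<close>
definition leads_exps :: "ratfun \<Rightarrow> exps \<Rightarrow> bool" where
  "leads_exps F = (\<lambda>(i, j, u, v). leads F (2 powi u * 3 powi v) i j)"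

definition log23 :: "nat \<Rightarrow> int \<times> int" where
  "log23 n = (if n = 2 then (1, 0) else if n = 3 then (0, 1) else (0, 0))"

definition lead_row :: "row \<Rightarrow> exps \<Rightarrow> exps" where
  "lead_row p = (\<lambda>(i, j, u, v).
     let (n, e) = (if lex_pos i j then low p else high p); (a, b) = log23 n
     in (e * i, e * j, e * u + a, e * v + b))"

definition lead_step :: "row \<Rightarrow> row \<Rightarrow> exps \<Rightarrow> exps \<Rightarrow> exps" where
  "lead_step p q A B =
     (let (i, j, u, v) = A; (i1, j1, u1, v1) = lead_row p B; (i2, j2, u2, v2) = lead_row q B
      in (i1 - i2 - i, j1 - j2 - j, u1 - u2 - u, v1 - v2 - v))"

definition constant_exps :: "exps \<Rightarrow> bool" where
  "constant_exps = (\<lambda>(i, j, u, v). i = 0 \<and> j = 0)"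

definition entries_le_3 :: "row \<Rightarrow> bool" where
  "entries_le_3 = (\<lambda>(a, b, c). a \<le> 3 \<and> b \<le> 3 \<and> c \<le> 3)"

lemma log23: "n \<in> {1, 2, 3} \<Longrightarrow> log23 n = (a, b) \<Longrightarrow> (2::rat) powi a * 3 powi b = of_nat n"
  by (auto simp: log23_def)

lemma leads_exps_row:
  assumes F: "leads_exps F A" and A: "\<not> constant_exps A" and p: "p \<noteq> (0, 0, 0)" "entries_le_3 p"
  shows "leads_exps (row p F) (lead_row p A)"
proof -
  obtain i j u v where ij: "A = (i, j, u, v)"
    by (metis prod.exhaust)
  obtain n e where ne: "(n, e) = (if lex_pos i j then low p else high p)"
    by (metis prod.exhaust)
  obtain a b where ab: "log23 n = (a, b)"
    by fastforce
  have n: "n \<in> {1, 2, 3}"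
    using ne p by (cases p) (auto simp: low_def high_def entries_le_3_def split: if_splits)
  have "leads (row p F) (of_nat n * (2 powi u * 3 powi v) powi e) (e * i) (e * j)"
    using F A by (intro leads_row[OF _ p(1) _ ne]) (auto simp: leads_exps_def constant_exps_def ij)
  moreover have "of_nat n * (2 powi u * 3 powi v) powi e = 2 powi (e * u + a) * (3 powi (e * v + b) :: rat)"
  proof -
    have "(2 powi u * 3 powi v) powi e = 2 powi (e * u) * (3 powi (e * v) :: rat)"
      by (simp only: power_int_mult_distrib mult.commute[of e] power_int_mult)
    then show ?thesis
      by (simp add: log23[OF n ab, symmetric] power_int_add)
  qed
  ultimately show ?thesis
    by (simp add: leads_exps_def lead_row_def ij ab flip: ne)
qed

lemma leads_exps_step:
  assumes F: "leads_exps F A" and G: "leads_exps G B" "\<not> constant_exps B"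
    and p: "p \<noteq> (0, 0, 0)" "entries_le_3 p" and q: "q \<noteq> (0, 0, 0)" "entries_le_3 q"
  shows "leads_exps (1 / F * (row p G / row q G)) (lead_step p q A B)"
proof -
  obtain i j u v where A: "A = (i, j, u, v)"
    by (metis prod.exhaust)
  obtain i1 j1 u1 v1 where B1: "lead_row p B = (i1, j1, u1, v1)"
    by (metis prod.exhaust)
  obtain i2 j2 u2 v2 where B2: "lead_row q B = (i2, j2, u2, v2)"
    by (metis prod.exhaust)
  have "leads (row p G / row q G / F)
      (2 powi u1 * 3 powi v1 / (2 powi u2 * 3 powi v2) / (2 powi u * 3 powi v)) (i1 - i2 - i) (j1 - j2 - j)"
    using leads_exps_row[OF G p] leads_exps_row[OF G q] F
    by (intro leads_divide) (simp_all add: leads_exps_def A B1 B2)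
  moreover have "2 powi u1 * 3 powi v1 / (2 powi u2 * 3 powi v2) / (2 powi u * 3 powi v) =
      2 powi (u1 - u2 - u) * (3 powi (v1 - v2 - v) :: rat)"
    by (simp add: power_int_diff)
  moreover have "row p G / row q G / F = 1 / F * (row p G / row q G)"
    by simp
  ultimately have "leads (1 / F * (row p G / row q G))
      (2 powi (u1 - u2 - u) * 3 powi (v1 - v2 - v)) (i1 - i2 - i) (j1 - j2 - j)"
    by (simp only:)
  then show ?thesis
    by (simp add: leads_exps_def lead_step_def A B1 B2)
qed

text \<open>
  One application of \<open>\<psi>\<phi>\<close>. A constant leading monomial is refused because it does not tell which
  end of a row dominates.
\<close>
definition lead_turn :: "rows \<Rightarrow> exps \<times> exps \<Rightarrow> (exps \<times> exps) option" where
  "lead_turn = (\<lambda>(W, E, S, N) (A, B).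
     if constant_exps B then None
     else let A' = lead_step W E A B
          in if constant_exps A' then None else Some (A', lead_step S N B A'))"

definition same_monomials :: "exps \<times> exps \<Rightarrow> bool" where
  "same_monomials = (\<lambda>((i, j, _), (k, l, _)). i = 1 \<and> j = 0 \<and> k = 0 \<and> l = 1)"

primrec lead_return :: "rows \<Rightarrow> nat \<Rightarrow> nat \<Rightarrow> exps \<times> exps \<Rightarrow> (nat \<times> exps \<times> exps) option" where
  "lead_return t 0 n s = None"
| "lead_return t (Suc b) n s = (case lead_turn t s of None \<Rightarrow> None
     | Some s' \<Rightarrow> if same_monomials s' then Some (Suc n, s') else lead_return t b (Suc n) s')"

definition lead_start :: "exps \<times> exps" where
  "lead_start = ((1, 0, 0, 0), (0, 1, 0, 0))"

section \<open>Values along an orbit\<close>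

type_synonym ratio = "int \<times> int"

text \<open>
  A row evaluated at the fraction \<open>m/n\<close>, multiplied by \<open>m n\<close>.
\<close>
definition quad :: "row \<Rightarrow> ratio \<Rightarrow> int" where
  "quad = (\<lambda>(a, b, c) (m, n). int a * n * n + int b * m * n + int c * m * m)"

text \<open>
  Heights grow quadratically along an orbit, so numerators and denominators are kept modulo 53 only.
  Steps at which either of them vanishes modulo 53 are refused, which also keeps the orbit away from
  zeros and poles.
\<close>
definition value_step :: "row \<Rightarrow> row \<Rightarrow> ratio \<Rightarrow> ratio \<Rightarrow> ratio option" where
  "value_step p q = (\<lambda>(m, n) z. let P = quad p z * n mod 53; Q = quad q z * m mod 53
     in if P = 0 \<or> Q = 0 then None else Some (P, Q))"

definition value_turn :: "rows \<Rightarrow> ratio \<times> ratio \<Rightarrow> (ratio \<times> ratio) option" where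
  "value_turn = (\<lambda>(W, E, S, N) (x, y). case value_step W E x y of None \<Rightarrow> None
     | Some x' \<Rightarrow> (case value_step S N y x' of None \<Rightarrow> None | Some y' \<Rightarrow> Some (x', y')))"

primrec value_orbit :: "rows \<Rightarrow> nat \<Rightarrow> ratio \<times> ratio \<Rightarrow> (ratio \<times> ratio) option" where
  "value_orbit t 0 s = Some s"
| "value_orbit t (Suc k) s = (case value_turn t s of None \<Rightarrow> None | Some s' \<Rightarrow> value_orbit t k s')"

text \<open>
  The point \<open>(p, q)\<close> with integral coordinates has a well-defined image under \<open>(\<psi>\<phi>)\<^sup>k\<close>, and this
  differs from \<open>(p, q)\<close> even modulo 53.
\<close>
definition moves :: "rows \<Rightarrow> nat \<Rightarrow> int \<times> int \<Rightarrow> bool" where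
  "moves t k = (\<lambda>(p, q). case value_orbit t k ((p, 1), (q, 1)) of None \<Rightarrow> False
     | Some ((m, n), (m', n')) \<Rightarrow> m mod 53 \<noteq> p * n mod 53 \<or> m' mod 53 \<noteq> q * n' mod 53)"

text \<open>
  For every model with an infinite group whose leading terms are not conclusive, one of these points is
  moved, modulo 53, by the power of \<open>\<psi>\<phi>\<close> that preserves leading terms.
\<close>
definition test_points :: "(int \<times> int) list" where
  "test_points = [(1, 3), (1, 1)]"

text \<open>
  Evaluation is a relation, as a rational function has no value at its poles.
\<close>
definition value_at :: "rat \<times> rat \<Rightarrow> ratfun \<Rightarrow> rat \<Rightarrow> bool" where
  "value_at P f c \<longleftrightarrow> (\<exists>a b. f = to_fract a / to_fract b \<and>
     poly (poly b [:snd P:]) (fst P) \<noteq> 0 \<and>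
     c = poly (poly a [:snd P:]) (fst P) / poly (poly b [:snd P:]) (fst P))"

lemma value_atI:
  "poly (poly b [:snd P:]) (fst P) \<noteq> 0 \<Longrightarrow>
   value_at P (to_fract a / to_fract b) (poly (poly a [:snd P:]) (fst P) / poly (poly b [:snd P:]) (fst P))"
  unfolding value_at_def by blast

lemma value_atE:
  assumes "value_at P f c"
  obtains a b where "f = to_fract a / to_fract b" "b \<noteq> 0" "poly (poly b [:snd P:]) (fst P) \<noteq> 0"
    "c = poly (poly a [:snd P:]) (fst P) / poly (poly b [:snd P:]) (fst P)"
proof -
  obtain a b where *: "f = to_fract a / to_fract b" "poly (poly b [:snd P:]) (fst P) \<noteq> 0"
    "c = poly (poly a [:snd P:]) (fst P) / poly (poly b [:snd P:]) (fst P)"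
    using assms unfolding value_at_def by blast
  moreover have "b \<noteq> 0"
    using *(2) by auto
  ultimately show ?thesis
    using that by blast
qed

lemma value_at_unique: "value_at P f c \<Longrightarrow> value_at P f d \<Longrightarrow> c = d"
proof (elim value_atE)
  fix a b a' b'
  assume 1: "f = to_fract a / to_fract b" "b \<noteq> 0" "poly (poly b [:snd P:]) (fst P) \<noteq> 0"
    "c = poly (poly a [:snd P:]) (fst P) / poly (poly b [:snd P:]) (fst P)"
    and 2: "f = to_fract a' / to_fract b'" "b' \<noteq> 0" "poly (poly b' [:snd P:]) (fst P) \<noteq> 0"
    "d = poly (poly a' [:snd P:]) (fst P) / poly (poly b' [:snd P:]) (fst P)"
  have "to_fract (a * b') = to_fract (a' * b)"
    using 1(1,2) 2(1,2) by (simp add: field_simps)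
  then have "a * b' = a' * b"
    by (simp only: to_fract_eq_iff)
  from arg_cong[OF this, of "\<lambda>p. poly (poly p [:snd P:]) (fst P)"] show "c = d"
    unfolding 1(4) 2(4) using 1(3) 2(3) by (simp add: frac_eq_eq)
qed

lemma value_at_add: "value_at P f c \<Longrightarrow> value_at P g d \<Longrightarrow> value_at P (f + g) (c + d)"
proof (elim value_atE)
  fix a b a' b'
  assume 1: "f = to_fract a / to_fract b" "b \<noteq> 0" "poly (poly b [:snd P:]) (fst P) \<noteq> 0"
    "c = poly (poly a [:snd P:]) (fst P) / poly (poly b [:snd P:]) (fst P)"
    and 2: "g = to_fract a' / to_fract b'" "b' \<noteq> 0" "poly (poly b' [:snd P:]) (fst P) \<noteq> 0"
    "d = poly (poly a' [:snd P:]) (fst P) / poly (poly b' [:snd P:]) (fst P)"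
  have "f + g = to_fract (a * b' + a' * b) / to_fract (b * b')"
    using 1(1,2) 2(1,2) by (simp add: field_simps)
  moreover have "value_at P \<dots> (poly (poly (a * b' + a' * b) [:snd P:]) (fst P) /
      poly (poly (b * b') [:snd P:]) (fst P))"
    using 1(3) 2(3) by (intro value_atI) simp
  moreover have "poly (poly (a * b' + a' * b) [:snd P:]) (fst P) /
      poly (poly (b * b') [:snd P:]) (fst P) = c + d"
    unfolding 1(4) 2(4) using 1(3) 2(3) by (simp add: add_frac_eq)
  ultimately show ?thesis
    by (simp only:)
qed

lemma value_at_mult: "value_at P f c \<Longrightarrow> value_at P g d \<Longrightarrow> value_at P (f * g) (c * d)"
proof (elim value_atE)
  fix a b a' b'
  assume 1: "f = to_fract a / to_fract b" "b \<noteq> 0" "poly (poly b [:snd P:]) (fst P) \<noteq> 0"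
    "c = poly (poly a [:snd P:]) (fst P) / poly (poly b [:snd P:]) (fst P)"
    and 2: "g = to_fract a' / to_fract b'" "b' \<noteq> 0" "poly (poly b' [:snd P:]) (fst P) \<noteq> 0"
    "d = poly (poly a' [:snd P:]) (fst P) / poly (poly b' [:snd P:]) (fst P)"
  have "f * g = to_fract (a * a') / to_fract (b * b')"
    unfolding 1(1) 2(1) by simp
  then show ?thesis
    using 1(3,4) 2(3,4) value_atI[of "b * b'" P "a * a'"] by simp
qed

lemma value_at_inverse: "value_at P f c \<Longrightarrow> c \<noteq> 0 \<Longrightarrow> value_at P (inverse f) (inverse c)"
proof (elim value_atE)
  fix a b
  assume 1: "f = to_fract a / to_fract b" "b \<noteq> 0" "poly (poly b [:snd P:]) (fst P) \<noteq> 0"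
    "c = poly (poly a [:snd P:]) (fst P) / poly (poly b [:snd P:]) (fst P)" and "c \<noteq> 0"
  then have "poly (poly a [:snd P:]) (fst P) \<noteq> 0"
    by auto
  from value_atI[OF this] show ?thesis
    unfolding 1(1,4) by simp
qed

lemma value_at_divide: "value_at P f c \<Longrightarrow> value_at P g d \<Longrightarrow> d \<noteq> 0 \<Longrightarrow> value_at P (f / g) (c / d)"
  by (simp add: divide_inverse value_at_mult value_at_inverse)

lemma value_at_const: "value_at P (const_fun c) c"
  using value_atI[of 1 P "[:[:c:]:]"] by (simp add: const_fun_def)

lemma value_at_of_nat: "value_at P (of_nat n) (of_nat n)"
  using value_at_const[of P "of_nat n"] by (simp add: const_fun_of_nat)

lemma value_at_vars: "value_at P var_x (fst P)" "value_at P var_y (snd P)"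
  using value_atI[of 1 P "[:[:0, 1:]:]"] value_atI[of 1 P "[:0, 1:]"]
  by (simp_all add: var_x_def var_y_def)

lemma value_at_row:
  "value_at P F c \<Longrightarrow> c \<noteq> 0 \<Longrightarrow> value_at P (row p F) (row p c)"
  by (cases p) (simp add: row_def value_at_add value_at_mult value_at_divide value_at_of_nat)

text \<open>
  The value of \<open>F\<close> at \<open>P\<close> is a fraction whose numerator and denominator, not necessarily reduced, are
  congruent to \<open>m\<close> and \<open>n\<close>.
\<close>
definition value_ratio :: "rat \<times> rat \<Rightarrow> ratfun \<Rightarrow> ratio \<Rightarrow> bool" where
  "value_ratio P F = (\<lambda>(m, n). \<not> 53 dvd m \<and> \<not> 53 dvd n \<and>
     (\<exists>m' n'. m' mod 53 = m mod 53 \<and> n' mod 53 = n mod 53 \<and> value_at P F (of_int m' / of_int n')))"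

lemma quad_mod:
  "m' mod 53 = m mod 53 \<Longrightarrow> n' mod 53 = n mod 53 \<Longrightarrow> quad p (m', n') mod 53 = quad p (m, n) mod 53"
  unfolding quad_def split_def by (intro mod_add_cong mod_mult_cong refl) simp_all

lemma row_quad:
  "m \<noteq> 0 \<Longrightarrow> n \<noteq> 0 \<Longrightarrow> row p (of_int m / of_int n :: rat) = of_int (quad p (m, n)) / (of_int m * of_int n)"
  by (cases p) (simp add: row_def quad_def add_divide_distrib)

lemma residue_class_nonzero: "a mod 53 = b mod 53 \<Longrightarrow> \<not> 53 dvd b \<Longrightarrow> a \<noteq> (0::int)"
  by (metis dvd_0_right mod_eq_0_iff_dvd)

lemma value_ratio_step:
  assumes F: "value_ratio P F z" and G: "value_ratio P G w" and step: "value_step p q z w = Some z'"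
  shows "value_ratio P (1 / F * (row p G / row q G)) z'"
proof -
  obtain m n k l where zw: "z = (m, n)" "w = (k, l)"
    by fastforce
  obtain m' n' where mn: "m' mod 53 = m mod 53" "n' mod 53 = n mod 53"
      "value_at P F (of_int m' / of_int n')" "\<not> 53 dvd m" "\<not> 53 dvd n"
    using F unfolding value_ratio_def zw by blast
  obtain k' l' where kl: "k' mod 53 = k mod 53" "l' mod 53 = l mod 53"
      "value_at P G (of_int k' / of_int l')" "\<not> 53 dvd k" "\<not> 53 dvd l"
    using G unfolding value_ratio_def zw by blast
  have nz: "m' \<noteq> 0" "n' \<noteq> 0" "k' \<noteq> 0" "l' \<noteq> 0"
    by (rule residue_class_nonzero, rule mn kl, rule mn kl)+
  define A B where "A = quad p (k', l') * n'" and "B = quad q (k', l') * m'"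
  have A: "A mod 53 = quad p w * n mod 53" and B: "B mod 53 = quad q w * m mod 53"
    unfolding A_def B_def zw by (intro mod_mult_cong quad_mod mn kl)+
  have z': "z' = (A mod 53, B mod 53)" "A mod 53 \<noteq> 0" "B mod 53 \<noteq> 0"
    using step by (auto simp: value_step_def zw A B Let_def split: if_splits)
  then have quad: "quad q (k', l') \<noteq> 0"
    by (auto simp: B_def)
  have "value_at P (1 / F * (row p G / row q G))
     (1 / (of_int m' / of_int n') * (row p (of_int k' / of_int l') / row q (of_int k' / of_int l')))"
    using nz quad mn(3) kl(3) value_at_const[of P 1]
    by (intro value_at_mult value_at_divide value_at_row) (auto simp: row_quad)
  also have "1 / (of_int m' / of_int n') * (row p (of_int k' / of_int l') / row q (of_int k' / of_int l')) =
      (of_int A / of_int B :: rat)"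
    using nz quad by (simp add: row_quad A_def B_def mult.commute)
  finally have "value_at P (1 / F * (row p G / row q G)) (of_int A / of_int B)" .
  then show ?thesis
    unfolding value_ratio_def z'(1) prod.case
    using z'(2,3) by (intro conjI exI[of _ A] exI[of _ B]) (simp_all add: dvd_eq_mod_eq_0)
qed

lemma two_three_powers:
  assumes "(2::rat) powi u * 3 powi v = 1"
  shows "u = 0 \<and> v = 0"
proof -
  have nat: "a = 0 \<and> b = 0 \<and> c = 0 \<and> d = 0"
    if eq: "(2::nat) ^ a * 3 ^ b = 2 ^ c * 3 ^ d" and 0: "a = 0 \<or> c = 0" "b = 0 \<or> d = 0" for a b c d
  proof -
    have "even (2 ^ a * (3::nat) ^ b) \<longleftrightarrow> a > 0" "even (2 ^ c * (3::nat) ^ d) \<longleftrightarrow> c > 0"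
      by auto
    then have ac: "a = 0" "c = 0"
      using eq 0 by auto
    then have "b = d"
      using eq by simp
    then show ?thesis
      using ac 0 by auto
  qed
  have split: "(z::rat) powi w = z ^ nat w / z ^ nat (- w)" if "z \<noteq> 0" for z w
    using that by (auto simp: power_int_def field_simps)
  have "(2::rat) ^ nat u * 3 ^ nat v = 2 ^ nat (- u) * 3 ^ nat (- v)"
    using assms by (simp add: split[of 2 u] split[of 3 v] field_simps)
  then have "of_nat (2 ^ nat u * 3 ^ nat v) = (of_nat (2 ^ nat (- u) * 3 ^ nat (- v)) :: rat)"
    by simp
  then have "2 ^ nat u * 3 ^ nat v = (2 ^ nat (- u) * 3 ^ nat (- v) :: nat)"
    by (simp only: of_nat_eq_iff)
  then have "nat u = 0 \<and> nat v = 0 \<and> nat (- u) = 0 \<and> nat (- v) = 0"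
    by (rule nat) auto
  then show ?thesis
    by auto
qed

section \<open>A criterion for an infinite group\<close>

text \<open>
  The steps \<open>(-1, 1)\<close> and \<open>(1, -1)\<close> occur, and all steps satisfy \<open>i + j \<ge> 0\<close>.
\<close>
definition half_plane :: "rows \<Rightarrow> bool" where
  "half_plane = (\<lambda>((a, b, c), (f, _), (_, d, _), _). a = 0 \<and> b = 0 \<and> d = 0 \<and> c \<noteq> 0 \<and> f \<noteq> 0)"

text \<open>
  Eight turns are enough: in the models concerned the exponents return after 2, 3, 4, 5, 7 or 8 turns.
\<close>
definition infinite_rows :: "rows \<Rightarrow> bool" where
  "infinite_rows t \<longleftrightarrow> half_plane t \<or>
     (case lead_return t 8 0 lead_start of None \<Rightarrow> False
      | Some (n, s) \<Rightarrow> s \<noteq> lead_start \<or> list_ex (moves t n) test_points)"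

context walk_model
begin

definition leads_orbit :: "nat \<Rightarrow> exps \<times> exps \<Rightarrow> bool" where
  "leads_orbit k s \<longleftrightarrow> leads_exps (X k) (fst s) \<and> leads_exps (Y k) (snd s)"

definition entries_small :: bool where
  "entries_small \<longleftrightarrow> (\<forall>p\<in>{x_row M (-1), x_row M 1, y_row M (-1), y_row M 1}. entries_le_3 p)"

lemma leads_orbit_turn:
  assumes entries_small "leads_orbit k s" "lead_turn (rows_of M) s = Some s'"
  shows "leads_orbit (Suc k) s'"
proof -
  obtain A B where s: "s = (A, B)"
    by (cases s)
  have *: "leads_exps (X k) A" "leads_exps (Y k) B"
    using assms(2) by (simp_all add: leads_orbit_def s)
  define A' where "A' = lead_step (x_row M (-1)) (x_row M 1) A B"
  have B: "\<not> constant_exps B" "\<not> constant_exps A'"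
      "s' = (A', lead_step (y_row M (-1)) (y_row M 1) B A')"
    using assms(3) by (auto simp: lead_turn_def rows_of_def s A'_def Let_def split: if_splits)
  have A': "leads_exps (X (Suc k)) A'"
    using leads_exps_step[OF *(1,2) B(1) rows(1) _ rows(2)] assms(1)
    by (simp add: XY_Suc(1) A'_def entries_small_def)
  have "leads_exps (Y (Suc k)) (lead_step (y_row M (-1)) (y_row M 1) B A')"
    unfolding XY_Suc(2)[of k]
    using leads_exps_step[OF *(2) A' B(2) rows(3) _ rows(4)] assms(1)
    by (simp add: entries_small_def)
  with A' show ?thesis
    by (simp add: leads_orbit_def B(3))
qed

lemma leads_orbit_return:
  assumes entries_small
  shows "leads_orbit k s \<Longrightarrow> lead_return (rows_of M) b k s = Some (n, s') \<Longrightarrow>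
     leads_orbit n s' \<and> same_monomials s' \<and> n > 0"
proof (induction b arbitrary: k s)
  case (Suc b)
  then obtain s1 where s1: "lead_turn (rows_of M) s = Some s1"
    by (auto split: option.splits)
  have *: "leads_orbit (Suc k) s1"
    using leads_orbit_turn[OF assms Suc.prems(1) s1] .
  show ?case
  proof (cases "same_monomials s1")
    case True
    then show ?thesis
      using * Suc.prems(2) s1 by auto
  next
    case False
    then show ?thesis
      using Suc.IH[OF *] Suc.prems(2) s1 by auto
  qed
qed simp

definition value_pair :: "rat \<times> rat \<Rightarrow> nat \<Rightarrow> ratio \<times> ratio \<Rightarrow> bool" where
  "value_pair P k s \<longleftrightarrow> value_ratio P (X k) (fst s) \<and> value_ratio P (Y k) (snd s)"

lemma value_pair_turn:
  assumes "value_pair P k s" "value_turn (rows_of M) s = Some s'"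
  shows "value_pair P (Suc k) s'"
proof -
  obtain z w where s: "s = (z, w)"
    by (cases s)
  obtain z' w' where s': "value_step (x_row M (-1)) (x_row M 1) z w = Some z'"
      "value_step (y_row M (-1)) (y_row M 1) w z' = Some w'" "s' = (z', w')"
    using assms(2) by (auto simp: value_turn_def rows_of_def s split: option.splits)
  have "value_ratio P (X (Suc k)) z'"
    using value_ratio_step[OF _ _ s'(1)] assms(1) by (simp add: XY_Suc(1) value_pair_def s)
  moreover from this have "value_ratio P (Y (Suc k)) w'"
    unfolding XY_Suc(2)[of k]
    using value_ratio_step[OF _ _ s'(2)] assms(1) by (simp add: value_pair_def s)
  ultimately show ?thesis
    by (simp add: value_pair_def s'(3))
qed

lemma value_pair_orbit:
  "value_pair P k s \<Longrightarrow> value_orbit (rows_of M) n s = Some s' \<Longrightarrow> value_pair P (k + n) s'"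
proof (induction n arbitrary: k s)
  case (Suc n)
  then obtain s1 where s1: "value_turn (rows_of M) s = Some s1"
    by (auto split: option.splits)
  then show ?case
    using Suc.IH[OF value_pair_turn[OF Suc.prems(1) s1]] Suc.prems(2) by auto
qed simp

lemma moves_orbit:
  assumes "moves (rows_of M) n (p, q)" "\<not> 53 dvd p" "\<not> 53 dvd q"
  shows "orbit (2 * n) \<noteq> (var_x, var_y)"
proof
  assume id: "orbit (2 * n) = (var_x, var_y)"
  define P :: "rat \<times> rat" where "P = (of_int p, of_int q)"
  obtain m k m' k' where s: "value_orbit (rows_of M) n ((p, 1), (q, 1)) = Some ((m, k), (m', k'))"
      and ne: "m mod 53 \<noteq> p * k mod 53 \<or> m' mod 53 \<noteq> q * k' mod 53"
    using assms(1) by (auto simp: moves_def split: option.splits)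
  have "\<exists>m' n'. m' mod 53 = z mod 53 \<and> n' mod 53 = 1 mod 53 \<and> of_int z = (of_int m' / of_int n' :: rat)"
    for z :: int
    by (intro exI[of _ z] exI[of _ 1]) simp
  then have "value_pair P 0 ((p, 1), (q, 1))"
    using assms(2,3) value_at_vars[of P]
    by (simp add: value_pair_def value_ratio_def XY_0 P_def) metis
  from value_pair_orbit[OF this s] have "value_pair P n ((m, k), (m', k'))"
    by simp
  moreover have XY: "X n = var_x" "Y n = var_y"
    using id by (simp_all add: orbit_XY)
  ultimately have ratio: "value_ratio P var_x (m, k)" "value_ratio P var_y (m', k')"
    by (simp_all add: value_pair_def)
  have reduced: "m mod 53 = z * k mod 53"
    if mk: "value_ratio P F (m, k)" and z: "value_at P F (of_int z)" for F m k z
  proof -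
    obtain a b where ab: "a mod 53 = m mod 53" "b mod 53 = k mod 53" "value_at P F (of_int a / of_int b)"
        "\<not> 53 dvd k"
      using mk unfolding value_ratio_def by blast
    have "b \<noteq> 0"
      using ab(2,4) by (rule residue_class_nonzero)
    have "of_int z = (of_int a / of_int b :: rat)"
      by (rule value_at_unique[OF z ab(3)])
    then have "of_int a = (of_int (z * b) :: rat)"
      using \<open>b \<noteq> 0\<close> by (simp add: field_simps)
    then have "a = z * b"
      by (simp only: of_int_eq_iff)
    then show ?thesis
      using ab(1) mod_mult_cong[OF refl ab(2), of z] by simp
  qed
  show False
    using ne reduced[OF ratio(1)] reduced[OF ratio(2)] value_at_vars[of P] by (simp add: P_def)
qed

text \<open>
  At a function \<open>F\<close> whose leading monomial has positive exponent in \<open>y\<close>, the lowest terms of the rows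
  dominate, namely the one in \<open>F\<close> for \<open>A\<^sub>-\<close>, \<open>B\<^sub>-\<close> and the one in \<open>F\<^sup>-\<^sup>1\<close> for \<open>A\<^sub>+\<close>, \<open>B\<^sub>+\<close>. So the involutions act
  on the exponents of \<open>y\<close> by \<open>(k, l) \<mapsto> (2 l - k, l)\<close> and \<open>(k, l) \<mapsto> (k, 2 k - l)\<close>.
  From \<open>(0, 1)\<close> this gives \<open>(2, 1)\<close>, \<open>(2, 3)\<close>, \<open>(4, 3)\<close>, and so on.
\<close>
lemma infinite_half_plane:
  assumes "half_plane (rows_of M)"
  shows "infinite (carrier (model_group M))"
proof (rule infinite_aperiodic)
  obtain b c d e f g h where W: "x_row M (-1) = (0, 0, c)" "x_row M 1 = (f, g, h)"
      "y_row M (-1) = (0, 0, f)" "y_row M 1 = (c, e, h)" "c \<noteq> 0" "f \<noteq> 0"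
    using assms by (auto simp: half_plane_def rows_of_def x_row_def y_row_def)
  have step: "\<exists>r i. leads (1 / F * (row (0, 0, m) G / row (n, n', n'') G)) r i (2 * l - k)"
    if "leads F r i k" "leads G r' i' l" "l > 0" "m \<noteq> 0" "n \<noteq> 0" for F G r r' i i' k l m n n' n''
  proof -
    have "leads (row (0, 0, m) G) (of_nat m * r' powi 1) (1 * i') (1 * l)"
      by (rule leads_row[OF that(2)]) (use that in \<open>auto simp: lex_pos_def low_def\<close>)
    moreover have "leads (row (n, n', n'') G) (of_nat n * r' powi -1) (-1 * i') (-1 * l)"
      by (rule leads_row[OF that(2)]) (use that in \<open>auto simp: lex_pos_def low_def\<close>)
    ultimately have "leads (row (0, 0, m) G / row (n, n', n'') G / F)
        (of_nat m * r' powi 1 / (of_nat n * r' powi -1) / r) (1 * i' - (-1 * i') - i) (1 * l - (-1 * l) - k)"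
      using that(1) by (intro leads_divide)
    then show ?thesis
      by (auto simp: algebra_simps)
  qed
  have "(\<exists>r i. leads (X k) r i (2 * int k)) \<and> (\<exists>r i. leads (Y k) r i (2 * int k + 1))" for k
  proof (induction k)
    case 0
    show ?case
      using leads_var by (auto simp: XY_0)
  next
    case (Suc k)
    then obtain r i r' i' where 1: "leads (X k) r i (2 * int k)" "leads (Y k) r' i' (2 * int k + 1)"
      by blast
    have "\<exists>r i. leads (X (Suc k)) r i (2 * (2 * int k + 1) - 2 * int k)"
      unfolding XY_Suc(1)[of k] W using step[OF 1(1,2)] W by simp
    moreover from this obtain r i where 2: "leads (X (Suc k)) r i (2 * (2 * int k + 1) - 2 * int k)"
      by blast
    have "\<exists>r i. leads (Y (Suc k)) r i (2 * (2 * (2 * int k + 1) - 2 * int k) - (2 * int k + 1))"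
      unfolding XY_Suc(2)[of k] W using step[OF 1(2) 2] W by simp
    ultimately show ?case
      by (simp add: algebra_simps)
  qed
  then show "orbit (2 * k) \<noteq> (var_x, var_y)" if "k > 0" for k
    using that leads_unique[OF leads_var(1)] by (metis Pair_inject orbit_XY(1) mult_eq_0_iff of_nat_eq_0_iff less_irrefl zero_neq_numeral)
qed

theorem infinite_rows_infinite:
  assumes "infinite_rows (rows_of M)" entries_small
  shows "infinite (carrier (model_group M))"
proof (cases "half_plane (rows_of M)")
  case True
  then show ?thesis
    by (rule infinite_half_plane)
next
  case False
  then obtain n s where ret: "lead_return (rows_of M) 8 0 lead_start = Some (n, s)"
    and s: "s \<noteq> lead_start \<or> list_ex (moves (rows_of M) n) test_points"
    using assms(1) by (auto simp: infinite_rows_def split: option.splits)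
  have "leads_orbit 0 lead_start"
    using leads_var by (simp add: leads_orbit_def lead_start_def XY_0 leads_exps_def)
  from leads_orbit_return[OF assms(2) this ret]
  obtain u v u' v' where uv: "s = ((1, 0, u, v), (0, 1, u', v'))" "leads_orbit n s"
    by (auto simp: same_monomials_def)
  have leads: "leads (X n) (2 powi u * 3 powi v) 1 0" "leads (Y n) (2 powi u' * 3 powi v') 0 1"
    using uv by (auto simp: leads_orbit_def leads_exps_def)
  have "orbit (2 * n) \<noteq> (var_x, var_y)"
    using s
  proof
    assume ne: "s \<noteq> lead_start"
    show ?thesis
    proof
      assume "orbit (2 * n) = (var_x, var_y)"
      then have "2 powi u * 3 powi v = (1::rat)" "2 powi u' * 3 powi v' = (1::rat)"
        using leads leads_unique leads_var by (auto simp: orbit_XY)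
      then show False
        using two_three_powers ne by (auto simp: uv(1) lead_start_def)
    qed
  next
    assume "list_ex (moves (rows_of M) n) test_points"
    then show ?thesis
      using moves_orbit by (auto simp: test_points_def)
  qed
  then show ?thesis
    using infinite_periodic_direction[of "2 * n"] leads by (simp add: orbit_XY)
qed

end

section \<open>Which multisets are two-dimensional models\<close>

definition weights :: "(int \<times> int) multiset \<Rightarrow> nat list" where
  "weights M = map (count M) [(-1, -1), (-1, 0), (-1, 1), (0, -1), (0, 1), (1, -1), (1, 0), (1, 1)]"

text \<open>
  The last four alternatives say that \<open>w + \<alpha> i + \<beta> j \<le> 2\<close> for every step \<open>(i, j)\<close> of positive
  multiplicity \<open>w\<close>, where \<open>(\<alpha>, \<beta>)\<close> is \<open>(0, 0)\<close>, \<open>(1, 0)\<close>, \<open>(0, 1)\<close> and \<open>(1, 1)\<close>, respectively: so many third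
  coordinates \<open>k \<le> 1\<close> fit above the plane \<open>k = \<alpha> i + \<beta> j\<close>. (A multiplicity never exceeds 3, which
  is the bound used for \<open>(-1, -1)\<close> in the last alternative.) The conditions on \<open>f + g + h\<close> and
  \<open>c + e + h\<close> allow walks to use steps with a negative coordinate, \<open>e + g + h > 0\<close> lets them leave the
  origin, and the two conditions after it exclude models of dimension at most 1.
\<close>
definition two_dim_weights :: "nat list \<Rightarrow> bool" where
  "two_dim_weights ws = (case ws of [a, b, c, d, e, f, g, h] \<Rightarrow>
     f + g + h > 0 \<and> c + e + h > 0 \<and> e + g + h > 0 \<and>
     (d > 0 \<or> f > 0 \<or> (a > 0 \<and> g > 0)) \<and> (b > 0 \<or> c > 0 \<or> (a > 0 \<and> e > 0)) \<and>
     (list_all (\<lambda>w. w \<le> 2) ws \<or>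
      list_all (\<lambda>w. w \<le> 3) [a, b, c] \<and> list_all (\<lambda>w. w \<le> 2) [d, e] \<and> list_all (\<lambda>w. w \<le> 1) [f, g, h] \<or>
      list_all (\<lambda>w. w \<le> 3) [a, d, f] \<and> list_all (\<lambda>w. w \<le> 2) [b, g] \<and> list_all (\<lambda>w. w \<le> 1) [c, e, h] \<or>
      list_all (\<lambda>w. w \<le> 3) [a, b, d] \<and> list_all (\<lambda>w. w \<le> 2) [c, f] \<and> list_all (\<lambda>w. w \<le> 1) [e, g] \<and> h = 0)
   | _ \<Rightarrow> False)"

abbreviation planar_steps :: "(int \<times> int) set" where
  "planar_steps \<equiv> ({-1, 0, 1} \<times> {-1, 0, 1}) - {(0, 0)}"

lemma planar_steps_explicit:
  "planar_steps = set [(-1, -1), (-1, 0), (-1, 1), (0, -1), (0, 1), (1, -1), (1, 0), (1, 1)]"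
  by auto

lemma coord_simps [simp]:
  "coord 0 (x, y, z) = x" "coord (Suc 0) (x, y, z) = y" "coord 1 (x, y, z) = y" "coord 2 (x, y, z) = z"
  by (simp_all add: coord_def numeral_2_eq_2)

lemma all_less_3: "(\<forall>c<3. P c) \<longleftrightarrow> P 0 \<and> P 1 \<and> P (2::nat)"
  by (auto simp: less_Suc_eq numeral_3_eq_3 numeral_2_eq_2)

lemma model3_finite: "model3 S \<Longrightarrow> finite S"
  unfolding model3_def by (rule finite_subset) auto

lemma model3_bounds:
  "model3 S \<Longrightarrow> (x, y, z) \<in> S \<Longrightarrow> x \<in> {-1, 0, 1} \<and> y \<in> {-1, 0, 1} \<and> z \<in> {-1, 0, 1} \<and> (x, y, z) \<noteq> (0, 0, 0)"
  unfolding model3_def by auto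

lemma projection_set:
  assumes "model3 S"
  shows "set_mset (projection S) \<subseteq> planar_steps"
proof
  fix p assume "p \<in># projection S"
  then obtain x y z where "(x, y, z) \<in> S" "p = (x, y)" "p \<noteq> (0, 0)"
    using model3_finite[OF assms] by (auto simp: projection_def)
  then show "p \<in> planar_steps"
    using model3_bounds[OF assms] by blast
qed

lemma count_projection:
  assumes "model3 S" "(i, j) \<noteq> (0, 0)"
  shows "count (projection S) (i, j) = card {k. (i, j, k) \<in> S}"
proof -
  have fin: "finite S"
    using assms(1) by (rule model3_finite)
  have "count (projection S) (i, j) =
      (\<Sum>s\<in>(\<lambda>(i, j, k). (i, j)) -` {(i, j)} \<inter> S. count (mset_set S) s)"
    unfolding projection_def count_filter_mset
    using assms(2) by (simp only: count_image_mset finite_set_mset_mset_set[OF fin] if_True simp_thms)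
  also have "\<dots> = (\<Sum>s\<in>(\<lambda>(i, j, k). (i, j)) -` {(i, j)} \<inter> S. 1)"
    using fin by (intro sum.cong) simp_all
  also have "\<dots> = card ((\<lambda>(i, j, k). (i, j)) -` {(i, j)} \<inter> S)"
    by simp
  also have "(\<lambda>(i, j, k). (i, j)) -` {(i, j)} \<inter> S = (\<lambda>k. (i, j, k)) ` {k. (i, j, k) \<in> S}"
    by auto
  also have "card \<dots> = card {k. (i, j, k) \<in> S}"
    by (rule card_image) (auto simp: inj_on_def)
  finally show ?thesis .
qed

lemma size_projection: "finite S \<Longrightarrow> size (projection S) \<le> card S"
  using size_filter_mset_lesseq[of "\<lambda>p. p \<noteq> (0, 0)" "image_mset (\<lambda>(i, j, k). (i, j)) (mset_set S)"]
  by (simp add: projection_def)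

lemma sum_weights:
  assumes "set_mset M \<subseteq> planar_steps"
  shows "sum_list (weights M) = size M"
proof -
  have "size M = (\<Sum>p\<in>planar_steps. count M p)"
    using assms by (simp only: size_multiset_overloaded_eq) (intro sum.mono_neutral_left; auto simp: not_in_iff)
  also have "\<dots> = sum_list (weights M)"
    unfolding planar_steps_explicit weights_def by (subst sum_list_distinct_conv_sum_set[symmetric]) auto
  finally show ?thesis by simp
qed

lemma low_lift:
  assumes S: "model3 S" and p: "(i, j) \<noteq> (0, 0)" "count (projection S) (i, j) > 0"
  shows "\<exists>k. (i, j, k) \<in> S \<and> k \<le> 2 - int (count (projection S) (i, j))"
proof (rule ccontr)
  let ?n = "count (projection S) (i, j)"
  assume "\<not> ?thesis"
  then have "{k. (i, j, k) \<in> S} \<subseteq> {2 - int ?n<..1}"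
    using model3_bounds[OF S] by force
  then have "card {k. (i, j, k) \<in> S} \<le> card {2 - int ?n<..1}"
    by (intro card_mono) auto
  then show False
    using p count_projection[OF S p(1)] by simp
qed

lemma count_projection_le_3:
  assumes S: "model3 S" and p: "(i, j) \<noteq> (0, 0)"
  shows "count (projection S) (i, j) \<le> 3"
proof -
  have "{k. (i, j, k) \<in> S} \<subseteq> {-1, 0, 1}"
    using model3_bounds[OF S] by auto
  then have "card {k. (i, j, k) \<in> S} \<le> card {-1, 0, 1::int}"
    by (intro card_mono) auto
  then show ?thesis
    using count_projection[OF assms] by simp
qed

lemma ineqs_suffice_list:
  assumes "finite S" "ineqs_suffice S I" "set L \<subseteq> S" "\<And>c. c \<in> I \<Longrightarrow> 0 \<le> (\<Sum>s\<leftarrow>L. coord c s)" "c < 3"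
  shows "0 \<le> (\<Sum>s\<leftarrow>L. coord c s)"
proof -
  have sum: "(\<Sum>s\<in>S. int (count_list L s) * coord c s) = (\<Sum>s\<leftarrow>L. coord c s)" for c
    using assms(3)
  proof (induction L)
    case (Cons t L)
    have "(\<Sum>s\<in>S. int (count_list (t # L) s) * coord c s) =
        (\<Sum>s\<in>S. int (count_list L s) * coord c s + (if t = s then coord c s else 0))"
      by (intro sum.cong) (simp_all add: algebra_simps)
    also have "\<dots> = (\<Sum>s\<leftarrow>L. coord c s) + coord c t"
      using Cons assms(1) by (simp add: sum.distrib)
    finally show ?case
      by simp
  qed simp
  show ?thesis
    using assms(2,4,5) unfolding ineqs_suffice_def coord_ineq_def sum[symmetric] by blast
qed

text \<open>
  Above a step of multiplicity \<open>n\<close> there is one with third coordinate at most \<open>2 - n\<close>, because only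
  the \<open>n - 1\<close> values \<open>3 - n, \<dots>, 1\<close> are larger. A combination of steps pointing into the quadrant
  must not have negative height, even if its members are lifted as low as possible.
\<close>
lemma lift_bound:
  assumes S: "model3 S" "ineqs_suffice S {0, 1}"
    and L: "set L \<subseteq> set_mset (projection S)" "0 \<le> (\<Sum>p\<leftarrow>L. fst p)" "0 \<le> (\<Sum>p\<leftarrow>L. snd p)"
  shows "0 \<le> (\<Sum>p\<leftarrow>L. 2 - int (count (projection S) p))"
proof -
  have "\<exists>k. (fst p, snd p, k) \<in> S \<and> k \<le> 2 - int (count (projection S) p)" if "p \<in> set L" for p
  proof -
    have "p \<in># projection S"
      using L(1) that by blast
    then show ?thesis
      using low_lift[OF S(1), of "fst p" "snd p"] projection_set[OF S(1)] by (cases p) auto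
  qed
  then obtain k where k: "\<And>p. p \<in> set L \<Longrightarrow> (fst p, snd p, k p) \<in> S"
      "\<And>p. p \<in> set L \<Longrightarrow> k p \<le> 2 - int (count (projection S) p)"
    by metis
  have "0 \<le> (\<Sum>s\<leftarrow>map (\<lambda>p. (fst p, snd p, k p)) L. coord 2 s)"
    by (rule ineqs_suffice_list[OF model3_finite[OF S(1)] S(2)]) (use k(1) L(2,3) in \<open>auto simp: comp_def\<close>)
  also have "\<dots> = (\<Sum>p\<leftarrow>L. k p)"
    by (simp add: comp_def)
  also have "\<dots> \<le> (\<Sum>p\<leftarrow>L. 2 - int (count (projection S) p))"
    by (rule sum_list_mono) (rule k(2))
  finally show ?thesis .
qed

lemma not_suffice_singleton:
  assumes "dimension S = 2" "c < 3"
  shows "\<not> ineqs_suffice S {c}"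
proof
  assume "ineqs_suffice S {c}"
  then have "dim_at_most S 1"
    unfolding dim_at_most_def using assms(2) by (intro exI[of _ "{c}"]) auto
  then show False
    using assms(1) Least_le[of "dim_at_most S" 1] by (simp add: dimension_def)
qed

lemma suffice_mono:
  assumes "finite S" "ineqs_suffice S {0, 1}" "{0, 1} = {c, d}"
    and "\<And>s. s \<in> S \<Longrightarrow> coord d s \<ge> r * coord c s" "r \<ge> 0"
  shows "ineqs_suffice S {c}"
proof -
  have "coord_ineq S a d" if "coord_ineq S a c" for a
  proof -
    have "0 \<le> r * (\<Sum>s\<in>S. int (a s) * coord c s)"
      using that assms(5) by (simp add: coord_ineq_def)
    also have "\<dots> = (\<Sum>s\<in>S. int (a s) * (r * coord c s))"
      by (simp add: sum_distrib_left algebra_simps)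
    also have "\<dots> \<le> (\<Sum>s\<in>S. int (a s) * coord d s)"
      by (intro sum_mono mult_left_mono assms(4)) auto
    finally show ?thesis
      by (simp add: coord_ineq_def)
  qed
  then have "\<forall>c\<in>{0, 1}. coord_ineq S a c" if "coord_ineq S a c" for a
    unfolding assms(3) using that by simp
  then show ?thesis
    using assms(2) unfolding ineqs_suffice_def by blast
qed

lemma walk_partial_sums:
  assumes "octant_walk S w" "w = u @ v" "c < 3"
  shows "0 \<le> (\<Sum>s\<leftarrow>u. coord c s)"
proof -
  have "\<forall>c<3. 0 \<le> (\<Sum>s\<leftarrow>take (length u) w. coord c s)"
    using assms(1,2) unfolding octant_walk_def by (metis length_append le_add1)
  then show ?thesis
    using assms(2,3) by simp
qed

lemma walk_needs_positive_step:
  assumes "octant_walk S w" "s \<in> set w" "coord c s < 0" "c < 3"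
  shows "\<exists>s'\<in>S. coord c s' > 0"
proof (rule ccontr)
  assume "\<not> ?thesis"
  then have le: "\<forall>s'\<in>set w. coord c s' \<le> 0"
    using assms(1) by (force simp: octant_walk_def)
  obtain u v where w: "w = (u @ [s]) @ v"
    using split_list[OF assms(2)] by auto
  have "(\<Sum>s\<leftarrow>u. coord c s) \<le> 0"
    using le w by (intro sum_list_nonpos) auto
  then show False
    using walk_partial_sums[OF assms(1) w assms(4)] assms(3) by simp
qed

text \<open>
  If no step increases \<open>i + j\<close>, then a walk in the quadrant keeps \<open>i = j = 0\<close>.
\<close>
lemma walk_leaves_origin:
  assumes "octant_walk S w" "s \<in> set w" "coord 0 s \<noteq> 0"
  shows "\<exists>s'\<in>S. coord 0 s' + coord 1 s' > 0"
proof (rule ccontr)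
  assume no: "\<not> ?thesis"
  obtain u v where w: "w = u @ s # v"
    using split_list[OF assms(2)] by auto
  have zero: "(\<Sum>s\<leftarrow>u. coord 0 s) = 0" if "w = u @ v" for u v
  proof -
    have "(\<Sum>s\<leftarrow>u. coord 0 s + coord 1 s) \<le> 0"
      using no assms(1) that by (intro sum_list_nonpos) (force simp: octant_walk_def)
    then have "(\<Sum>s\<leftarrow>u. coord 0 s) + (\<Sum>s\<leftarrow>u. coord 1 s) \<le> 0"
      by (simp add: sum_list_addf)
    then show ?thesis
      using walk_partial_sums[OF assms(1) that, of 0] walk_partial_sums[OF assms(1) that, of 1] by simp
  qed
  show False
    using zero[of u "s # v"] zero[of "u @ [s]" v] w assms(3) by simp
qed

text \<open>
  The bounds \<open>two\<close> and \<open>three\<close> stem from combinations of two and three steps. As the multiplicities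
  sum up to at most 6, a multiplicity 3 leaves little room for the others; each of the cases follows one
  step of multiplicity 3 and finds \<open>(\<alpha>, \<beta>)\<close>.
\<close>
lemma weight_cases:
  fixes a b c d e f g h :: nat
  assumes pos: "f + g + h > 0" "c + e + h > 0" "e + g + h > 0" "d > 0 \<or> f > 0 \<or> (a > 0 \<and> g > 0)"
   "b > 0 \<or> c > 0 \<or> (a > 0 \<and> e > 0)"
   and le2: "e \<le> 2" "g \<le> 2" "h \<le> 2" and le3: "a \<le> 3" "b \<le> 3" "c \<le> 3" "d \<le> 3" "f \<le> 3"
   and sum: "a + b + c + d + e + f + g + h \<le> 6"
   and two: "c = 0 \<or> f = 0 \<or> c + f \<le> 4" "c = 0 \<or> g = 0 \<or> c + g \<le> 4" "e = 0 \<or> f = 0 \<or> e + f \<le> 4"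
      "b = 0 \<or> h = 0 \<or> b + h \<le> 4" "c = 0 \<or> h = 0 \<or> c + h \<le> 4" "d = 0 \<or> h = 0 \<or> d + h \<le> 4"
      "f = 0 \<or> h = 0 \<or> f + h \<le> 4"
   and three: "b = 0 \<or> f = 0 \<or> h = 0 \<or> 2 * b + f + h \<le> 8" "c = 0 \<or> d = 0 \<or> h = 0 \<or> c + 2 * d + h \<le> 8"
  shows "(a \<le> 2 \<and> b \<le> 2 \<and> c \<le> 2 \<and> d \<le> 2 \<and> f \<le> 2) \<or> (d \<le> 2 \<and> f \<le> 1 \<and> g \<le> 1 \<and> h \<le> 1) \<or>
    (b \<le> 2 \<and> c \<le> 1 \<and> e \<le> 1 \<and> h \<le> 1) \<or> (c \<le> 2 \<and> f \<le> 2 \<and> e \<le> 1 \<and> g \<le> 1 \<and> h = 0)"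
proof -
  consider "a \<le> 2 \<and> b \<le> 2 \<and> c \<le> 2 \<and> d \<le> 2 \<and> f \<le> 2" | "c = 3" | "f = 3"
    | "b = 3" "c \<le> 2" "f \<le> 2" | "d = 3" "c \<le> 2" "f \<le> 2" | "a = 3" "b \<le> 2" "c \<le> 2" "d \<le> 2" "f \<le> 2"
    using le3 by linarith
  then show ?thesis
  proof cases
    case 1 then show ?thesis by blast
  next
    case 2
    then have "f \<le> 1" "g \<le> 1" "h \<le> 1" "d \<le> 2"
      using two(1,2,5) sum pos(1) by auto
    then show ?thesis by blast
  next
    case 3
    then have "c \<le> 1" "e \<le> 1" "h \<le> 1" "b \<le> 2"
      using two(1,3,7) sum pos(2) by auto
    then show ?thesis by blast
  next
    case 4
    have h: "h \<le> 1" "h = 0 \<or> f \<le> 1"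
      using 4(1) two(4) three(1) by linarith+
    have dg: "d \<le> 2" "g \<le> 1"
      using 4(1) sum pos by linarith+
    show ?thesis
    proof (cases "h = 0 \<and> e \<le> 1")
      case True
      then show ?thesis
        using 4 dg by blast
    next
      case False
      then have "f \<le> 1"
        using 4(1) h sum by linarith
      then show ?thesis
        using h dg by blast
    qed
  next
    case 5
    have h: "h \<le> 1" "h = 0 \<or> c \<le> 1"
      using 5(1) two(6) three(2) by linarith+
    have be: "b \<le> 2" "e \<le> 1"
      using 5(1) sum pos by linarith+
    show ?thesis
    proof (cases "h = 0 \<and> g \<le> 1")
      case True
      then show ?thesis
        using 5 be by blast
    next
      case False
      then have "c \<le> 1"
        using 5(1) h sum by linarith
      then show ?thesis
        using h be by blast
    qed
  next
    case 6
    have h: "h \<le> 1"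
      using 6(1) sum pos by linarith
    show ?thesis
    proof (cases "h = 0 \<and> e \<le> 1 \<and> g \<le> 1")
      case True
      then show ?thesis
        using 6 by blast
    next
      case False
      then have "f \<le> 1 \<and> g \<le> 1 \<or> c \<le> 1 \<and> e \<le> 1"
        using 6(1) sum pos h by linarith
      then show ?thesis
        using 6 h by blast
    qed
  qed
qed
text \<open>
  The steps leaving the half-planes \<open>x \<ge> 0\<close> and \<open>y \<ge> 0\<close> exist as otherwise one inequality would suffice;
  walks using them need steps in the opposite directions.
\<close>
lemma two_dim_weights_necessary:
  assumes "two_dim_model M"
  shows "set_mset M \<subseteq> planar_steps" "sum_list (weights M) \<le> 6" "\<forall>w\<in>set (weights M). w \<le> 3"
    "two_dim_weights (weights M)"
proof -
  obtain S where S: "model3 S" "card S \<le> 6" "nontrivial_model S" "dimension S = 2"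
      "ineqs_suffice S {0, 1}" and M: "M = projection S"
    using assms unfolding two_dim_model_def by blast
  have fin: "finite S"
    using S(1) by (rule model3_finite)
  show sub: "set_mset M \<subseteq> planar_steps"
    unfolding M using S(1) by (rule projection_set)
  show sum: "sum_list (weights M) \<le> 6"
    using sum_weights[OF sub] size_projection[OF fin] S(2) M by simp
  show le3: "\<forall>w\<in>set (weights M). w \<le> 3"
    using count_projection_le_3[OF S(1)] by (auto simp: weights_def M)
  obtain a b c d e f g h where cnt: "a = count M (-1, -1)" "b = count M (-1, 0)" "c = count M (-1, 1)"
    "d = count M (0, -1)" "e = count M (0, 1)" "f = count M (1, -1)" "g = count M (1, 0)" "h = count M (1, 1)"
    by simp
  have ws: "weights M = [a, b, c, d, e, f, g, h]"
    by (simp add: weights_def cnt)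
  have pos: "count M (x, y) > 0" if "(x, y, z) \<in> S" "(x, y) \<noteq> (0, 0)" for x y z
    using that fin by (auto simp: M projection_def intro!: image_eqI[of _ _ "(x, y, z)"])
  have step: "(x = 0 \<and> y = 0) \<or> (x = -1 \<and> y = -1 \<and> a > 0) \<or> (x = -1 \<and> y = 0 \<and> b > 0) \<or>
      (x = -1 \<and> y = 1 \<and> c > 0) \<or> (x = 0 \<and> y = -1 \<and> d > 0) \<or> (x = 0 \<and> y = 1 \<and> e > 0) \<or>
      (x = 1 \<and> y = -1 \<and> f > 0) \<or> (x = 1 \<and> y = 0 \<and> g > 0) \<or> (x = 1 \<and> y = 1 \<and> h > 0)"
    if "(x, y, z) \<in> S" for x y z
  proof -
    have "x = -1 \<or> x = 0 \<or> x = 1" "y = -1 \<or> y = 0 \<or> y = 1"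
      using model3_bounds[OF S(1) that] by blast+
    then show ?thesis
      using pos[OF that] unfolding cnt by (elim disjE) simp_all
  qed
  have used: "\<exists>w. octant_walk S w \<and> s \<in> set w" if "s \<in> S" for s
    using S(3) that by (auto simp: nontrivial_model_def)
  have neg: "\<exists>s\<in>S. coord d s < 0" if "{0, 1} = {c, d}" "c < 3" for c d :: nat
    using suffice_mono[OF fin S(5) that(1), of 0] not_suffice_singleton[OF S(4) that(2)] by force
  have "\<exists>s\<in>S. coord 0 s < 0"
    by (rule neg[of 1]) auto
  then obtain s where s: "s \<in> S" "coord 0 s < 0"
    by blast
  have "\<exists>s\<in>S. coord 1 s < 0"
    by (rule neg[of 0]) auto
  then obtain t where t: "t \<in> S" "coord 1 t < 0"
    by blast
  obtain w where w: "octant_walk S w" "s \<in> set w"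
    using used[OF s(1)] by blast
  obtain w' where w': "octant_walk S w'" "t \<in> set w'"
    using used[OF t(1)] by blast
  have pos1: "f + g + h > 0"
  proof -
    obtain x y z where "(x, y, z) \<in> S" "x > 0"
      using walk_needs_positive_step[OF w s(2)] by auto
    then show ?thesis
      using step by fastforce
  qed
  have pos2: "c + e + h > 0"
  proof -
    obtain x y z where "(x, y, z) \<in> S" "y > 0"
      using walk_needs_positive_step[OF w' t(2)] by auto
    then show ?thesis
      using step by fastforce
  qed
  have pos3: "e + g + h > 0"
  proof -
    obtain x y z where "(x, y, z) \<in> S" "x + y > 0"
      using walk_leaves_origin[OF w] s(2) by auto
    then show ?thesis
      using step by fastforce
  qed
  have pos4: "d > 0 \<or> f > 0 \<or> (a > 0 \<and> g > 0)"
  proof (rule ccontr)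
    assume no: "\<not> ?thesis"
    obtain x y z where xyz: "(x, y, z) \<in> S" "y < 0"
      using t by (cases t) auto
    have "a > 0"
      using step[OF xyz(1)] xyz(2) no by auto
    then have "ineqs_suffice S {0}"
      using no by (intro suffice_mono[OF fin S(5), of 0 1 1]) (auto dest: step)
    then show False
      using not_suffice_singleton[OF S(4)] by simp
  qed
  have pos5: "b > 0 \<or> c > 0 \<or> (a > 0 \<and> e > 0)"
  proof (rule ccontr)
    assume no: "\<not> ?thesis"
    obtain x y z where xyz: "(x, y, z) \<in> S" "x < 0"
      using s by (cases s) auto
    have "a > 0"
      using step[OF xyz(1)] xyz(2) no by auto
    then have "ineqs_suffice S {1}"
      using no by (intro suffice_mono[OF fin S(5), of 1 0 1]) (auto dest: step)
    then show False
      using not_suffice_singleton[OF S(4)] by simp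
  qed
  \<comment> \<open>The combinations that matter are the steps without negative coordinate, and the pairs and
    triples adding up to \<open>(0, 0)\<close>, \<open>(1, 0)\<close>, \<open>(0, 1)\<close>, \<open>(2, 0)\<close>, \<open>(0, 2)\<close>.\<close>
  have bound: "(\<forall>p\<in>set L. count M p > 0) \<and> 0 \<le> (\<Sum>p\<leftarrow>L. fst p) \<and> 0 \<le> (\<Sum>p\<leftarrow>L. snd p) \<longrightarrow>
      0 \<le> (\<Sum>p\<leftarrow>L. 2 - int (count M p))" for L
    using lift_bound[OF S(1,5), folded M, of L] by auto
  have le2: "e \<le> 2" "g \<le> 2" "h \<le> 2"
    using bound[of "[(0, 1)]"] bound[of "[(1, 0)]"] bound[of "[(1, 1)]"]
    by (auto simp flip: cnt simp del: count_greater_zero_iff)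
  have two1: "c = 0 \<or> f = 0 \<or> c + f \<le> 4"
    using bound[of "[(-1, 1), (1, -1)]"] by (auto simp flip: cnt simp del: count_greater_zero_iff)
  have two2: "c = 0 \<or> g = 0 \<or> c + g \<le> 4"
    using bound[of "[(-1, 1), (1, 0)]"] by (auto simp flip: cnt simp del: count_greater_zero_iff)
  have two3: "e = 0 \<or> f = 0 \<or> e + f \<le> 4"
    using bound[of "[(0, 1), (1, -1)]"] by (auto simp flip: cnt simp del: count_greater_zero_iff)
  have two4: "b = 0 \<or> h = 0 \<or> b + h \<le> 4"
    using bound[of "[(-1, 0), (1, 1)]"] by (auto simp flip: cnt simp del: count_greater_zero_iff)
  have two5: "c = 0 \<or> h = 0 \<or> c + h \<le> 4"
    using bound[of "[(-1, 1), (1, 1)]"] by (auto simp flip: cnt simp del: count_greater_zero_iff)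
  have two6: "d = 0 \<or> h = 0 \<or> d + h \<le> 4"
    using bound[of "[(0, -1), (1, 1)]"] by (auto simp flip: cnt simp del: count_greater_zero_iff)
  have two7: "f = 0 \<or> h = 0 \<or> f + h \<le> 4"
    using bound[of "[(1, -1), (1, 1)]"] by (auto simp flip: cnt simp del: count_greater_zero_iff)
  have two8: "b = 0 \<or> f = 0 \<or> h = 0 \<or> 2 * b + f + h \<le> 8"
    using bound[of "[(-1, 0), (-1, 0), (1, -1), (1, 1)]"] by (auto simp flip: cnt simp del: count_greater_zero_iff)
  have two9: "c = 0 \<or> d = 0 \<or> h = 0 \<or> c + 2 * d + h \<le> 8"
    using bound[of "[(-1, 1), (0, -1), (0, -1), (1, 1)]"] by (auto simp flip: cnt simp del: count_greater_zero_iff)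
  have sum6: "a + b + c + d + e + f + g + h \<le> 6"
    and le: "a \<le> 3" "b \<le> 3" "c \<le> 3" "d \<le> 3" "f \<le> 3"
    using sum le3 by (simp_all add: ws)
  have "a \<le> 2 \<and> b \<le> 2 \<and> c \<le> 2 \<and> d \<le> 2 \<and> f \<le> 2 \<or> d \<le> 2 \<and> f \<le> 1 \<and> g \<le> 1 \<and> h \<le> 1 \<or>
      b \<le> 2 \<and> c \<le> 1 \<and> e \<le> 1 \<and> h \<le> 1 \<or> c \<le> 2 \<and> f \<le> 2 \<and> e \<le> 1 \<and> g \<le> 1 \<and> h = 0"
    by (rule weight_cases[OF pos1 pos2 pos3 pos4 pos5 le2 le sum6 two1 two2 two3 two4 two5 two6 two7 two8 two9])
  then show "two_dim_weights (weights M)"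
    using pos1 pos2 pos3 pos4 pos5 le2 le by (auto simp: ws two_dim_weights_def)
qed

definition model_of :: "nat list \<Rightarrow> (int \<times> int) multiset" where
  "model_of ws = (\<Sum>(n, p)\<leftarrow>zip ws [(-1, -1), (-1, 0), (-1, 1), (0, -1), (0, 1), (1, -1), (1, 0), (1, 1)].
     replicate_mset n p)"

definition bounded_lists :: "nat \<Rightarrow> nat \<Rightarrow> nat list set" where
  "bounded_lists k n = {ws. length ws = k \<and> sum_list ws \<le> n \<and> (\<forall>w\<in>set ws. w \<le> 3)}"

abbreviation weight_lists :: "nat list set" where
  "weight_lists \<equiv> bounded_lists 8 6"

lemma length_8E:
  assumes "length ws = 8"
  obtains a b c d e f g h where "ws = [a, b, c, d, e, f, g, h]"
  using assms by (auto simp: length_Suc_conv eval_nat_numeral)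

lemma weights_model_of: "length ws = 8 \<Longrightarrow> weights (model_of ws) = ws"
  by (elim length_8E) (simp add: weights_def model_of_def)

lemma model_of_planar:
  assumes "length ws = 8"
  shows "set_mset (model_of ws) \<subseteq> planar_steps"
  using assms by (elim length_8E) (auto simp: model_of_def split: if_splits)

lemma model_of_weights:
  assumes "set_mset M \<subseteq> planar_steps"
  shows "model_of (weights M) = M"
proof (rule multiset_eqI)
  fix p
  show "count (model_of (weights M)) p = count M p"
  proof (cases "p \<in> planar_steps")
    case True
    then show ?thesis
      unfolding planar_steps_explicit by (auto simp: weights_def model_of_def)
  next
    case False
    have "set_mset (model_of (weights M)) \<subseteq> planar_steps"
      by (rule model_of_planar) (simp add: weights_def)
    then have "p \<notin># M" "p \<notin># model_of (weights M)"
      using False assms by blast+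
    then show ?thesis
      by (simp add: not_in_iff)
  qed
qed

text \<open>
  Lifting the copies of a step to the highest levels available makes the third inequality
  as weak as possible.
\<close>
definition lift :: "(int \<times> int) multiset \<Rightarrow> step3 set" where
  "lift M = (SIGMA i:{-1, 0, 1}. SIGMA j:{-1, 0, 1}. {2 - int (count M (i, j))..1})"

lemma lift_iff:
  "(i, j, k) \<in> lift M \<longleftrightarrow> i \<in> {-1, 0, 1} \<and> j \<in> {-1, 0, 1} \<and> 2 - int (count M (i, j)) \<le> k \<and> k \<le> 1"
  by (auto simp: lift_def)

lemma all_le_Suc: "(\<forall>n\<le>Suc k. P n) \<longleftrightarrow> P 0 \<and> (\<forall>n\<le>k. P (Suc n))"
  by (metis Suc_le_mono le0 not0_implies_Suc)

lemma dimension_2I: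
  assumes "ineqs_suffice S {0, 1}" "\<And>c. c < 3 \<Longrightarrow> \<not> ineqs_suffice S {c}"
  shows "dimension S = 2"
  unfolding dimension_def
proof (rule Least_equality)
  show "dim_at_most S 2"
    unfolding dim_at_most_def using assms(1) by (intro exI[of _ "{0, 1}"]) auto
  fix d assume "dim_at_most S d"
  then obtain I where I: "I \<subseteq> {..<3}" "card I = d" "ineqs_suffice S I"
    unfolding dim_at_most_def by blast
  show "2 \<le> d"
  proof (rule ccontr)
    assume "\<not> 2 \<le> d"
    then have "card I = 0 \<or> card I = 1"
      using I(2) by auto
    moreover have "finite I"
      using I(1) finite_subset by blast
    ultimately have "I = {} \<or> (\<exists>c. I = {c})"
      by (auto simp: card_1_singleton_iff)
    then obtain c where "c < 3" "I \<subseteq> {c}"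
      using I(1) by fastforce
    then have "ineqs_suffice S {c}"
      using I(3) unfolding ineqs_suffice_def by blast
    then show False
      using assms(2) \<open>c < 3\<close> by blast
  qed
qed

text \<open>
  One copy of each step is lifted to level 1. Whichever steps are present, at most three of these
  copies form a walk to a point all of whose coordinates are positive, and any step of the model can be
  appended to it.
\<close>
lemma two_dim_weights_sufficient:
  assumes ws: "ws \<in> weight_lists" "two_dim_weights ws"
  shows "two_dim_model (model_of ws)"
proof -
  obtain a b c d e f g h where abc: "ws = [a, b, c, d, e, f, g, h]"
    using ws(1) by (auto simp: bounded_lists_def elim: length_8E)
  define M where "M = model_of ws"
  define S where "S = lift M"
  have len: "length ws = 8"
    using abc by simp
  have cnt: "count M (-1, -1) = a" "count M (-1, 0) = b" "count M (-1, 1) = c" "count M (0, -1) = d"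
    "count M (0, 1) = e" "count M (1, -1) = f" "count M (1, 0) = g" "count M (1, 1) = h" "count M (0, 0) = 0"
    by (simp_all add: M_def model_of_def abc)
  have le3: "a \<le> 3" "b \<le> 3" "c \<le> 3" "d \<le> 3" "e \<le> 3" "f \<le> 3" "g \<le> 3" "h \<le> 3"
    using ws(1) by (simp_all add: bounded_lists_def abc)
  have S_iff: "(i, j, k) \<in> S \<longleftrightarrow>
      (i, j, k) \<in> {-1, 0, 1} \<times> {-1, 0, 1} \<times> {-1, 0, 1} \<and> 2 - int (count M (i, j)) \<le> k" for i j k
  proof (cases "i \<in> {-1, 0, 1} \<and> j \<in> {-1, 0, 1}")
    case True
    then have "int (count M (i, j)) \<le> 3"
      using le3 by (elim conjE insertE emptyE) (simp_all add: cnt)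
    moreover have "k \<in> {-1, 0, 1} \<longleftrightarrow> -1 \<le> k \<and> k \<le> 1"
      by auto
    ultimately show ?thesis
      unfolding S_def lift_iff mem_Times_iff fst_conv snd_conv
      using conjunct1[OF True] conjunct2[OF True] by force
  next
    case False
    then show ?thesis
      unfolding S_def lift_iff by blast
  qed
  have model: "model3 S"
  proof -
    have "s \<in> {-1, 0, 1} \<times> {-1, 0, 1} \<times> {-1, 0, 1} \<and> s \<noteq> (0, 0, 0)" if "s \<in> S" for s
    proof -
      obtain i j k where s: "s = (i, j, k)"
        by (metis prod.exhaust)
      have "(i, j, k) \<in> {-1, 0, 1} \<times> {-1, 0, 1} \<times> {-1, 0, 1}" "2 - int (count M (i, j)) \<le> k"
        using that S_iff s by blast+
      then show ?thesis
        unfolding s using cnt(9) by auto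
    qed
    then show ?thesis
      unfolding model3_def by blast
  qed
  note fin = model3_finite[OF model]
  have proj: "projection S = M"
  proof (rule multiset_eqI)
    fix p :: "int \<times> int"
    obtain i j where p: "p = (i, j)"
      by (cases p)
    show "count (projection S) p = count M p"
    proof (cases "p \<in> planar_steps")
      case True
      then have "{k. (i, j, k) \<in> S} = {2 - int (count M (i, j))..1}"
        by (auto simp: S_def lift_iff p)
      then show ?thesis
        using count_projection[OF model, of i j] True p by auto
    next
      case False
      then have "p \<notin># projection S" "p \<notin># M"
        using projection_set[OF model] model_of_planar[OF len] unfolding M_def by blast+
      then show ?thesis
        by (simp add: not_in_iff)
    qed
  qed
  have card: "card S \<le> 6"
  proof -
    have "filter_mset (\<lambda>p. p \<noteq> (0, 0)) (image_mset (\<lambda>(i, j, k). (i, j)) (mset_set S)) =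
        image_mset (\<lambda>(i, j, k). (i, j)) (mset_set S)"
      using fin S_iff cnt(9) by (intro filter_mset_eq_conv[THEN iffD2]) auto
    then have "size (projection S) = card S"
      by (simp add: projection_def)
    then show ?thesis
      using proj sum_weights[OF model_of_planar[OF len]] ws(1) weights_model_of[OF len]
      by (simp add: M_def bounded_lists_def)
  qed
  have top: "(i, j, 1) \<in> S" if "count M (i, j) > 0" "i \<in> {-1, 0, 1}" "j \<in> {-1, 0, 1}" for i j
    using that unfolding S_def lift_iff by auto
  note cond = ws(2)[unfolded abc two_dim_weights_def list.case list.pred_inject]
  note cond1 = cond[THEN conjunct1] and cond2 = cond[THEN conjunct2, THEN conjunct1]
    and cond3 = cond[THEN conjunct2, THEN conjunct2, THEN conjunct1]
    and cond4 = cond[THEN conjunct2, THEN conjunct2, THEN conjunct2, THEN conjunct1]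
    and cond5 = cond[THEN conjunct2, THEN conjunct2, THEN conjunct2, THEN conjunct2, THEN conjunct1]
    and cond6 = cond[THEN conjunct2, THEN conjunct2, THEN conjunct2, THEN conjunct2, THEN conjunct2]
  have suffice: "ineqs_suffice S {0, 1}"
  proof -
    have "\<exists>\<alpha> \<beta>. \<alpha> \<ge> 0 \<and> \<beta> \<ge> 0 \<and> (\<forall>(i, j)\<in>set [(-1, -1), (-1, 0), (-1, 1), (0, -1), (0, 0), (0, 1), (1, -1), (1, 0), (1, 1)].
        count M (i, j) > 0 \<longrightarrow> int (count M (i, j)) + \<alpha> * i + \<beta> * j \<le> 2)"
    proof -
      consider "a \<le> 2" "b \<le> 2" "c \<le> 2" "d \<le> 2" "e \<le> 2" "f \<le> 2" "g \<le> 2" "h \<le> 2"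
        | "d \<le> 2" "e \<le> 2" "f \<le> 1" "g \<le> 1" "h \<le> 1"
        | "b \<le> 2" "g \<le> 2" "c \<le> 1" "e \<le> 1" "h \<le> 1"
        | "c \<le> 2" "f \<le> 2" "e \<le> 1" "g \<le> 1" "h = 0"
        using cond6 by (elim disjE) blast+
      then show ?thesis
      proof cases
        case 1
        then show ?thesis
          by (intro exI[of _ 0]) (simp add: cnt)
      next
        case 2
        then show ?thesis
          using le3 by (intro exI[of _ 1] exI[of _ 0]) (simp add: cnt)
      next
        case 3
        then show ?thesis
          using le3 by (intro exI[of _ 0] exI[of _ 1]) (simp add: cnt)
      next
        case 4
        then show ?thesis
          using le3 by (intro exI[of _ 1]) (simp add: cnt)
      qed
    qed
    then obtain \<alpha> \<beta> where \<alpha>\<beta>: "\<alpha> \<ge> 0" "\<beta> \<ge> 0" and dom: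
      "\<forall>(i, j)\<in>set [(-1, -1), (-1, 0), (-1, 1), (0, -1), (0, 0), (0, 1), (1, -1), (1, 0), (1, 1)].
        count M (i, j) > 0 \<longrightarrow> int (count M (i, j)) + \<alpha> * i + \<beta> * j \<le> 2"
      by blast
    have "\<alpha> * i + \<beta> * j \<le> k" if "(i, j, k) \<in> S" for i j k
    proof -
      have ij: "i \<in> {-1, 0, 1}" "j \<in> {-1, 0, 1}" and k: "2 - int (count M (i, j)) \<le> k" "k \<le> 1"
        using that unfolding S_def lift_iff by blast+
      have pos: "count M (i, j) > 0"
        using k by (simp del: count_greater_zero_iff)
      have "(i, j) \<in> set [(-1, -1), (-1, 0), (-1, 1), (0, -1), (0, 0), (0, 1), (1, -1), (1, 0), (1, 1)]"
        using ij by auto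
      from bspec[OF dom this] pos have "int (count M (i, j)) + \<alpha> * i + \<beta> * j \<le> 2"
        by simp
      then show ?thesis
        using k(1) by linarith
    qed
    with \<alpha>\<beta> have "\<exists>\<alpha> \<beta>. \<alpha> \<ge> 0 \<and> \<beta> \<ge> 0 \<and> (\<forall>(i, j, k)\<in>S. \<alpha> * i + \<beta> * j \<le> k)"
      by blast
    then obtain \<alpha> \<beta> where ab: "\<alpha> \<ge> 0" "\<beta> \<ge> 0" "\<And>i j k. (i, j, k) \<in> S \<Longrightarrow> \<alpha> * i + \<beta> * j \<le> k"
      by fast
    have "coord_ineq S t 2" if "coord_ineq S t 0" "coord_ineq S t 1" for t
    proof -
      have "0 \<le> \<alpha> * (\<Sum>s\<in>S. int (t s) * coord 0 s) + \<beta> * (\<Sum>s\<in>S. int (t s) * coord 1 s)"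
        using that ab(1,2) by (simp add: coord_ineq_def)
      also have "\<dots> = (\<Sum>s\<in>S. int (t s) * (\<alpha> * coord 0 s + \<beta> * coord 1 s))"
        by (simp add: sum_distrib_left algebra_simps sum.distrib)
      also have "\<dots> \<le> (\<Sum>s\<in>S. int (t s) * coord 2 s)"
        using ab(3) by (intro sum_mono mult_left_mono) auto
      finally show ?thesis
        by (simp add: coord_ineq_def)
    qed
    then show ?thesis
      unfolding ineqs_suffice_def all_less_3 by simp
  qed
  have not_single: "\<not> ineqs_suffice S {t}" if "t < 3" for t
  proof
    assume suf: "ineqs_suffice S {t}"
    note bad = ineqs_suffice_list[OF fin suf]
    have "t = 0 \<or> t = 1 \<or> t = 2"
      using that by auto
    then show False
    proof (elim disjE)
      assume t: "t = 0"
      consider "d > 0" | "f > 0" | "a > 0" "g > 0"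
        using cond4 by blast
      then show False
      proof cases
        case 1
        then show False
          using bad[of "[(0, -1, 1)]" 1] top[of 0 "-1"] by (simp add: cnt t)
      next
        case 2
        then show False
          using bad[of "[(1, -1, 1)]" 1] top[of 1 "-1"] by (simp add: cnt t)
      next
        case 3
        then show False
          using bad[of "[(-1, -1, 1), (1, 0, 1)]" 1] top[of "-1" "-1"] top[of 1 0] by (simp add: cnt t)
      qed
    next
      assume t: "t = 1"
      consider "b > 0" | "c > 0" | "a > 0" "e > 0"
        using cond5 by blast
      then show False
      proof cases
        case 1
        then show False
          using bad[of "[(-1, 0, 1)]" 0] top[of "-1" 0] by (simp add: cnt t)
      next
        case 2
        then show False
          using bad[of "[(-1, 1, 1)]" 0] top[of "-1" 1] by (simp add: cnt t)
      next
        case 3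
        then show False
          using bad[of "[(-1, -1, 1), (0, 1, 1)]" 0] top[of "-1" "-1"] top[of 0 1] by (simp add: cnt t)
      qed
    next
      assume t: "t = 2"
      consider "b > 0" | "c > 0" | "a > 0"
        using cond5 by blast
      then show False
      proof cases
        case 1
        then show False
          using bad[of "[(-1, 0, 1)]" 0] top[of "-1" 0] by (simp add: cnt t)
      next
        case 2
        then show False
          using bad[of "[(-1, 1, 1)]" 0] top[of "-1" 1] by (simp add: cnt t)
      next
        case 3
        then show False
          using bad[of "[(-1, -1, 1)]" 0] top[of "-1" "-1"] by (simp add: cnt t)
      qed
    qed
  qed
  have dim: "dimension S = 2"
    by (rule dimension_2I[OF suffice not_single])
  have walk: "\<exists>w. octant_walk S w \<and> s \<in> set w" if s: "s \<in> S" for s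
  proof -
    obtain x y z where xyz: "s = (x, y, z)" "x \<ge> -1" "y \<ge> -1" "z \<ge> -1"
      using s S_iff by (cases s) auto
    have walkI: "octant_walk S (u @ [s])"
      if "set u \<subseteq> S" "\<forall>n\<le>length (u @ [s]). \<forall>c<3. 0 \<le> (\<Sum>s\<leftarrow>take n (u @ [s]). coord c s)" for u
      using that s unfolding octant_walk_def by auto
    consider "h > 0" | "g > 0" "e > 0" | "g > 0" "c > 0" | "e > 0" "f > 0"
      using cond1 cond2 cond3 by auto
    then show ?thesis
    proof cases
      case 1
      have "octant_walk S ([(1, 1, 1)] @ [s])"
        by (rule walkI) (use 1 top[of 1 1] xyz in \<open>simp_all add: cnt all_le_Suc all_less_3\<close>)
      then show ?thesis by (rule_tac exI) auto
    next
      case 2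
      have "octant_walk S ([(1, 0, 1), (0, 1, 1)] @ [s])"
        by (rule walkI) (use 2 top[of 1 0] top[of 0 1] xyz in \<open>simp_all add: cnt all_le_Suc all_less_3\<close>)
      then show ?thesis by (rule_tac exI) auto
    next
      case 3
      have "octant_walk S ([(1, 0, 1), (1, 0, 1), (-1, 1, 1)] @ [s])"
        by (rule walkI) (use 3 top[of 1 0] top[of "-1" 1] xyz in \<open>simp_all add: cnt all_le_Suc all_less_3\<close>)
      then show ?thesis by (rule_tac exI) auto
    next
      case 4
      have "octant_walk S ([(0, 1, 1), (0, 1, 1), (1, -1, 1)] @ [s])"
        by (rule walkI) (use 4 top[of 0 1] top[of 1 "-1"] xyz in \<open>simp_all add: cnt all_le_Suc all_less_3\<close>)
      then show ?thesis by (rule_tac exI) auto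
    qed
  qed
  have nontrivial: "nontrivial_model S"
    using dim walk by (simp add: nontrivial_model_def)
  show ?thesis
    unfolding two_dim_model_def
    by (intro exI[of _ S] conjI model card nontrivial dim suffice proj[unfolded M_def, symmetric])
qed

section \<open>Classification and count\<close>

lemma finite_bounded_lists: "finite (bounded_lists k n)"
proof (rule finite_subset)
  show "bounded_lists k n \<subseteq> {ws. set ws \<subseteq> {..3} \<and> length ws = k}"
    by (auto simp: bounded_lists_def)
qed (simp add: finite_lists_length_eq)

text \<open>
  Adds up the indicator of \<open>P\<close> over the members of \<open>bounded_lists k n\<close> followed by \<open>ws\<close>. They are
  generated from the last entry on, and one at a time, so that rewriting never handles a long list.
\<close>
fun tally :: "(nat list \<Rightarrow> bool) \<Rightarrow> nat \<Rightarrow> nat \<Rightarrow> nat list \<Rightarrow> int"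
  and tally_upto :: "(nat list \<Rightarrow> bool) \<Rightarrow> nat \<Rightarrow> nat \<Rightarrow> nat list \<Rightarrow> nat \<Rightarrow> int" where
  "tally P 0 n ws = (if P ws then 1 else 0)"
| "tally P (Suc k) n ws = tally_upto P k n ws (min 3 n)"
| "tally_upto P k n ws 0 = tally P k n (0 # ws)"
| "tally_upto P k n ws (Suc a) = tally_upto P k n ws a + tally P k (n - Suc a) (Suc a # ws)"

lemma tally_upto_sum: "tally_upto P k n ws a = (\<Sum>x\<le>a. tally P k (n - x) (x # ws))"
  by (induction a) simp_all

lemma tally_card: "tally P k n ws = int (card {vs \<in> bounded_lists k n. P (vs @ ws)})"
proof (induction k arbitrary: n ws)
  case 0
  have "{vs \<in> bounded_lists 0 n. P (vs @ ws)} = (if P ws then {[]} else {})"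
    by (auto simp: bounded_lists_def)
  then show ?case
    by simp
next
  case (Suc k)
  let ?B = "\<lambda>x. {vs \<in> bounded_lists k (n - x). P (vs @ x # ws)}"
  have "{vs \<in> bounded_lists (Suc k) n. P (vs @ ws)} = (\<Union>x\<in>{..min 3 n}. (\<lambda>vs. vs @ [x]) ` ?B x)"
  proof (intro equalityI subsetI)
    fix us assume us: "us \<in> {vs \<in> bounded_lists (Suc k) n. P (vs @ ws)}"
    then obtain vs x where vs: "us = vs @ [x]"
      by (cases us rule: rev_cases) (auto simp: bounded_lists_def)
    have "x \<in> {..min 3 n}" "vs \<in> ?B x"
      using us by (auto simp: vs bounded_lists_def)
    then show "us \<in> (\<Union>x\<in>{..min 3 n}. (\<lambda>vs. vs @ [x]) ` ?B x)"
      unfolding vs by blast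
  qed (auto simp: bounded_lists_def)
  also have "card \<dots> = (\<Sum>x\<le>min 3 n. card ((\<lambda>vs. vs @ [x]) ` ?B x))"
    by (rule card_UN_disjoint) (auto simp: finite_bounded_lists)
  also have "\<dots> = (\<Sum>x\<le>min 3 n. card (?B x))"
    by (intro sum.cong card_image) (simp_all add: inj_on_def)
  finally show ?case
    by (simp add: tally_upto_sum Suc.IH)
qed

fun weight_rows :: "nat list \<Rightarrow> rows" where
  "weight_rows [a, b, c, d, e, f, g, h] = ((a, b, c), (f, g, h), (a, d, f), (c, e, h))"
| "weight_rows _ = undefined"

fun swap_weights :: "nat list \<Rightarrow> nat list" where
  "swap_weights [a, b, c, d, e, f, g, h] = [a, d, f, b, g, c, e, h]"
| "swap_weights _ = undefined"

text \<open>
  Exchanging \<open>x\<close> and \<open>y\<close> swaps \<open>(b, c, e)\<close> with \<open>(d, f, g)\<close> and fixes \<open>a\<close> and \<open>h\<close>. One list in each orbit is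
  selected by the lexicographic order of these triples.
\<close>
fun canonical :: "nat list \<Rightarrow> bool" where
  "canonical [a, b, c, d, e, f, g, h] \<longleftrightarrow> b < d \<or> b = d \<and> (c < f \<or> c = f \<and> e \<le> g)"
| "canonical _ = undefined"

lemma weight_rows_weights: "weight_rows (weights M) = rows_of M"
  by (simp add: weights_def rows_of_def x_row_def y_row_def)

lemma weights_exchange: "weights (exchange_xy M) = swap_weights (weights M)"
proof -
  have "count (exchange_xy M) (i, j) = count M (j, i)" for i j
    by (induction M) (auto simp: exchange_xy_def)
  then show ?thesis
    by (simp add: weights_def)
qed

lemma two_dim_weights_pos:
  "two_dim_weights [a, b, c, d, e, f, g, h] \<Longrightarrow>
   (a > 0 \<or> b > 0 \<or> c > 0) \<and> f + g + h > 0 \<and> (a > 0 \<or> d > 0 \<or> f > 0) \<and> c + e + h > 0"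
  unfolding two_dim_weights_def list.case by blast

lemma walk_model_two_dim:
  assumes "two_dim_model M"
  shows "walk_model M" "walk_model.entries_small M"
proof -
  note nec = two_dim_weights_necessary[OF assms]
  show model: "walk_model M"
  proof
    show "small_steps M"
      unfolding small_steps_def using nec(1) by blast
  qed (use two_dim_weights_pos[OF nec(4)[unfolded weights_def list.map]] in
      \<open>auto simp: x_row_def y_row_def\<close>)
  show "walk_model.entries_small M"
    unfolding walk_model.entries_small_def[OF model]
    using nec(3) by (simp add: entries_le_3_def x_row_def y_row_def weights_def)
qed

lemma finite_rows_swap:
  "length ws = 8 \<Longrightarrow> finite_rows (weight_rows (swap_weights ws)) = finite_rows (weight_rows ws)"
  by (elim length_8E) (auto simp: finite_rows_def)

lemma two_dim_weights_swap:
  "length ws = 8 \<Longrightarrow> two_dim_weights (swap_weights ws) = two_dim_weights ws"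
  by (elim length_8E, simp add: two_dim_weights_def add.commute add.left_commute) argo

lemma weight_lists_swap: "ws \<in> weight_lists \<Longrightarrow> swap_weights ws \<in> weight_lists"
  by (auto simp: bounded_lists_def elim!: length_8E)

text \<open>
  Candidates for a counterexample to the classification; there are none.
\<close>
definition unsettled :: "nat list \<Rightarrow> bool" where
  "unsettled ws \<longleftrightarrow> two_dim_weights ws \<and>
     \<not> finite_rows (weight_rows ws) \<and> \<not> infinite_rows (weight_rows ws)"

text \<open>
  The models with an infinite group, one of each pair of models exchanged.
\<close>
definition representative :: "nat list \<Rightarrow> bool" where
  "representative ws \<longleftrightarrow> two_dim_weights ws \<and> canonical ws \<and> \<not> finite_rows (weight_rows ws)"

lemma number_of_unsettled: "tally unsettled 8 6 [] = 0"
  by code_simp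

lemma number_of_representatives: "tally representative 8 6 [] = 409"
  by code_simp

lemma every_model_settled:
  assumes "ws \<in> weight_lists"
  shows "\<not> unsettled ws"
proof -
  have "card {ws \<in> bounded_lists 8 6. unsettled ws} = 0"
    using number_of_unsettled tally_card[of unsettled 8 6 "[]"] by simp
  then have "{ws \<in> bounded_lists 8 6. unsettled ws} = {}"
    using finite_bounded_lists[of 8 6] by (simp only: card_eq_0_iff) simp
  then show ?thesis
    using assms by (auto simp: bounded_lists_def)
qed

text \<open>
  A group is either of order at most 8 or infinite, so the bound 200 separates the two kinds.
\<close>
lemma group_order_dichotomy:
  assumes "two_dim_model M"
  shows "group_order_ge 200 (model_group M) \<longleftrightarrow> \<not> finite_rows (weight_rows (weights M))"
    and "group_order_ge 200 (model_group M) \<Longrightarrow> infinite (carrier (model_group M))"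
proof -
  interpret walk_model M
    using assms by (rule walk_model_two_dim)
  have "weights M \<in> weight_lists"
    using two_dim_weights_necessary[OF assms] by (simp add: bounded_lists_def) (simp add: weights_def)
  then have dich: "finite_rows (rows_of M) \<or> infinite_rows (rows_of M)"
    using every_model_settled two_dim_weights_necessary(4)[OF assms]
    by (auto simp: unsettled_def simp flip: weight_rows_weights)
  have fin: "finite (carrier (model_group M)) \<and> card (carrier (model_group M)) \<le> 8" if "finite_rows (rows_of M)"
    using that by (rule finite_rows_card)
  have inf: "infinite (carrier (model_group M))" if "\<not> finite_rows (rows_of M)"
    using dich that infinite_rows_infinite walk_model_two_dim(2)[OF assms] by blast
  show "group_order_ge 200 (model_group M) \<longleftrightarrow> \<not> finite_rows (weight_rows (weights M))"
    using fin inf by (auto simp: group_order_ge_def weight_rows_weights)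
  then show "group_order_ge 200 (model_group M) \<Longrightarrow> infinite (carrier (model_group M))"
    using inf by (simp add: weight_rows_weights)
qed

lemma two_dim_model_iff:
  "two_dim_model M \<longleftrightarrow> (\<exists>ws\<in>weight_lists. two_dim_weights ws \<and> M = model_of ws)"
proof
  assume M: "two_dim_model M"
  note nec = two_dim_weights_necessary[OF M]
  have "weights M \<in> weight_lists"
    using nec(2,3) by (simp add: bounded_lists_def) (simp add: weights_def)
  then show "\<exists>ws\<in>weight_lists. two_dim_weights ws \<and> M = model_of ws"
    using nec(4) model_of_weights[OF nec(1)] by metis
qed (auto intro: two_dim_weights_sufficient)

theorem theorem1:
  shows "card {{M, exchange_xy M} | M.
             two_dim_model M \<and> group_order_ge 200 (model_group M)} = 409 \<and>
         (\<forall>M. two_dim_model M \<and> group_order_ge 200 (model_group M) \<longrightarrow>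
            infinite (carrier (model_group M)))"
proof
  define A where "A = {ws\<in>weight_lists. two_dim_weights ws \<and> \<not> finite_rows (weight_rows ws)}"
  define B where "B = {ws\<in>A. canonical ws}"
  define orb where "orb ws = {model_of ws, model_of (swap_weights ws)}" for ws
  have len: "length ws = 8" if "ws \<in> A" for ws
    using that by (simp add: A_def bounded_lists_def)
  have swap: "swap_weights ws \<in> A" if "ws \<in> A" for ws
    using that len[OF that] by (simp add: A_def weight_lists_swap two_dim_weights_swap finite_rows_swap)
  have swap2: "swap_weights (swap_weights ws) = ws" if "ws \<in> A" for ws
    using len[OF that] by (elim length_8E) simp
  have exchange: "exchange_xy (model_of ws) = model_of (swap_weights ws)" if "ws \<in> A" for ws
  proof -
    have "set_mset (exchange_xy (model_of ws)) \<subseteq> planar_steps"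
    proof
      fix p assume "p \<in># exchange_xy (model_of ws)"
      then obtain q where q: "q \<in># model_of ws" "p = prod.swap q"
        unfolding exchange_xy_def by auto
      have "q \<in> planar_steps"
        using model_of_planar[OF len[OF that]] q(1) by (rule subsetD)
      then show "p \<in> planar_steps"
        unfolding q(2) by (cases q) auto
    qed
    then have "exchange_xy (model_of ws) = model_of (weights (exchange_xy (model_of ws)))"
      by (simp add: model_of_weights)
    then show ?thesis
      using len[OF that] by (simp add: weights_exchange weights_model_of)
  qed
  have "{M. two_dim_model M \<and> group_order_ge 200 (model_group M)} = model_of ` A"
  proof (intro equalityI subsetI)
    fix M assume "M \<in> {M. two_dim_model M \<and> group_order_ge 200 (model_group M)}"
    then show "M \<in> model_of ` A"
      using group_order_dichotomy(1)[of M] unfolding two_dim_model_iff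
      by (auto simp: A_def bounded_lists_def weights_model_of)
  next
    fix M assume "M \<in> model_of ` A"
    then obtain ws where ws: "ws \<in> A" "M = model_of ws"
      by blast
    then have "two_dim_model M"
      by (simp add: A_def two_dim_weights_sufficient)
    then show "M \<in> {M. two_dim_model M \<and> group_order_ge 200 (model_group M)}"
      using ws len[OF ws(1)] group_order_dichotomy(1)[of M] by (simp add: A_def weights_model_of)
  qed
  then have "{{M, exchange_xy M} | M. two_dim_model M \<and> group_order_ge 200 (model_group M)} =
      (\<lambda>M. {M, exchange_xy M}) ` model_of ` A"
    by (simp only: setcompr_eq_image)
  also have "\<dots> = orb ` A"
    unfolding image_image by (rule image_cong) (simp_all add: exchange orb_def)
  also have "\<dots> = orb ` B"
  proof (intro equalityI subsetI)
    fix X assume "X \<in> orb ` A"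
    then obtain ws where ws: "ws \<in> A" "X = orb ws"
      by blast
    have "canonical ws \<or> canonical (swap_weights ws)"
      using len[OF ws(1)] by (elim length_8E) auto
    moreover have "orb (swap_weights ws) = orb ws"
      using swap2[OF ws(1)] by (auto simp: orb_def)
    ultimately show "X \<in> orb ` B"
      using ws swap by (auto simp: B_def)
  qed (auto simp: B_def)
  also have "card \<dots> = card B"
  proof (rule card_image, rule inj_onI)
    fix u v assume uv: "u \<in> B" "v \<in> B" "orb u = orb v"
    have inj: "x = y" if "x \<in> A" "y \<in> A" "model_of x = model_of y" for x y
      using that len weights_model_of by metis
    have A: "u \<in> A" "v \<in> A" and can: "canonical u" "canonical v"
      using uv by (auto simp: B_def)
    have "model_of u = model_of v \<or> model_of u = model_of (swap_weights v)"
      using uv(3) by (auto simp: orb_def)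
    then have "u = v \<or> u = swap_weights v"
      using inj A swap by blast
    moreover have "u = v" if "u = swap_weights v"
      using len[OF A(2)] can that by (elim length_8E) auto
    ultimately show "u = v"
      by blast
  qed
  also have "card B = 409"
  proof -
    have "B = {ws \<in> bounded_lists 8 6. representative (ws @ [])}"
      by (auto simp: B_def A_def bounded_lists_def representative_def)
    then have "int (card B) = 409"
      using number_of_representatives tally_card[of representative 8 6 "[]"] by simp
    then show ?thesis
      by simp
  qed
  finally show "card {{M, exchange_xy M} | M.
      two_dim_model M \<and> group_order_ge 200 (model_group M)} = 409" .
  show "\<forall>M. two_dim_model M \<and> group_order_ge 200 (model_group M) \<longrightarrow> infinite (carrier (model_group M))"
    using group_order_dichotomy(2) by blast
qed

end
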